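(* Let $(E,d)$ be a Polish space with $d$ bounded by $d_\infty$ over $E\times E$, and let $N\geq1$. Let $(q(x,\cdot))_{x\in E}$ be a measurable kernel of finite non-negative measures on $E$, $\beta:E\to\mathbb{R}_+$ a measurable function and $(P_x)_{x\in E}$ a Markovian kernel on $E$. Consider the non-explosive pure jump particle system on $E^N$ in which, when the configuration is $\bar x=(x_1,\ldots,x_N)$, each particle $i$ jumps from $x_i$ according to the jump measure $F(x_i,\bar x,\cdot)$, where $$F(x,\bar{x},dz)=q(x,dz)+\frac{\beta(x)}{N}\sum_{j=1}^N P_{x_j}(dz).$$ Set $\theta_*=\inf_{x\neq y\in E}\theta_P(x,y)\in[0,1]$. Then the coarse Ricci curvature $\sigma$ of this particle system satisfies $$\sigma\geq -(1-\theta_* )\|\beta\|_\infty-\sup_{x\neq y}\ \left(\frac{J_d^{x,y}(q(x,\cdot),q(y,\cdot))}{d(x,y)}+\frac{|\beta(x)-\beta(y)|}{d(x,y)}d_\infty-\beta(x)\vee \beta(y)\right).$$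
   Context: $E^N$ is endowed with $d(\bar x,\bar y)=\frac1N\sum_{i=1}^N d(x_i,y_i)$. The generator of the particle system is $\mathcal{L} f(\bar x)=\sum_{i=1}^N \int_E \bigl(f(x_1,\ldots,x_{i-1},z,x_{i+1},\ldots,x_N)-f(\bar x)\bigr)F(x_i,\bar{x},dz)$. $\|\beta\|_\infty=\sup_E\beta$ and $a\vee b=\max(a,b)$. For non-negative measures $\mu,\nu$ with the same finite mass, $\mathcal{W}_d(\mu,\nu)=\inf_\pi\int d(u,v)\,\pi(du,dv)$, the infimum being over non-negative measures $\pi$ on the product space with marginals $\mu$ and $\nu$. $\theta_P(x,y)=1-\mathcal{W}_d(P_x,P_y)/d(x,y)$ for $x\neq y$ (discrete-time coarse Ricci curvature of $P$); as in the paper, $\theta_*$ is taken to lie in $[0,1]$. For $x,y\in E$ and finite non-negative measures $m_1,m_2$ on $E$, $$J_{d}^{x,y}(m_1,m_2)=\mathcal{W}_d\bigl(m_1+m_2(E)\delta_x,\ m_2+m_1(E)\delta_y\bigr)-\bigl(m_1(E)+m_2(E)\bigr)d(x,y).$$ The coarse Ricci curvature of a Markov process $\bar X$ on $E^N$ is the largest $\sigma\in[-\infty,+\infty]$ such that, for all $t\geq0$ and all $\bar x,\bar y\in E^N$, $\mathcal{W}_d\bigl(\mathbb{P}(\bar X_t\in\cdot\mid\bar X_0=\bar x),\mathbb{P}(\bar X_t\in\cdot\mid\bar X_0=\bar y)\bigr)\leq e^{-\sigma t}d(\bar x,\bar y)$. *)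

theory Defs
  imports "HOL-Probability.Probability" "HOL-Real_Asymp.Real_Asymp"
begin

definition sum_measure :: "'b measure \<Rightarrow> ('i \<Rightarrow> 'b measure) \<Rightarrow> 'i set \<Rightarrow> 'b measure" where
  "sum_measure S \<mu> I = measure_of (space S) (sets S) (\<lambda>A. \<Sum>i\<in>I. emeasure (\<mu> i) A)"

definition plus_measure :: "'b measure \<Rightarrow> 'b measure \<Rightarrow> 'b measure" (infixl \<open>\<oplus>\<^sub>\<mu>\<close> 65) where
  "\<mu> \<oplus>\<^sub>\<mu> \<nu> = measure_of (space \<mu>) (sets \<mu>) (\<lambda>A. emeasure \<mu> A + emeasure \<nu> A)"

lemma sets_sum_measure [simp, measurable_cong]: "sets (sum_measure S \<mu> I) = sets S"
  and space_sum_measure [simp]: "space (sum_measure S \<mu> I) = space S"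
  by (simp_all add: sum_measure_def)

lemma sets_plus_measure [simp, measurable_cong]: "sets (\<mu> \<oplus>\<^sub>\<mu> \<nu>) = sets \<mu>"
  and space_plus_measure [simp]: "space (\<mu> \<oplus>\<^sub>\<mu> \<nu>) = space \<mu>"
  by (simp_all add: plus_measure_def)

lemma emeasure_sum_measure:
  assumes "\<And>i. i \<in> I \<Longrightarrow> sets (\<mu> i) = sets S" "A \<in> sets S"
  shows "emeasure (sum_measure S \<mu> I) A = (\<Sum>i\<in>I. emeasure (\<mu> i) A)"
  unfolding sum_measure_def
proof (rule emeasure_measure_of_sigma)
  show "countably_additive (sets S) (\<lambda>A. \<Sum>i\<in>I. emeasure (\<mu> i) A)"
  proof (rule countably_additiveI)
    fix B :: "nat \<Rightarrow> 'b set"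
    assume B: "range B \<subseteq> sets S" "disjoint_family B"
    have "(\<Sum>n. \<Sum>i\<in>I. emeasure (\<mu> i) (B n)) = (\<Sum>i\<in>I. \<Sum>n. emeasure (\<mu> i) (B n))"
      by (rule suminf_sum) auto
    also have "\<dots> = (\<Sum>i\<in>I. emeasure (\<mu> i) (\<Union>n. B n))"
      using B assms(1) by (intro sum.cong refl suminf_emeasure) auto
    finally show "(\<Sum>n. \<Sum>i\<in>I. emeasure (\<mu> i) (B n)) = (\<Sum>i\<in>I. emeasure (\<mu> i) (\<Union>n. B n))" .
  qed
qed (use assms in \<open>auto simp: positive_def sets.sigma_algebra_axioms\<close>)

lemma emeasure_plus_measure:
  assumes "sets \<nu> = sets \<mu>" "A \<in> sets \<mu>"
  shows "emeasure (\<mu> \<oplus>\<^sub>\<mu> \<nu>) A = emeasure \<mu> A + emeasure \<nu> A"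
proof -
  have "\<mu> \<oplus>\<^sub>\<mu> \<nu> = sum_measure \<mu> (\<lambda>b. if b then \<mu> else \<nu>) UNIV"
    by (simp add: plus_measure_def sum_measure_def UNIV_bool add.commute)
  then show ?thesis
    using assms by (simp add: emeasure_sum_measure UNIV_bool add.commute)
qed

definition couplings :: "'b measure \<Rightarrow> 'c measure \<Rightarrow> ('b \<times> 'c) measure set" where
  "couplings \<mu> \<nu> = {\<pi>. sets \<pi> = sets (\<mu> \<Otimes>\<^sub>M \<nu>) \<and> distr \<pi> \<mu> fst = \<mu> \<and> distr \<pi> \<nu> snd = \<nu>}"

definition wasserstein :: "('b \<Rightarrow> 'b \<Rightarrow> real) \<Rightarrow> 'b measure \<Rightarrow> 'b measure \<Rightarrow> ennreal" where
  "wasserstein d \<mu> \<nu> = (INF \<pi> \<in> couplings \<mu> \<nu>. \<integral>\<^sup>+(u, v). ennreal (d u v) \<partial>\<pi>)"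

definition discrete_curvature ::
    "('a::metric_space \<Rightarrow> 'a measure) \<Rightarrow> 'a \<Rightarrow> 'a \<Rightarrow> ereal" where
  "discrete_curvature P x y =
     1 - enn2ereal (wasserstein dist (P x) (P y)) / ereal (dist x y)"

definition J_functional ::
    "'a::metric_space \<Rightarrow> 'a \<Rightarrow> 'a measure \<Rightarrow> 'a measure \<Rightarrow> ereal" where
  "J_functional x y m\<^sub>1 m\<^sub>2 =
     enn2ereal (wasserstein dist
       (m\<^sub>1 \<oplus>\<^sub>\<mu> scale_measure (emeasure m\<^sub>2 UNIV) (return borel x))
       (m\<^sub>2 \<oplus>\<^sub>\<mu> scale_measure (emeasure m\<^sub>1 UNIV) (return borel y)))
     - ereal ((measure m\<^sub>1 UNIV + measure m\<^sub>2 UNIV) * dist x y)"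

text \<open>\<open>exp_decay \<sigma> t\<close> is \<open>exp (- \<sigma> * t)\<close> for \<open>t \<ge> 0\<close>, with \<open>\<plusminus>\<infinity> * 0 = 0\<close> in the exponent.\<close>

definition exp_decay :: "ereal \<Rightarrow> real \<Rightarrow> ennreal" where
  "exp_decay \<sigma> t = (case \<sigma> of
      ereal s \<Rightarrow> ennreal (exp (- s * t))
    | PInfty \<Rightarrow> if t = 0 then 1 else 0
    | MInfty \<Rightarrow> if t = 0 then 1 else \<infinity>)"

lemma exp_decay_simps [simp]:
  "exp_decay (ereal s) t = ennreal (exp (- s * t))"
  "exp_decay \<infinity> t = (if t = 0 then 1 else 0)"
  "exp_decay (- \<infinity>) t = (if t = 0 then 1 else \<infinity>)"
  by (simp_all add: exp_decay_def)

definition contracts_at_rate ::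
    "('s \<Rightarrow> 's \<Rightarrow> real) \<Rightarrow> (real \<Rightarrow> 's \<Rightarrow> 's measure) \<Rightarrow> ereal \<Rightarrow> bool" where
  "contracts_at_rate d law \<sigma> \<longleftrightarrow>
     (\<forall>t\<ge>0. \<forall>x y. wasserstein d (law t x) (law t y) \<le> exp_decay \<sigma> t * ennreal (d x y))"

text \<open>
  \<open>law t x\<close> stands for the law at time \<open>t\<close> of the process started from \<open>x\<close>. The supremum is a
  maximum, see \<open>contracts_at_coarse_ricci_curvature\<close> below.
\<close>

definition coarse_ricci_curvature ::
    "('s \<Rightarrow> 's \<Rightarrow> real) \<Rightarrow> (real \<Rightarrow> 's \<Rightarrow> 's measure) \<Rightarrow> ereal" where
  "coarse_ricci_curvature d law = Sup {\<sigma>. contracts_at_rate d law \<sigma>}"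

lemma exp_decay_0: "exp_decay \<sigma> 0 = 1"
  by (cases \<sigma>) auto

lemma exp_decay_le:
  assumes "t > 0" "ereal s < \<sigma>"
  shows "exp_decay \<sigma> t \<le> ennreal (exp (- s * t))"
  using assms by (cases \<sigma>) (auto intro!: ennreal_leI)

lemma contracts_at_coarse_ricci_curvature:
  assumes "contracts_at_rate d law \<sigma>"
  shows "contracts_at_rate d law (coarse_ricci_curvature d law)"
  unfolding contracts_at_rate_def
proof (intro allI impI)
  fix t :: real and x y
  assume "t \<ge> 0"
  let ?A = "{\<sigma>. contracts_at_rate d law \<sigma>}"
  let ?W = "wasserstein d (law t x) (law t y)"
  have A: "?W \<le> exp_decay a t * ennreal (d x y)" if "a \<in> ?A" for a
    using that \<open>t \<ge> 0\<close> by (auto simp: contracts_at_rate_def)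
  show "?W \<le> exp_decay (coarse_ricci_curvature d law) t * ennreal (d x y)"
  proof (cases "t = 0")
    case True
    then show ?thesis using A[of \<sigma>] assms by (simp add: exp_decay_0)
  next
    case False
    with \<open>t \<ge> 0\<close> have t: "t > 0" by simp
    have lower: "?W \<le> ennreal (exp (- s * t)) * ennreal (d x y)"
      if s: "ereal s < Sup ?A" for s
    proof -
      obtain a where a: "a \<in> ?A" "ereal s < a"
        using s by (auto simp: less_Sup_iff)
      show ?thesis
        using A[OF a(1)] mult_right_mono[OF exp_decay_le[OF t a(2)], of "ennreal (d x y)"]
        by (meson order_trans zero_le)
    qed
    have limit: "?W \<le> ennreal L * ennreal (d x y)"
      if s: "\<And>n. ereal (s n) < Sup ?A" and L: "(\<lambda>n. exp (- s n * t)) \<longlonglongrightarrow> L"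
      for s :: "nat \<Rightarrow> real" and L
    proof (rule tendsto_lowerbound)
      show "(\<lambda>n. ennreal (exp (- s n * t)) * ennreal (d x y)) \<longlonglongrightarrow> ennreal L * ennreal (d x y)"
        using L by (intro tendsto_mult_ennreal tendsto_ennrealI tendsto_const) auto
      show "\<forall>\<^sub>F n in sequentially. ?W \<le> ennreal (exp (- s n * t)) * ennreal (d x y)"
        using lower[OF s] by simp
    qed simp
    show ?thesis
    proof (cases "Sup ?A")
      case (real r)
      have "(\<lambda>n. exp (- (r - 1 / real (Suc n)) * t)) \<longlonglongrightarrow> exp (- (r - 0) * t)"
        by (intro tendsto_intros LIMSEQ_Suc[OF lim_1_over_n])
      from limit[OF _ this] show ?thesis
        using real by (simp add: coarse_ricci_curvature_def)
    next
      case PInf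
      have "(\<lambda>n. exp (- real n * t)) \<longlonglongrightarrow> 0"
        using t by real_asymp
      from limit[OF _ this] show ?thesis
        using PInf t by (simp add: coarse_ricci_curvature_def)
    next
      case MInf
      then have "\<sigma> = - \<infinity>"
        using assms Sup_upper[of \<sigma> ?A] by simp
      then show ?thesis
        using A[of \<sigma>] assms MInf by (simp add: coarse_ricci_curvature_def)
    qed
  qed
qed

text \<open>
  A non-explosive pure jump process \<open>X\<close> with jump kernel \<open>\<Lambda>\<close>, started at \<open>x\<^sub>0\<close>, described by its
  jump times \<open>T n\<close> (with \<open>T n = \<infinity>\<close> if there are fewer than \<open>n\<close> jumps) and its successive positions
  \<open>Y n\<close>. Conditionally on the first \<open>n\<close> jumps, the next holding time is exponential with parameter
  \<open>\<lambda>\<close>, the total mass of \<open>\<Lambda> (Y n)\<close>, and the next position is independent of it with law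
  \<open>\<Lambda> (Y n) / \<lambda>\<close>. If \<open>\<lambda> = 0\<close>, the right-hand side of \<open>next_jump\<close> is \<open>0\<close> by the conventions
  \<open>x / 0 = x * \<infinity>\<close> and \<open>0 * \<infinity> = 0\<close> of \<^typ>\<open>ennreal\<close>, so \<open>T (Suc n) = \<infinity>\<close> almost surely.
\<close>

locale nonexplosive_jump_process = prob_space M
  for M :: "'w measure" +
  fixes S :: "'s measure" and \<Lambda> :: "'s \<Rightarrow> 's measure" and x\<^sub>0 :: 's
    and T :: "nat \<Rightarrow> 'w \<Rightarrow> ereal" and Y :: "nat \<Rightarrow> 'w \<Rightarrow> 's" and X :: "real \<Rightarrow> 'w \<Rightarrow> 's"
  assumes measurable_T: "\<And>n. T n \<in> borel_measurable M"
    and measurable_Y: "\<And>n. Y n \<in> measurable M S"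
    and measurable_X: "\<And>t. t \<ge> 0 \<Longrightarrow> X t \<in> measurable M S"
    and initial: "AE \<omega> in M. T 0 \<omega> = 0 \<and> Y 0 \<omega> = x\<^sub>0"
    and increasing: "\<And>n. AE \<omega> in M. T n \<omega> < T (Suc n) \<omega> \<or> (T n \<omega> = \<infinity> \<and> T (Suc n) \<omega> = \<infinity>)"
    and nonexplosive: "AE \<omega> in M. (\<lambda>n. T n \<omega>) \<longlonglongrightarrow> \<infinity>"
    and next_jump: "\<And>n B A t. B \<in> sets (\<Pi>\<^sub>M k\<in>{..n}. borel \<Otimes>\<^sub>M S) \<Longrightarrow> A \<in> sets S \<Longrightarrow> t \<ge> 0 \<Longrightarrow>
      emeasure M {\<omega> \<in> space M. (\<lambda>k\<in>{..n}. (T k \<omega>, Y k \<omega>)) \<in> B \<and>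
          T n \<omega> + ereal t < T (Suc n) \<omega> \<and> T (Suc n) \<omega> < \<infinity> \<and> Y (Suc n) \<omega> \<in> A} =
      (\<integral>\<^sup>+\<omega>. indicator B (\<lambda>k\<in>{..n}. (T k \<omega>, Y k \<omega>)) * indicator {..<\<infinity>} (T n \<omega>) *
          ennreal (exp (- measure (\<Lambda> (Y n \<omega>)) (space S) * t)) *
          (emeasure (\<Lambda> (Y n \<omega>)) A / emeasure (\<Lambda> (Y n \<omega>)) (space S)) \<partial>M)"
    and path: "\<And>n t. t \<ge> 0 \<Longrightarrow>
      AE \<omega> in M. T n \<omega> \<le> ereal t \<and> ereal t < T (Suc n) \<omega> \<longrightarrow> X t \<omega> = Y n \<omega>"

text \<open>
  Configurations of \<open>N = CARD('n)\<close> particles are functions \<open>'n \<Rightarrow> 'a\<close>. For a separable metric space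
  \<open>'a\<close> the product \<open>\<sigma>\<close>-algebra is the Borel \<open>\<sigma>\<close>-algebra of \<open>config_dist\<close>.
\<close>

abbreviation config_space :: "('n::finite \<Rightarrow> 'a::metric_space) measure" where
  "config_space \<equiv> \<Pi>\<^sub>M i\<in>UNIV. borel"

definition config_dist :: "('n::finite \<Rightarrow> 'a::metric_space) \<Rightarrow> ('n \<Rightarrow> 'a) \<Rightarrow> real" where
  "config_dist x y = 1 / real CARD('n) * (\<Sum>i\<in>UNIV. dist (x i) (y i))"

definition interaction_kernel ::
    "('a::metric_space \<Rightarrow> 'a measure) \<Rightarrow> ('a \<Rightarrow> real) \<Rightarrow> ('a \<Rightarrow> 'a measure) \<Rightarrow>
     'a \<Rightarrow> ('n::finite \<Rightarrow> 'a) \<Rightarrow> 'a measure" where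
  "interaction_kernel q \<beta> P x xs =
     q x \<oplus>\<^sub>\<mu> scale_measure (ennreal (\<beta> x / real CARD('n))) (sum_measure borel (\<lambda>j. P (xs j)) UNIV)"

definition particle_kernel ::
    "('a::metric_space \<Rightarrow> ('n::finite \<Rightarrow> 'a) \<Rightarrow> 'a measure) \<Rightarrow> ('n \<Rightarrow> 'a) \<Rightarrow> ('n \<Rightarrow> 'a) measure" where
  "particle_kernel F xs =
     sum_measure config_space (\<lambda>i. distr (F (xs i) xs) config_space (\<lambda>z. xs(i := z))) UNIV"

lemma measurable_fun_upd_config:
  "(\<lambda>z. xs(i := z)) \<in> measurable borel (config_space :: ('n::finite \<Rightarrow> 'a::metric_space) measure)"
proof (rule measurable_PiM_single')
  fix k :: 'n assume "k \<in> UNIV"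
  show "(\<lambda>z. (xs(i := z)) k) \<in> borel_measurable borel" by (cases "k = i") auto
qed (auto simp: space_PiM)

lemma nn_integral_sum_measure:
  assumes "finite I" "\<And>i. i \<in> I \<Longrightarrow> sets (\<mu> i) = sets S" "f \<in> borel_measurable S"
  shows "(\<integral>\<^sup>+x. f x \<partial>sum_measure S \<mu> I) = (\<Sum>i\<in>I. \<integral>\<^sup>+x. f x \<partial>\<mu> i)"
proof -
  have meas: "g \<in> borel_measurable (\<mu> i)"
    if "i \<in> I" "g \<in> borel_measurable S" for i and g :: "_ \<Rightarrow> ennreal"
    using that(2) measurable_cong_sets[OF assms(2)[OF that(1)] refl, of borel] by blast
  show ?thesis
    using assms(3)
  proof (induction rule: borel_measurable_induct)
    case (cong f g)
    have "(\<integral>\<^sup>+x. g x \<partial>\<mu> i) = (\<integral>\<^sup>+x. f x \<partial>\<mu> i)" if "i \<in> I" for i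
      using cong(3) sets_eq_imp_space_eq[OF assms(2)[OF that]] by (intro nn_integral_cong) auto
    moreover have "(\<integral>\<^sup>+x. g x \<partial>sum_measure S \<mu> I) = (\<integral>\<^sup>+x. f x \<partial>sum_measure S \<mu> I)"
      using cong(3) by (intro nn_integral_cong) auto
    ultimately show ?case using cong by simp
  next
    case (set A)
    then show ?case using assms(2) by (simp add: emeasure_sum_measure)
  next
    case (mult u c)
    then show ?case using meas by (simp add: nn_integral_cmult sum_distrib_left)
  next
    case (add u v)
    then show ?case using meas by (simp add: nn_integral_add sum.distrib)
  next
    case (seq U)
    have "(\<integral>\<^sup>+x. (SUP n. U n) x \<partial>sum_measure S \<mu> I) = (\<integral>\<^sup>+x. (SUP n. U n x) \<partial>sum_measure S \<mu> I)"
      by (simp add: SUP_apply image_comp o_def)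
    also have "\<dots> = (SUP n. \<integral>\<^sup>+x. U n x \<partial>sum_measure S \<mu> I)"
      by (rule nn_integral_monotone_convergence_SUP) (use seq in auto)
    also have "\<dots> = (SUP n. \<Sum>i\<in>I. \<integral>\<^sup>+x. U n x \<partial>\<mu> i)"
      using seq by simp
    also have "\<dots> = (\<Sum>i\<in>I. SUP n. \<integral>\<^sup>+x. U n x \<partial>\<mu> i)"
    proof (rule ennreal_SUP_sum)
      fix i
      show "incseq (\<lambda>n. \<integral>\<^sup>+x. U n x \<partial>\<mu> i)"
        using seq(3) by (auto simp: incseq_def le_fun_def intro!: nn_integral_mono)
    qed
    also have "\<dots> = (\<Sum>i\<in>I. \<integral>\<^sup>+x. (SUP n. U n) x \<partial>\<mu> i)"
    proof (rule sum.cong[OF refl])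
      fix i assume i: "i \<in> I"
      have "(\<integral>\<^sup>+x. (SUP n. U n x) \<partial>\<mu> i) = (SUP n. \<integral>\<^sup>+x. U n x \<partial>\<mu> i)"
        by (rule nn_integral_monotone_convergence_SUP[OF seq(3) meas[OF i seq(1)]])
      then show "(SUP n. \<integral>\<^sup>+x. U n x \<partial>\<mu> i) = (\<integral>\<^sup>+x. (SUP n. U n) x \<partial>\<mu> i)"
        by (simp add: SUP_apply image_comp o_def)
    qed
    finally show ?case .
  qed
qed

text \<open>
  A process with jump kernel \<open>particle_kernel F\<close> has the generator of the system in which the
  particle \<open>i\<close> jumps from \<open>xs i\<close> to \<open>z\<close> with intensity \<open>F (xs i) xs\<close>.
\<close>

lemma particle_generator:
  fixes f :: "('n::finite \<Rightarrow> 'a::metric_space) \<Rightarrow> real"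
  assumes F: "\<And>i. sets (F (xs i) xs) = sets borel" "\<And>i. finite_measure (F (xs i) xs)"
    and f: "f \<in> borel_measurable config_space" and bound: "\<And>z. \<bar>f z\<bar> \<le> c"
  shows "(\<integral>z. (f z - f xs) \<partial>particle_kernel F xs) =
    (\<Sum>i\<in>UNIV. \<integral>z. (f (xs(i := z)) - f xs) \<partial>F (xs i) xs)"
proof -
  have upd: "(\<lambda>z. xs(i := z)) \<in> measurable (F (xs i) xs) config_space" for i
    using measurable_fun_upd_config[of xs i] measurable_cong_sets[OF F(1) refl] by blast
  define g where "g z = f z - f xs" for z
  have g [measurable]: "g \<in> borel_measurable config_space"
    unfolding g_def using f by measurable
  have gb: "\<bar>g z\<bar> \<le> 2 * c" for z
    using bound[of z] bound[of xs] unfolding g_def by linarith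
  have gi: "(\<lambda>z. g (xs(i := z))) \<in> borel_measurable (F (xs i) xs)" for i
    using measurable_compose[OF upd g] .
  have int_i: "integrable (F (xs i) xs) (\<lambda>z. g (xs(i := z)))" for i
    using gb by (intro finite_measure.integrable_const_bound[OF F(2), of _ "2 * c"] gi) auto
  have nn: "(\<integral>\<^sup>+z. h z \<partial>particle_kernel F xs) = (\<Sum>i\<in>UNIV. \<integral>\<^sup>+z. h (xs(i := z)) \<partial>F (xs i) xs)"
    if "h \<in> borel_measurable config_space" for h
    unfolding particle_kernel_def using that upd
    by (subst nn_integral_sum_measure) (auto simp: nn_integral_distr)
  have fin: "(\<integral>\<^sup>+z. ennreal (h (g (xs(i := z)))) \<partial>F (xs i) xs) \<noteq> \<infinity>"
    if "\<And>u. h u \<le> \<bar>u\<bar>" for h i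
  proof -
    have "(\<integral>\<^sup>+z. ennreal (h (g (xs(i := z)))) \<partial>F (xs i) xs)
        \<le> (\<integral>\<^sup>+z. ennreal (norm (g (xs(i := z)))) \<partial>F (xs i) xs)"
      using that by (intro nn_integral_mono ennreal_leI) auto
    also have "\<dots> < \<infinity>"
      using int_i by (simp add: integrable_iff_bounded)
    finally show ?thesis by simp
  qed
  have int: "integrable (particle_kernel F xs) g"
  proof (rule integrableI_bounded)
    show "g \<in> borel_measurable (particle_kernel F xs)"
      unfolding particle_kernel_def using g by simp
    have "(\<integral>\<^sup>+z. ennreal (norm (g z)) \<partial>particle_kernel F xs) =
        (\<Sum>i\<in>UNIV. \<integral>\<^sup>+z. ennreal (norm (g (xs(i := z)))) \<partial>F (xs i) xs)"
      by (rule nn) measurable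
    also have "\<dots> < \<infinity>"
      using int_i by (simp add: integrable_iff_bounded)
    finally show "(\<integral>\<^sup>+z. ennreal (norm (g z)) \<partial>particle_kernel F xs) < \<infinity>" .
  qed
  have "(\<integral>z. g z \<partial>particle_kernel F xs) =
      enn2real (\<Sum>i\<in>UNIV. \<integral>\<^sup>+z. ennreal (g (xs(i := z))) \<partial>F (xs i) xs) -
      enn2real (\<Sum>i\<in>UNIV. \<integral>\<^sup>+z. ennreal (- g (xs(i := z))) \<partial>F (xs i) xs)"
    unfolding real_lebesgue_integral_def[OF int] by (subst (1 2) nn) measurable
  also have "\<dots> = (\<Sum>i\<in>UNIV. \<integral>z. g (xs(i := z)) \<partial>F (xs i) xs)"
    using fin[of "\<lambda>u. u"] fin[of "\<lambda>u. - u"]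
    by (subst (1 2) enn2real_sum)
      (simp_all add: less_top real_lebesgue_integral_def[OF int_i] sum_subtractf)
  finally show ?thesis unfolding g_def .
qed

end

theory Submission
  imports Defs
begin

text \<open>
  Let \<open>\<Lambda>\<close> be the jump kernel of the particle system and \<open>\<lambda>\<close> its total mass. Moving the particles with the same
  index together, with almost optimal couplings of the \<open>q\<close>-parts and of the \<open>P\<close>-parts, couples
  \<open>\<Lambda> x + (r - \<lambda> x) \<delta>\<^sub>x\<close> and \<open>\<Lambda> y + (r - \<lambda> y) \<delta>\<^sub>y\<close> at cost at most \<open>(r - \<kappa>) d(x, y) + \<epsilon>\<close>, where
  \<open>\<kappa>\<close> is the claimed lower bound and \<open>r \<ge> \<lambda> x + \<lambda> y\<close>.

  The rates are not bounded, so one first freezes the process when it leaves \<open>G = {\<lambda> \<le> R}\<close>. On \<open>G\<close> it is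
  uniformized: a discrete chain observed at a Poisson time of mean \<open>r t\<close>. The static couplings, chosen
  measurably up to an arbitrarily small error, yield a coupling of two such chains whose expected distance
  on \<open>G \<times> G\<close> is at most \<open>exp (- \<kappa> t) d(x, y)\<close> plus a small error. By Duhamel's formula the frozen
  semigroup \<open>u\<close> satisfies the backward equation with rates \<open>\<lambda>\<close>, hence \<open>u (t - T n) (Y n)\<close>, evaluated along the
  jump process up to time \<open>t\<close>, telescopes; since the process does not explode, \<open>u t x A\<close> is the probability
  that \<open>X t \<in> A\<close> and that the process has not left \<open>G\<close>. This tends to the law of \<open>X t\<close> as \<open>R\<close> grows, and the
  missing mass is coupled independently, at a cost of at most \<open>d_inf\<close> times that mass.
\<close>

section \<open>Couplings and their costs\<close>

text \<open>The constant is already visible for one pair of particles at a and b. With m = min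
  (\<beta> a) (\<beta> b): the q-parts, topped up with point masses so that one particle may jump
  while the other stays, cost what J measures; mean-field jumps are matched at rate m; the excess
  rate |\<beta> a - \<beta> b| costs at most d_inf per unit; and mass m stays put on both sides.
  Subtracting the total rate times d(a, b) leaves - max (\<beta> a) (\<beta> b) times d(a, b),
  because \<beta> a + \<beta> b - m is the maximum. A mean-field jump lands at a distance governed
  by the whole configuration, so \<theta> enters through an average over labels and not through the
  supremum over pairs.

  The obstacle is that the hypotheses describe each process alone, on its own probability space, by
  the laws of its jumps; no coupled process and no semigroup is given. So all couplings are built
  from kernels, and the processes enter only through their laws at time t.\<close>

lemma emeasure_distr_proj:
  assumes "sets \<pi> = sets (\<mu> \<Otimes>\<^sub>M \<nu>)"
  shows "A \<in> sets \<mu> \<Longrightarrow> emeasure (distr \<pi> \<mu> fst) A = emeasure \<pi> (A \<times> space \<nu>)"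
    and "B \<in> sets \<nu> \<Longrightarrow> emeasure (distr \<pi> \<nu> snd) B = emeasure \<pi> (space \<mu> \<times> B)"
proof -
  have sp: "space \<pi> = space \<mu> \<times> space \<nu>"
    using sets_eq_imp_space_eq[OF assms] by (simp add: space_pair_measure)
  have m: "fst \<in> measurable \<pi> \<mu>" "snd \<in> measurable \<pi> \<nu>"
    by (simp_all add: measurable_cong_sets[OF assms refl])
  have "A \<in> sets \<mu> \<Longrightarrow> fst -` A \<inter> space \<pi> = A \<times> space \<nu>" "B \<in> sets \<nu> \<Longrightarrow> snd -` B \<inter> space \<pi> = space \<mu> \<times> B"
    using sets.sets_into_space by (fastforce simp: sp)+
  then show "A \<in> sets \<mu> \<Longrightarrow> emeasure (distr \<pi> \<mu> fst) A = emeasure \<pi> (A \<times> space \<nu>)"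
    "B \<in> sets \<nu> \<Longrightarrow> emeasure (distr \<pi> \<nu> snd) B = emeasure \<pi> (space \<mu> \<times> B)"
    by (simp_all add: emeasure_distr[OF m(1)] emeasure_distr[OF m(2)])
qed

lemma couplings_sets: "\<pi> \<in> couplings \<mu> \<nu> \<Longrightarrow> sets \<pi> = sets (\<mu> \<Otimes>\<^sub>M \<nu>)"
  by (simp add: couplings_def)

lemma couplings_space: "\<pi> \<in> couplings \<mu> \<nu> \<Longrightarrow> space \<pi> = space \<mu> \<times> space \<nu>"
  by (drule couplings_sets, drule sets_eq_imp_space_eq) (simp add: space_pair_measure)

lemma couplings_emeasure:
  assumes "\<pi> \<in> couplings \<mu> \<nu>"
  shows "A \<in> sets \<mu> \<Longrightarrow> emeasure \<pi> (A \<times> space \<nu>) = emeasure \<mu> A"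
    and "B \<in> sets \<nu> \<Longrightarrow> emeasure \<pi> (space \<mu> \<times> B) = emeasure \<nu> B"
  using assms emeasure_distr_proj[OF couplings_sets[OF assms]] by (simp_all add: couplings_def)

lemma couplingsI:
  assumes "sets \<pi> = sets (\<mu> \<Otimes>\<^sub>M \<nu>)"
    and "\<And>A. A \<in> sets \<mu> \<Longrightarrow> emeasure \<pi> (A \<times> space \<nu>) = emeasure \<mu> A"
    and "\<And>B. B \<in> sets \<nu> \<Longrightarrow> emeasure \<pi> (space \<mu> \<times> B) = emeasure \<nu> B"
  shows "\<pi> \<in> couplings \<mu> \<nu>"
  using assms by (auto simp: couplings_def emeasure_distr_proj intro!: measure_eqI)

abbreviation transport_cost :: "('b \<Rightarrow> 'c \<Rightarrow> real) \<Rightarrow> ('b \<times> 'c) measure \<Rightarrow> ennreal" where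
  "transport_cost d \<pi> \<equiv> \<integral>\<^sup>+(u, v). ennreal (d u v) \<partial>\<pi>"

text \<open>Unlike the infimum in \<open>wasserstein\<close>, this provides a coupling that can be
  scaled, added and mapped. Attainment of the infimum is avoided by allowing an error
  \<open>e > 0\<close> wherever a bound comes from a Wasserstein distance.\<close>

definition transport_le :: "('b \<Rightarrow> 'c \<Rightarrow> real) \<Rightarrow> 'b measure \<Rightarrow> 'c measure \<Rightarrow> ennreal \<Rightarrow> bool" where
  "transport_le d \<mu> \<nu> c \<longleftrightarrow> (\<exists>\<pi>\<in>couplings \<mu> \<nu>. transport_cost d \<pi> \<le> c)"

lemma transport_leE:
  assumes "transport_le d \<mu> \<nu> c"
  obtains \<pi> where "\<pi> \<in> couplings \<mu> \<nu>" "transport_cost d \<pi> \<le> c"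
  using assms by (auto simp: transport_le_def)

lemma transport_le_mono: "transport_le d \<mu> \<nu> c \<Longrightarrow> c \<le> c' \<Longrightarrow> transport_le d \<mu> \<nu> c'"
  by (auto simp: transport_le_def intro: order_trans)

lemma transport_le_wasserstein:
  assumes "wasserstein d \<mu> \<nu> < c"
  shows "transport_le d \<mu> \<nu> c"
  using assms by (auto simp: wasserstein_def transport_le_def INF_less_iff intro: less_imp_le)

lemma wasserstein_le_transport: "transport_le d \<mu> \<nu> c \<Longrightarrow> wasserstein d \<mu> \<nu> \<le> c"
  by (auto simp: transport_le_def wasserstein_def intro: INF_lower2)

lemma nn_integral_plus_measure:
  assumes "sets \<nu> = sets \<mu>" "f \<in> borel_measurable \<mu>"
  shows "(\<integral>\<^sup>+x. f x \<partial>(\<mu> \<oplus>\<^sub>\<mu> \<nu>)) = (\<integral>\<^sup>+x. f x \<partial>\<mu>) + (\<integral>\<^sup>+x. f x \<partial>\<nu>)"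
proof -
  have "\<mu> \<oplus>\<^sub>\<mu> \<nu> = sum_measure \<mu> (\<lambda>b. if b then \<mu> else \<nu>) UNIV"
    by (simp add: plus_measure_def sum_measure_def UNIV_bool add.commute)
  then show ?thesis
    using assms by (simp add: nn_integral_sum_measure UNIV_bool add.commute)
qed

lemma pair_measure_couplings:
  assumes "prob_space \<mu>" "prob_space \<nu>"
  shows "\<mu> \<Otimes>\<^sub>M \<nu> \<in> couplings \<mu> \<nu>"
proof -
  interpret \<mu>: prob_space \<mu> by fact
  interpret \<nu>: prob_space \<nu> by fact
  show ?thesis
    by (rule couplingsI) (simp_all add: \<nu>.emeasure_pair_measure_Times \<mu>.emeasure_space_1 \<nu>.emeasure_space_1)
qed

lemma couplings_scale:
  assumes \<pi>: "\<pi> \<in> couplings \<mu> \<nu>"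
  shows "scale_measure c \<pi> \<in> couplings (scale_measure c \<mu>) (scale_measure c \<nu>)"
proof (rule couplingsI)
  show "sets (scale_measure c \<pi>) = sets (scale_measure c \<mu> \<Otimes>\<^sub>M scale_measure c \<nu>)"
    using couplings_sets[OF \<pi>] by (simp cong: sets_pair_measure_cong)
  have sp: "space (scale_measure c \<mu>) = space \<mu>" "space (scale_measure c \<nu>) = space \<nu>"
    by (auto intro!: sets_eq_imp_space_eq)
  show "emeasure (scale_measure c \<pi>) (A \<times> space (scale_measure c \<nu>)) = emeasure (scale_measure c \<mu>) A"
    if "A \<in> sets (scale_measure c \<mu>)" for A
    using couplings_emeasure(1)[OF \<pi>, of A] that by (simp add: sp)
  show "emeasure (scale_measure c \<pi>) (space (scale_measure c \<mu>) \<times> A) = emeasure (scale_measure c \<nu>) A"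
    if "A \<in> sets (scale_measure c \<nu>)" for A
    using couplings_emeasure(2)[OF \<pi>, of A] that by (simp add: sp)
qed

context
  fixes S :: "'b measure" and R :: "'c measure" and d :: "'b \<Rightarrow> 'c \<Rightarrow> real"
  assumes d [measurable]: "(\<lambda>(u, v). d u v) \<in> borel_measurable (S \<Otimes>\<^sub>M R)"
begin

lemma coupling_cost_measurable:
  assumes "\<pi> \<in> couplings \<mu> \<nu>" "sets \<mu> = sets S" "sets \<nu> = sets R"
  shows "sets \<pi> = sets (S \<Otimes>\<^sub>M R)" "(\<lambda>(u, v). ennreal (d u v)) \<in> borel_measurable \<pi>"
proof -
  show s: "sets \<pi> = sets (S \<Otimes>\<^sub>M R)"
    using couplings_sets[OF assms(1)] assms(2,3) by (simp cong: sets_pair_measure_cong)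
  show "(\<lambda>(u, v). ennreal (d u v)) \<in> borel_measurable \<pi>"
    by (simp add: measurable_cong_sets[OF s refl])
qed

lemma transport_le_scale:
  assumes "transport_le d \<mu> \<nu> c" and s: "sets \<mu> = sets S" "sets \<nu> = sets R"
  shows "transport_le d (scale_measure a \<mu>) (scale_measure a \<nu>) (a * c)"
proof -
  obtain \<pi> where \<pi>: "\<pi> \<in> couplings \<mu> \<nu>" "transport_cost d \<pi> \<le> c"
    using assms(1) by (rule transport_leE)
  note m = coupling_cost_measurable(2)[OF \<pi>(1) s]
  have "transport_cost d (scale_measure a \<pi>) \<le> a * c"
    using \<pi>(2) by (subst nn_integral_scale_measure[OF m]) (intro mult_left_mono, auto)
  then show ?thesis using couplings_scale[OF \<pi>(1)] by (auto simp: transport_le_def)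
qed

lemma transport_le_sum:
  assumes "finite I" and tr: "\<And>i. i \<in> I \<Longrightarrow> transport_le d (\<mu> i) (\<nu> i) (c i)"
    and s: "\<And>i. i \<in> I \<Longrightarrow> sets (\<mu> i) = sets S" "\<And>i. i \<in> I \<Longrightarrow> sets (\<nu> i) = sets R"
  shows "transport_le d (sum_measure S \<mu> I) (sum_measure R \<nu> I) (\<Sum>i\<in>I. c i)"
proof -
  have "\<exists>\<pi>. \<forall>i\<in>I. \<pi> i \<in> couplings (\<mu> i) (\<nu> i) \<and> transport_cost d (\<pi> i) \<le> c i"
    using tr unfolding transport_le_def by (intro bchoice) blast
  then obtain \<pi> where \<pi>: "\<And>i. i \<in> I \<Longrightarrow> \<pi> i \<in> couplings (\<mu> i) (\<nu> i)"
    and cost: "\<And>i. i \<in> I \<Longrightarrow> transport_cost d (\<pi> i) \<le> c i" by blast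
  have s\<pi>: "sets (\<pi> i) = sets (S \<Otimes>\<^sub>M R)" if "i \<in> I" for i
    using coupling_cost_measurable(1)[OF \<pi>[OF that]] s that by simp
  have sp: "space (\<mu> i) = space S" "space (\<nu> i) = space R" if "i \<in> I" for i
    using s[OF that] by (auto dest: sets_eq_imp_space_eq)
  have "sum_measure (S \<Otimes>\<^sub>M R) \<pi> I \<in> couplings (sum_measure S \<mu> I) (sum_measure R \<nu> I)"
  proof (rule couplingsI)
    show "sets (sum_measure (S \<Otimes>\<^sub>M R) \<pi> I) = sets (sum_measure S \<mu> I \<Otimes>\<^sub>M sum_measure R \<nu> I)"
      by (simp cong: sets_pair_measure_cong)
    show "emeasure (sum_measure (S \<Otimes>\<^sub>M R) \<pi> I) (A \<times> space (sum_measure R \<nu> I)) = emeasure (sum_measure S \<mu> I) A"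
      if "A \<in> sets (sum_measure S \<mu> I)" for A
      using that couplings_emeasure(1)[OF \<pi>] by (simp add: emeasure_sum_measure s\<pi> s sp)
    show "emeasure (sum_measure (S \<Otimes>\<^sub>M R) \<pi> I) (space (sum_measure S \<mu> I) \<times> A) = emeasure (sum_measure R \<nu> I) A"
      if "A \<in> sets (sum_measure R \<nu> I)" for A
      using that couplings_emeasure(2)[OF \<pi>] by (simp add: emeasure_sum_measure s\<pi> s sp)
  qed
  moreover have "transport_cost d (sum_measure (S \<Otimes>\<^sub>M R) \<pi> I) \<le> (\<Sum>i\<in>I. c i)"
    using \<open>finite I\<close> cost by (subst nn_integral_sum_measure) (auto simp: s\<pi> intro!: sum_mono)
  ultimately show ?thesis by (auto simp: transport_le_def)
qed

lemma transport_le_plus: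
  assumes "transport_le d \<mu> \<nu> a" "transport_le d \<mu>' \<nu>' b"
    and s: "sets \<mu> = sets S" "sets \<mu>' = sets S" "sets \<nu> = sets R" "sets \<nu>' = sets R"
  shows "transport_le d (\<mu> \<oplus>\<^sub>\<mu> \<mu>') (\<nu> \<oplus>\<^sub>\<mu> \<nu>') (a + b)"
proof -
  \<comment> \<open>Addition is the sum over the index type \<open>bool\<close>, so
    \<open>transport_le_sum\<close> applies.\<close>
  have eq: "\<mu> \<oplus>\<^sub>\<mu> \<mu>' = sum_measure S (\<lambda>b. if b then \<mu> else \<mu>') UNIV" "\<nu> \<oplus>\<^sub>\<mu> \<nu>' = sum_measure R (\<lambda>b. if b then \<nu> else \<nu>') UNIV"
    using s sets_eq_imp_space_eq[OF s(1)] sets_eq_imp_space_eq[OF s(3)]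
    by (simp_all add: plus_measure_def sum_measure_def UNIV_bool add.commute)
  have "transport_le d (sum_measure S (\<lambda>b. if b then \<mu> else \<mu>') UNIV) (sum_measure R (\<lambda>b. if b then \<nu> else \<nu>') UNIV)
      (\<Sum>x\<in>UNIV. if x then a else b)"
    using assms by (intro transport_le_sum) auto
  then show ?thesis unfolding eq by (simp add: UNIV_bool add.commute)
qed

lemma transport_le_return:
  assumes "x \<in> space S" "y \<in> space R"
  shows "transport_le d (return S x) (return R y) (ennreal (d x y))"
proof -
  have "return (S \<Otimes>\<^sub>M R) (x, y) \<in> couplings (return S x) (return R y)"
    using assms by (intro couplingsI) (auto simp: indicator_def cong: sets_pair_measure_cong)
  moreover have "transport_cost d (return (S \<Otimes>\<^sub>M R) (x, y)) = ennreal (d x y)"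
    using assms by (subst nn_integral_return) (auto simp: space_pair_measure)
  ultimately show ?thesis
    unfolding transport_le_def by (intro bexI[of _ "return (S \<Otimes>\<^sub>M R) (x, y)"]) simp_all
qed

lemma transport_le_bounded:
  assumes \<mu>: "prob_space \<mu>" "sets \<mu> = sets S" and \<nu>: "prob_space \<nu>" "sets \<nu> = sets R"
    and D: "\<And>u v. u \<in> space S \<Longrightarrow> v \<in> space R \<Longrightarrow> d u v \<le> D"
  shows "transport_le d \<mu> \<nu> (ennreal D)"
proof -
  interpret P: prob_space "\<mu> \<Otimes>\<^sub>M \<nu>" by (rule prob_space_pair[OF \<mu>(1) \<nu>(1)])
  have "transport_cost d (\<mu> \<Otimes>\<^sub>M \<nu>) \<le> (\<integral>\<^sup>+_. ennreal D \<partial>(\<mu> \<Otimes>\<^sub>M \<nu>))"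
    using sets_eq_imp_space_eq[OF \<mu>(2)] sets_eq_imp_space_eq[OF \<nu>(2)]
    by (intro nn_integral_mono) (auto simp: space_pair_measure intro!: ennreal_leI D)
  then show ?thesis
    using pair_measure_couplings[OF \<mu>(1) \<nu>(1)] by (auto simp: transport_le_def P.emeasure_space_1)
qed

end

lemma couplings_distr:
  assumes \<pi>: "\<pi> \<in> couplings \<mu> \<nu>" and f: "f \<in> \<mu> \<rightarrow>\<^sub>M S" and g: "g \<in> \<nu> \<rightarrow>\<^sub>M R"
  shows "distr \<pi> (S \<Otimes>\<^sub>M R) (\<lambda>(u, v). (f u, g v)) \<in> couplings (distr \<mu> S f) (distr \<nu> R g)"
proof (rule couplingsI)
  note [measurable] = f g
  note s [measurable_cong] = couplings_sets[OF \<pi>]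
  note sp = couplings_space[OF \<pi>]
  have fg: "(\<lambda>(u, v). (f u, g v)) \<in> \<pi> \<rightarrow>\<^sub>M S \<Otimes>\<^sub>M R" by measurable
  show "sets (distr \<pi> (S \<Otimes>\<^sub>M R) (\<lambda>(u, v). (f u, g v))) = sets (distr \<mu> S f \<Otimes>\<^sub>M distr \<nu> R g)"
    by (simp cong: sets_pair_measure_cong)
  show "emeasure (distr \<pi> (S \<Otimes>\<^sub>M R) (\<lambda>(u, v). (f u, g v))) (A \<times> space (distr \<nu> R g)) = emeasure (distr \<mu> S f) A"
    if "A \<in> sets (distr \<mu> S f)" for A
  proof -
    have A [measurable]: "A \<in> sets S" using that by simp
    have "(\<lambda>(u, v). (f u, g v)) -` (A \<times> space R) \<inter> space \<pi> = (f -` A \<inter> space \<mu>) \<times> space \<nu>"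
      using measurable_space[OF g] by (auto simp: sp)
    then show ?thesis
      using couplings_emeasure(1)[OF \<pi> measurable_sets[OF f A]] by (simp add: emeasure_distr[OF fg] emeasure_distr[OF f A])
  qed
  show "emeasure (distr \<pi> (S \<Otimes>\<^sub>M R) (\<lambda>(u, v). (f u, g v))) (space (distr \<mu> S f) \<times> A) = emeasure (distr \<nu> R g) A"
    if "A \<in> sets (distr \<nu> R g)" for A
  proof -
    have A [measurable]: "A \<in> sets R" using that by simp
    have "(\<lambda>(u, v). (f u, g v)) -` (space S \<times> A) \<inter> space \<pi> = space \<mu> \<times> (g -` A \<inter> space \<nu>)"
      using measurable_space[OF f] by (auto simp: sp)
    then show ?thesis
      using couplings_emeasure(2)[OF \<pi> measurable_sets[OF g A]] by (simp add: emeasure_distr[OF fg] emeasure_distr[OF g A])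
  qed
qed

text \<open>The diagonal coupling. It serves the degenerate cases \<open>u = v\<close>, of which the
  curvature hypotheses say nothing.\<close>

lemma transport_le_refl:
  assumes d: "(\<lambda>(u, v). d u v) \<in> borel_measurable (\<mu> \<Otimes>\<^sub>M \<mu>)" and "\<And>u. u \<in> space \<mu> \<Longrightarrow> d u u = 0"
  shows "transport_le d \<mu> \<mu> 0"
proof -
  have m: "(\<lambda>x. (x, x)) \<in> \<mu> \<rightarrow>\<^sub>M \<mu> \<Otimes>\<^sub>M \<mu>" by measurable
  have "distr \<mu> (\<mu> \<Otimes>\<^sub>M \<mu>) (\<lambda>x. (x, x)) \<in> couplings \<mu> \<mu>"
  proof (rule couplingsI)
    fix A assume A: "A \<in> sets \<mu>"
    have "(\<lambda>x. (x, x)) -` (A \<times> space \<mu>) \<inter> space \<mu> = A" "(\<lambda>x. (x, x)) -` (space \<mu> \<times> A) \<inter> space \<mu> = A"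
      using sets.sets_into_space[OF A] by auto
    then show "emeasure (distr \<mu> (\<mu> \<Otimes>\<^sub>M \<mu>) (\<lambda>x. (x, x))) (A \<times> space \<mu>) = emeasure \<mu> A"
      "emeasure (distr \<mu> (\<mu> \<Otimes>\<^sub>M \<mu>) (\<lambda>x. (x, x))) (space \<mu> \<times> A) = emeasure \<mu> A"
      using A by (simp_all add: emeasure_distr[OF m])
  qed simp
  moreover have "transport_cost d (distr \<mu> (\<mu> \<Otimes>\<^sub>M \<mu>) (\<lambda>x. (x, x))) = (\<integral>\<^sup>+x. ennreal (d x x) \<partial>\<mu>)"
    using d by (subst nn_integral_distr[OF m]) auto
  moreover have "(\<integral>\<^sup>+x. ennreal (d x x) \<partial>\<mu>) = (\<integral>\<^sup>+x. 0 \<partial>\<mu>)"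
    using assms(2) by (intro nn_integral_cong) simp
  ultimately show ?thesis
    unfolding transport_le_def by (intro bexI[of _ "distr \<mu> (\<mu> \<Otimes>\<^sub>M \<mu>) (\<lambda>x. (x, x))"]) simp_all
qed

text \<open>
  Couples the mass missing in the sub-coupling \<open>\<gamma>\<close> independently. If nothing is missing, the factor
  \<open>1 / 0 = \<infinity>\<close> multiplies the null measure.
\<close>

definition complete_coupling :: "'b measure \<Rightarrow> 'c measure \<Rightarrow> ('b \<times> 'c) measure \<Rightarrow> ('b \<times> 'c) measure" where
  "complete_coupling \<mu> \<nu> \<gamma> = \<gamma> \<oplus>\<^sub>\<mu> scale_measure (1 / (1 - emeasure \<gamma> (space \<gamma>)))
     (diff_measure \<mu> (distr \<gamma> \<mu> fst) \<Otimes>\<^sub>M diff_measure \<nu> (distr \<gamma> \<nu> snd))"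

context
  fixes \<mu> :: "'b measure" and \<nu> :: "'c measure" and \<gamma> :: "('b \<times> 'c) measure"
  assumes \<mu>: "prob_space \<mu>" and \<nu>: "prob_space \<nu>" and sets_\<gamma>: "sets \<gamma> = sets (\<mu> \<Otimes>\<^sub>M \<nu>)"
    and marg1: "\<And>A. A \<in> sets \<mu> \<Longrightarrow> emeasure \<gamma> (A \<times> space \<nu>) \<le> emeasure \<mu> A"
    and marg2: "\<And>B. B \<in> sets \<nu> \<Longrightarrow> emeasure \<gamma> (space \<mu> \<times> B) \<le> emeasure \<nu> B"
begin

lemma space_sub_coupling: "space \<gamma> = space \<mu> \<times> space \<nu>"
  using sets_eq_imp_space_eq[OF sets_\<gamma>] by (simp add: space_pair_measure)

lemma sub_coupling_mass_le: "emeasure \<gamma> (space \<gamma>) \<le> 1"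
  using marg1[OF sets.top] prob_space.emeasure_space_1[OF \<mu>] by (simp add: space_sub_coupling)

lemma sub_coupling_rest:
  "A \<in> sets \<mu> \<Longrightarrow> emeasure (diff_measure \<mu> (distr \<gamma> \<mu> fst)) A = emeasure \<mu> A - emeasure \<gamma> (A \<times> space \<nu>)"
  "B \<in> sets \<nu> \<Longrightarrow> emeasure (diff_measure \<nu> (distr \<gamma> \<nu> snd)) B = emeasure \<nu> B - emeasure \<gamma> (space \<mu> \<times> B)"
proof -
  interpret \<mu>: prob_space \<mu> by (rule \<mu>)
  interpret \<nu>: prob_space \<nu> by (rule \<nu>)
  note distr = emeasure_distr_proj[OF sets_\<gamma>]
  have f: "finite_measure (distr \<gamma> \<mu> fst)" "finite_measure (distr \<gamma> \<nu> snd)"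
    using distr(1)[OF sets.top] distr(2)[OF sets.top] sub_coupling_mass_le
    by (auto intro!: finite_measureI simp: space_sub_coupling top_unique)
  show "A \<in> sets \<mu> \<Longrightarrow> emeasure (diff_measure \<mu> (distr \<gamma> \<mu> fst)) A = emeasure \<mu> A - emeasure \<gamma> (A \<times> space \<nu>)"
    by (subst emeasure_diff_measure[OF _ f(1)])
      (auto simp: distr marg1 \<mu>.finite_measure_axioms)
  show "B \<in> sets \<nu> \<Longrightarrow> emeasure (diff_measure \<nu> (distr \<gamma> \<nu> snd)) B = emeasure \<nu> B - emeasure \<gamma> (space \<mu> \<times> B)"
    by (subst emeasure_diff_measure[OF _ f(2)])
      (auto simp: distr marg2 \<nu>.finite_measure_axioms)
qed

lemma finite_sub_coupling_rest:
  "finite_measure (diff_measure \<mu> (distr \<gamma> \<mu> fst))" "finite_measure (diff_measure \<nu> (distr \<gamma> \<nu> snd))"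
  using prob_space.emeasure_space_1[OF \<mu>] prob_space.emeasure_space_1[OF \<nu>]
  by (auto intro!: finite_measureI simp: sub_coupling_rest)

lemma sets_sub_coupling_rest:
  "sets (diff_measure \<mu> (distr \<gamma> \<mu> fst) \<Otimes>\<^sub>M diff_measure \<nu> (distr \<gamma> \<nu> snd)) = sets \<gamma>"
  unfolding sets_\<gamma> by (rule sets_pair_measure_cong) simp_all

lemma sets_complete_coupling: "sets (complete_coupling \<mu> \<nu> \<gamma>) = sets \<gamma>"
  by (simp add: complete_coupling_def)

lemma emeasure_complete_coupling:
  assumes A: "A \<in> sets \<mu>" and B: "B \<in> sets \<nu>"
  shows "emeasure (complete_coupling \<mu> \<nu> \<gamma>) (A \<times> B) = emeasure \<gamma> (A \<times> B) +
    1 / (1 - emeasure \<gamma> (space \<gamma>)) * ((emeasure \<mu> A - emeasure \<gamma> (A \<times> space \<nu>)) *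
      (emeasure \<nu> B - emeasure \<gamma> (space \<mu> \<times> B)))"
proof -
  interpret R: finite_measure "diff_measure \<nu> (distr \<gamma> \<nu> snd)" by (rule finite_sub_coupling_rest)
  have "A \<times> B \<in> sets \<gamma>" using A B by (simp add: sets_\<gamma>)
  then show ?thesis
    unfolding complete_coupling_def
    using A B by (subst emeasure_plus_measure)
      (simp_all add: sets_sub_coupling_rest[unfolded sets_\<gamma>] sets_\<gamma> R.emeasure_pair_measure_Times sub_coupling_rest)
qed

text \<open>For \<open>m = 0\<close> the bound forces \<open>a - e = 0\<close>, so both sides vanish
  although \<open>1 / m\<close> is infinite. This spares a case distinction on whether mass is
  missing.\<close>

lemma complete_coupling_aux:
  fixes m a e :: ennreal
  assumes "a - e \<le> m" "m \<le> 1"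
  shows "1 / m * ((a - e) * m) = a - e"
proof (cases "m = 0")
  case False
  have "1 / m * (r * m) = r * (m / m)" for r by (simp add: ennreal_times_divide mult.commute)
  moreover have "m / m = 1" using False assms(2) by (intro ennreal_divide_self) (auto intro: le_less_trans)
  ultimately show ?thesis by simp
qed (use assms in auto)

text \<open>Both remainders have the missing mass m as total mass, so their product divided by m has
  the remainders as marginals.\<close>

lemma complete_coupling: "complete_coupling \<mu> \<nu> \<gamma> \<in> couplings \<mu> \<nu>"
proof -
  let ?m = "1 - emeasure \<gamma> (space \<gamma>)"
  have m: "emeasure \<mu> (space \<mu>) - emeasure \<gamma> (space \<mu> \<times> space \<nu>) = ?m"
    "emeasure \<nu> (space \<nu>) - emeasure \<gamma> (space \<mu> \<times> space \<nu>) = ?m"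
    using prob_space.emeasure_space_1[OF \<mu>] prob_space.emeasure_space_1[OF \<nu>] by (simp_all add: space_sub_coupling)
  have "1 / ?m * ((emeasure \<mu> A - emeasure \<gamma> (A \<times> space \<nu>)) * ?m) = emeasure \<mu> A - emeasure \<gamma> (A \<times> space \<nu>)"
    if "A \<in> sets \<mu>" for A
    using emeasure_space[of "diff_measure \<mu> (distr \<gamma> \<mu> fst)" A] m(1) that
    by (intro complete_coupling_aux) (simp_all add: sub_coupling_rest)
  moreover have "1 / ?m * ((emeasure \<nu> B - emeasure \<gamma> (space \<mu> \<times> B)) * ?m) = emeasure \<nu> B - emeasure \<gamma> (space \<mu> \<times> B)"
    if "B \<in> sets \<nu>" for B
    using emeasure_space[of "diff_measure \<nu> (distr \<gamma> \<nu> snd)" B] m(2) that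
    by (intro complete_coupling_aux) (simp_all add: sub_coupling_rest)
  ultimately show ?thesis
    by (intro couplingsI) (simp_all add: sets_complete_coupling sets_\<gamma> emeasure_complete_coupling m mult.commute[of ?m]
        marg1 marg2 add.commute[of _ "_ - _"] diff_add_cancel_ennreal)
qed

text \<open>The independent part has total mass \<open>m * m / m = m\<close>, where m is the missing
  mass.\<close>

lemma complete_coupling_cost:
  assumes f [measurable]: "f \<in> borel_measurable \<gamma>" and D: "\<And>z. z \<in> space \<gamma> \<Longrightarrow> f z \<le> D"
  shows "(\<integral>\<^sup>+z. f z \<partial>complete_coupling \<mu> \<nu> \<gamma>) \<le> (\<integral>\<^sup>+z. f z \<partial>\<gamma>) + D * (1 - emeasure \<gamma> (space \<gamma>))"
proof -
  interpret R: finite_measure "diff_measure \<nu> (distr \<gamma> \<nu> snd)" by (rule finite_sub_coupling_rest)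
  let ?R = "diff_measure \<mu> (distr \<gamma> \<mu> fst) \<Otimes>\<^sub>M diff_measure \<nu> (distr \<gamma> \<nu> snd)"
  let ?m = "1 - emeasure \<gamma> (space \<gamma>)"
  have fR [measurable]: "f \<in> borel_measurable ?R"
    using f measurable_cong_sets[OF sets_sub_coupling_rest refl] by blast
  have spR: "space ?R = space \<gamma>" by (rule sets_eq_imp_space_eq[OF sets_sub_coupling_rest])
  have R: "emeasure ?R (space ?R) = ?m * ?m"
    using prob_space.emeasure_space_1[OF \<mu>] prob_space.emeasure_space_1[OF \<nu>]
    by (subst space_pair_measure) (simp add: R.emeasure_pair_measure_Times sub_coupling_rest space_sub_coupling)
  have "(\<integral>\<^sup>+z. f z \<partial>complete_coupling \<mu> \<nu> \<gamma>) = (\<integral>\<^sup>+z. f z \<partial>\<gamma>) + 1 / ?m * (\<integral>\<^sup>+z. f z \<partial>?R)"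
    unfolding complete_coupling_def
    by (subst nn_integral_plus_measure) (simp_all add: sets_sub_coupling_rest[unfolded sets_\<gamma>] sets_\<gamma> nn_integral_scale_measure)
  also have "(\<integral>\<^sup>+z. f z \<partial>?R) \<le> (\<integral>\<^sup>+z. D \<partial>?R)"
    using D by (intro nn_integral_mono) (simp add: spR)
  also have "(\<integral>\<^sup>+z. D \<partial>?R) = D * (?m * ?m)"
    by (simp add: R)
  also have "1 / ?m * (D * (?m * ?m)) = D * (1 / ?m * (?m * ?m))"
    by (simp add: ac_simps)
  also have "1 / ?m * (?m * ?m) = ?m"
    using complete_coupling_aux[of 1 "emeasure \<gamma> (space \<gamma>)" ?m] by simp
  finally show ?thesis by (simp add: add_left_mono mult_left_mono)
qed

end

text \<open>On rectangles the completed coupling is an explicit expression in masses of \<mu>, \<nu>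
  and \<gamma>, and rectangles form an intersection-stable generator.\<close>

lemma measurable_complete_coupling:
  assumes \<mu>: "\<mu> \<in> X \<rightarrow>\<^sub>M prob_algebra S" and \<nu>: "\<nu> \<in> X \<rightarrow>\<^sub>M prob_algebra R"
    and \<gamma>: "\<gamma> \<in> X \<rightarrow>\<^sub>M subprob_algebra (S \<Otimes>\<^sub>M R)"
    and marg1: "\<And>x A. x \<in> space X \<Longrightarrow> A \<in> sets S \<Longrightarrow> emeasure (\<gamma> x) (A \<times> space R) \<le> emeasure (\<mu> x) A"
    and marg2: "\<And>x B. x \<in> space X \<Longrightarrow> B \<in> sets R \<Longrightarrow> emeasure (\<gamma> x) (space S \<times> B) \<le> emeasure (\<nu> x) B"
  shows "(\<lambda>x. complete_coupling (\<mu> x) (\<nu> x) (\<gamma> x)) \<in> X \<rightarrow>\<^sub>M prob_algebra (S \<Otimes>\<^sub>M R)"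
proof -
  note [measurable] = measurable_prob_algebraD[OF \<mu>] measurable_prob_algebraD[OF \<nu>] \<gamma>
  have sp: "prob_space (\<mu> x)" "prob_space (\<nu> x)" "sets (\<mu> x) = sets S" "sets (\<nu> x) = sets R"
    "sets (\<gamma> x) = sets (S \<Otimes>\<^sub>M R)" if "x \<in> space X" for x
    using measurable_space[OF \<mu> that] measurable_space[OF \<nu> that] measurable_space[OF \<gamma> that]
    by (auto simp: space_prob_algebra space_subprob_algebra)
  have sp': "space (\<mu> x) = space S" "space (\<nu> x) = space R" "space (\<gamma> x) = space (S \<Otimes>\<^sub>M R)" if "x \<in> space X" for x
    using sp[OF that] by (auto dest: sets_eq_imp_space_eq)
  have sp'': "sets (\<gamma> x) = sets (\<mu> x \<Otimes>\<^sub>M \<nu> x)" if "x \<in> space X" for x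
    using sp[OF that] by (simp cong: sets_pair_measure_cong)
  show ?thesis
  proof (rule measurable_prob_algebra_generated[OF sets_pair_measure Int_stable_pair_measure_generator])
    fix x assume x: "x \<in> space X"
    note cc = complete_coupling[OF sp(1,2)[OF x] sp''[OF x]] sets_complete_coupling[OF sp(1,2)[OF x] sp''[OF x]]
    have c: "complete_coupling (\<mu> x) (\<nu> x) (\<gamma> x) \<in> couplings (\<mu> x) (\<nu> x)"
      using marg1[OF x] marg2[OF x] by (intro cc) (simp_all add: sp[OF x] sp'[OF x])
    show "sets (complete_coupling (\<mu> x) (\<nu> x) (\<gamma> x)) = sets (S \<Otimes>\<^sub>M R)"
      using marg1[OF x] marg2[OF x] by (subst cc(2)) (simp_all add: sp[OF x] sp'[OF x])
    show "prob_space (complete_coupling (\<mu> x) (\<nu> x) (\<gamma> x))"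
      using couplings_emeasure(1)[OF c sets.top] prob_space.emeasure_space_1[OF sp(1)[OF x]] couplings_space[OF c]
      by (intro prob_spaceI) simp
  next
    fix C assume "C \<in> {a \<times> b |a b. a \<in> sets S \<and> b \<in> sets R}"
    then obtain A B where [measurable]: "A \<in> sets S" "B \<in> sets R" and C: "C = A \<times> B" by auto
    have "emeasure (complete_coupling (\<mu> x) (\<nu> x) (\<gamma> x)) C = emeasure (\<gamma> x) (A \<times> B) +
        1 / (1 - emeasure (\<gamma> x) (space S \<times> space R)) * ((emeasure (\<mu> x) A - emeasure (\<gamma> x) (A \<times> space R)) *
        (emeasure (\<nu> x) B - emeasure (\<gamma> x) (space S \<times> B)))" if "x \<in> space X" for x
      unfolding C
      using marg1[OF that] marg2[OF that]
      by (subst emeasure_complete_coupling[OF sp(1,2)[OF that] sp''[OF that]])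
        (simp_all add: sp[OF that] sp'[OF that] space_pair_measure)
    then show "(\<lambda>x. emeasure (complete_coupling (\<mu> x) (\<nu> x) (\<gamma> x)) C) \<in> borel_measurable X"
      by (subst measurable_cong) measurable
  qed (auto dest: sets.sets_into_space)
qed

section \<open>Measurable choice of almost optimal couplings\<close>

text \<open>\<open>S\<close> carries no topology here: separability appears as countable measurable
  partitions into cells of small diameter, the form in which the discretisation of couplings uses
  it.\<close>

locale separable_cost =
  fixes S :: "'s measure" and d :: "'s \<Rightarrow> 's \<Rightarrow> real" and D :: real
  assumes d_measurable [measurable]: "(\<lambda>(u, v). d u v) \<in> borel_measurable (S \<Otimes>\<^sub>M S)"
    and d_nonneg: "\<And>u v. u \<in> space S \<Longrightarrow> v \<in> space S \<Longrightarrow> 0 \<le> d u v"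
    and d_le: "\<And>u v. u \<in> space S \<Longrightarrow> v \<in> space S \<Longrightarrow> d u v \<le> D"
    and d_triangle: "\<And>u v w. u \<in> space S \<Longrightarrow> v \<in> space S \<Longrightarrow> w \<in> space S \<Longrightarrow> d u w \<le> d u v + d v w"
    and partition: "\<And>e. 0 < e \<Longrightarrow> \<exists>\<phi>\<in>S \<rightarrow>\<^sub>M count_space (UNIV :: nat set).
      \<forall>u\<in>space S. \<forall>v\<in>space S. \<phi> u = \<phi> v \<longrightarrow> d u v \<le> e"

section \<open>Couplings discretised on a countable grid of cells\<close>

lemma nn_integral_nat_valued:
  fixes h :: "nat \<Rightarrow> ennreal"
  assumes [measurable]: "\<phi> \<in> M \<rightarrow>\<^sub>M count_space UNIV"
  shows "(\<integral>\<^sup>+u. h (\<phi> u) \<partial>M) = (\<Sum>k. h k * emeasure M (\<phi> -` {k} \<inter> space M))"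
proof -
  have [measurable]: "\<phi> -` {k} \<inter> space M \<in> sets M" for k
    by (rule measurable_sets[OF assms]) simp
  have h: "h (\<phi> u) = (\<Sum>k. h k * indicator (\<phi> -` {k} \<inter> space M) u)" if "u \<in> space M" for u
  proof -
    have "(\<Sum>k. h k * indicator (\<phi> -` {k} \<inter> space M) u) = (\<Sum>k\<in>{\<phi> u}. h k * indicator (\<phi> -` {k} \<inter> space M) u)"
      by (rule suminf_finite) (auto simp: indicator_def)
    then show ?thesis using that by simp
  qed
  have "(\<integral>\<^sup>+u. h (\<phi> u) \<partial>M) = (\<integral>\<^sup>+u. (\<Sum>k. h k * indicator (\<phi> -` {k} \<inter> space M) u) \<partial>M)"
    by (intro nn_integral_cong h)
  also have "\<dots> = (\<Sum>k. \<integral>\<^sup>+u. h k * indicator (\<phi> -` {k} \<inter> space M) u \<partial>M)"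
    by (rule nn_integral_suminf) simp
  also have "\<dots> = (\<Sum>k. h k * emeasure M (\<phi> -` {k} \<inter> space M))"
    by (simp add: nn_integral_cmult_indicator)
  finally show ?thesis .
qed

lemma ennreal_divide_mult_le:
  fixes w a b :: ennreal
  assumes "a < \<top>" "b < \<top>"
  shows "w / (a * b) * b \<le> w / a"
proof (cases "b = 0")
  case False
  then have "b / b = 1" using assms by (intro ennreal_divide_self) auto
  have "w / (a * b) * b = w / a / b * b"
    using assms False by (simp add: divide_ennreal_def ennreal_inverse_mult ac_simps)
  also have "\<dots> = w / a * (b / b)" by (simp add: divide_ennreal_def ac_simps)
  finally show ?thesis by (simp add: \<open>b / b = 1\<close>)
qed simp

text \<open>If a or b vanishes then so does w, hence null cells satisfy the identity despite the
  division by 0.\<close>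

lemma ennreal_divide_mult_eq:
  fixes w a b :: ennreal
  assumes "a < \<top>" "b < \<top>" "w \<le> a" "w \<le> b"
  shows "w / (a * b) * b * a = w"
proof (cases "w = 0")
  case False
  then have 0: "a \<noteq> 0" "b \<noteq> 0" using assms by auto
  then have "b / b = 1" "a / a = 1" using assms by (auto intro!: ennreal_divide_self)
  have "w / (a * b) * b * a = w * (b / b) * (a / a)"
    using assms 0 by (simp add: divide_ennreal_def ennreal_inverse_mult ac_simps)
  then show ?thesis by (simp add: \<open>b / b = 1\<close> \<open>a / a = 1\<close>)
qed simp

text \<open>For w the weights in one row, a the mass of its cell and \<open>b k\<close> the masses
  of the cells on the other side, the integrand is the density of the discretised coupling against
  the product law. The bound 1 on its partial integral keeps the marginal below the given law; it is
  applied to rows and to columns.\<close>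

lemma nn_integral_grid_le_1:
  fixes w :: "nat \<Rightarrow> ennreal"
  assumes \<phi>: "\<phi> \<in> \<nu> \<rightarrow>\<^sub>M count_space UNIV" and w: "(\<Sum>k. w k) \<le> a" and "a < \<top>"
    and b: "\<And>k. b k = emeasure \<nu> (\<phi> -` {k} \<inter> space \<nu>)" "\<And>k. b k < \<top>"
  shows "(\<integral>\<^sup>+v. w (\<phi> v) / (a * b (\<phi> v)) \<partial>\<nu>) \<le> 1"
proof -
  have "(\<integral>\<^sup>+v. w (\<phi> v) / (a * b (\<phi> v)) \<partial>\<nu>) = (\<Sum>k. w k / (a * b k) * b k)"
    using nn_integral_nat_valued[OF \<phi>, of "\<lambda>k. w k / (a * b k)"] b(1) by simp
  also have "\<dots> \<le> (\<Sum>k. w k / a)"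
    by (intro suminf_le allI ennreal_divide_mult_le assms) auto
  also have "\<dots> = (\<Sum>k. w k) / a"
    by (simp add: divide_ennreal_def)
  also have "\<dots> \<le> a / a"
    using w by (rule divide_right_mono_ennreal)
  also have "\<dots> \<le> 1"
    using \<open>a < \<top>\<close> by (cases "a = 0") auto
  finally show ?thesis .
qed

text \<open>
  A code \<open>(M, ws)\<close> stands for a finitely supported matrix with entries in \<open>(1 / M) \<nat>\<close>. Since there are only
  countably many codes, almost optimal ones can be chosen measurably by taking the first that works.
\<close>

definition grid_weight :: "nat \<times> nat list \<Rightarrow> nat \<Rightarrow> nat \<Rightarrow> ennreal" where
  "grid_weight e k l = (if prod_encode (k, l) < length (snd e)
     then ennreal (real (snd e ! prod_encode (k, l)) / real (fst e)) else 0)"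

text \<open>Half of \<epsilon> pays for cutting the matrix off after finitely many entries, half for
  rounding the remaining ones down. Rounding down keeps every entry, hence every row and column sum,
  below its target.\<close>

lemma exists_grid_weight:
  fixes p :: "nat \<Rightarrow> nat \<Rightarrow> ennreal"
  assumes p: "(\<Sum>k. \<Sum>l. p k l) = 1" and \<epsilon>: "0 < (\<epsilon>::real)"
  shows "\<exists>e. (\<forall>k l. grid_weight e k l \<le> p k l) \<and> 1 - ennreal \<epsilon> \<le> (\<Sum>k. \<Sum>l. grid_weight e k l)"
proof -
  define P where "P i = (case prod_decode i of (k, l) \<Rightarrow> p k l)" for i
  have P_sum: "(\<Sum>i. P i) = 1"
    using suminf_ennreal_2dimen[of "\<lambda>k. \<Sum>l. p k l" "\<lambda>(k, l). p k l"] p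
    by (simp add: P_def case_prod_unfold)
  have P_top: "P i \<noteq> \<top>" for i
    using ennreal_suminf_lessD[of P \<top> i] P_sum by (simp add: less_top)
  have "(\<lambda>L. \<Sum>i<L. P i) \<longlonglongrightarrow> 1"
    using summable_LIMSEQ[of P] P_sum by simp
  moreover have "1 - ennreal (\<epsilon> / 2) < 1"
    using \<epsilon> ennreal_minus[of "\<epsilon> / 2" 1] by (simp add: ennreal_less_one_iff)
  ultimately have "eventually (\<lambda>L. 1 - ennreal (\<epsilon> / 2) < (\<Sum>i<L. P i)) sequentially"
    by (rule order_tendstoD)
  then obtain L where L: "1 - ennreal (\<epsilon> / 2) < (\<Sum>i<L. P i)"
    by (auto simp: eventually_sequentially)
  \<comment> \<open>Rounding \<open>L\<close> entries down to multiples of \<open>1 / M\<close>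
    loses at most \<open>L / M < \<epsilon> / 2\<close> in total.\<close>
  obtain M :: nat where M: "real M > 2 * real L / \<epsilon>"
    using reals_Archimedean2 by blast
  have "M > 0"
    using M \<epsilon> by (metis divide_nonneg_pos le_less_trans mult_nonneg_nonneg of_nat_0_le_iff of_nat_0_less_iff zero_le_numeral)
  note M = M this
  define ws where "ws = map (\<lambda>i. nat \<lfloor>real M * enn2real (P i)\<rfloor>) [0..<L]"
  let ?e = "(M, ws)"
  have ws: "length ws = L" "\<And>i. i < L \<Longrightarrow> ws ! i = nat \<lfloor>real M * enn2real (P i)\<rfloor>"
    by (auto simp: ws_def)
  have P_code: "p k l = ennreal (enn2real (P (prod_encode (k, l))))" for k l
    using P_top[of "prod_encode (k, l)"] by (simp add: P_def less_top)
  have le: "real (ws ! i) / real M \<le> enn2real (P i)" if "i < L" for i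
  proof -
    have "real (ws ! i) \<le> real M * enn2real (P i)"
      using that by (simp add: ws of_nat_floor)
    then show ?thesis using M by (simp add: field_simps)
  qed
  have ge: "enn2real (P i) \<le> real (ws ! i) / real M + 1 / real M" if "i < L" for i
  proof -
    have "real M * enn2real (P i) \<le> real (ws ! i) + 1"
      using that by (simp add: ws)
    then show ?thesis using M by (simp add: field_simps)
  qed
  have 1: "grid_weight ?e k l \<le> p k l" for k l
    unfolding P_code grid_weight_def using le by (auto simp: ws intro!: ennreal_leI)
  have "(\<Sum>k. \<Sum>l. grid_weight ?e k l) = (\<Sum>i. case prod_decode i of (k, l) \<Rightarrow> grid_weight ?e k l)"
    using suminf_ennreal_2dimen[of "\<lambda>k. \<Sum>l. grid_weight ?e k l" "\<lambda>(k, l). grid_weight ?e k l"]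
    by (simp add: case_prod_unfold)
  also have "\<dots> = (\<Sum>i. if i < L then ennreal (real (ws ! i) / real M) else 0)"
    by (intro suminf_cong) (auto simp: grid_weight_def ws case_prod_unfold)
  also have "\<dots> = (\<Sum>i<L. ennreal (real (ws ! i) / real M))"
    by (subst suminf_finite[of "{..<L}"]) auto
  finally have sum: "(\<Sum>k. \<Sum>l. grid_weight ?e k l) = (\<Sum>i<L. ennreal (real (ws ! i) / real M))" .
  have "(\<Sum>i<L. P i) \<le> (\<Sum>i<L. ennreal (real (ws ! i) / real M) + ennreal (1 / real M))"
  proof (rule sum_mono)
    fix i assume "i \<in> {..<L}"
    then have "ennreal (enn2real (P i)) \<le> ennreal (real (ws ! i) / real M + 1 / real M)"
      using ge[of i] by (intro ennreal_leI) simp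
    then show "P i \<le> ennreal (real (ws ! i) / real M) + ennreal (1 / real M)"
      using P_top[of i] by (simp add: less_top)
  qed
  also have "\<dots> = (\<Sum>i<L. ennreal (real (ws ! i) / real M)) + of_nat L * ennreal (1 / real M)"
    by (simp add: sum.distrib)
  also have "of_nat L * ennreal (1 / real M) \<le> ennreal (\<epsilon> / 2)"
    using M \<epsilon> by (subst ennreal_of_nat_eq_real_of_nat) (auto simp: ennreal_mult[symmetric] field_simps intro!: ennreal_leI)
  finally have "1 - ennreal (\<epsilon> / 2) \<le> (\<Sum>i<L. ennreal (real (ws ! i) / real M)) + ennreal (\<epsilon> / 2)"
    using L by (meson add_left_mono le_less_trans less_imp_le order_trans)
  then have "1 - ennreal (\<epsilon> / 2) - ennreal (\<epsilon> / 2) \<le> (\<Sum>i<L. ennreal (real (ws ! i) / real M))"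
    by (simp add: ennreal_minus_le_iff add.commute)
  moreover have "1 - ennreal (\<epsilon> / 2) - ennreal (\<epsilon> / 2) = 1 - ennreal \<epsilon>"
    using \<epsilon> ennreal_minus[of "\<epsilon> / 2" 1] ennreal_minus[of "\<epsilon> / 2" "1 - \<epsilon> / 2"] ennreal_minus[of \<epsilon> 1] by simp
  ultimately have "1 - ennreal \<epsilon> \<le> (\<Sum>k. \<Sum>l. grid_weight ?e k l)"
    by (simp add: sum)
  with 1 show ?thesis by blast
qed


context separable_cost
begin

text \<open>Almost optimal couplings chosen separately for each \<open>x\<close> need not depend
  measurably on \<open>x\<close>, so their cell masses are replaced by codes. A code fixes only how
  much mass goes from cell to cell; within a pair of cells the mass is spread independently
  according to the given laws, which keeps the dependence on \<open>x\<close> measurable.\<close>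

lemma exists_measurable_coupling:
  assumes \<mu>: "\<mu> \<in> X \<rightarrow>\<^sub>M prob_algebra S" and \<nu>: "\<nu> \<in> X \<rightarrow>\<^sub>M prob_algebra S"
    and c [measurable]: "c \<in> borel_measurable X" and c_nonneg: "\<And>x. x \<in> space X \<Longrightarrow> 0 \<le> c x"
    and ex: "\<And>x e. x \<in> space X \<Longrightarrow> 0 < e \<Longrightarrow> transport_le d (\<mu> x) (\<nu> x) (ennreal (c x + e))"
    and \<epsilon>: "0 < \<epsilon>"
  shows "\<exists>K\<in>X \<rightarrow>\<^sub>M prob_algebra (S \<Otimes>\<^sub>M S). \<forall>x\<in>space X. K x \<in> couplings (\<mu> x) (\<nu> x) \<and>
      transport_cost d (K x) \<le> ennreal (c x + \<epsilon>)"
proof -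
  let ?SS = "S \<Otimes>\<^sub>M S" and ?P = "\<lambda>x. \<mu> x \<Otimes>\<^sub>M \<nu> x"
  \<comment> \<open>The budget is 4 \<delta>: one \<delta> for the almost optimal coupling, two for
    moving within a pair of cells, one for the completed mass, which is at most \<delta>' and costs
    at most \<open>D\<close> per unit. The denominator of \<delta>' is positive whatever
    \<open>D\<close> is.\<close>
  define \<delta> where "\<delta> = \<epsilon> / 4"
  define \<delta>' where "\<delta>' = \<epsilon> / (4 * (\<bar>D\<bar> + 1))"
  have \<delta>: "0 < \<delta>" "0 < \<delta>'" "D * \<delta>' \<le> \<delta>"
  proof -
    have "D * \<delta>' \<le> (\<bar>D\<bar> + 1) * \<delta>'" using \<epsilon> by (intro mult_right_mono) (auto simp: \<delta>'_def)
    also have "\<dots> = \<delta>" by (simp add: \<delta>_def \<delta>'_def field_simps)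
    finally show "D * \<delta>' \<le> \<delta>" .
  qed (use \<epsilon> in \<open>auto simp: \<delta>_def \<delta>'_def\<close>)
  obtain \<phi> where \<phi> [measurable]: "\<phi> \<in> S \<rightarrow>\<^sub>M count_space (UNIV :: nat set)"
    and diam: "\<And>u v. u \<in> space S \<Longrightarrow> v \<in> space S \<Longrightarrow> \<phi> u = \<phi> v \<Longrightarrow> d u v \<le> \<delta>"
    using partition[OF \<delta>(1)] by blast
  note [measurable] = measurable_prob_algebraD[OF \<mu>] measurable_prob_algebraD[OF \<nu>]
  have pS: "prob_space (\<mu> x)" "prob_space (\<nu> x)" "sets (\<mu> x) = sets S" "sets (\<nu> x) = sets S"
    if "x \<in> space X" for x
    using measurable_space[OF \<mu> that] measurable_space[OF \<nu> that]
    by (auto simp: space_prob_algebra)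
  have spS: "space (\<mu> x) = space S" "space (\<nu> x) = space S" if "x \<in> space X" for x
    using pS[OF that] by (auto dest: sets_eq_imp_space_eq)
  define A where "A k = \<phi> -` {k} \<inter> space S" for k
  have A [measurable]: "A k \<in> sets S" for k
    unfolding A_def by (rule measurable_sets[OF \<phi>]) simp
  define a where "a x k = emeasure (\<mu> x) (A k)" for x k
  define b where "b x k = emeasure (\<nu> x) (A k)" for x k
  have [measurable]: "(\<lambda>x. a x k) \<in> borel_measurable X" "(\<lambda>x. b x k) \<in> borel_measurable X" for k
    unfolding a_def b_def by measurable
  have fin: "a x k < \<top>" "b x k < \<top>" if "x \<in> space X" for x k
    using prob_space.emeasure_le_1[OF pS(1)[OF that]] prob_space.emeasure_le_1[OF pS(2)[OF that]]
    unfolding a_def b_def by (meson ennreal_one_less_top le_less_trans)+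
  \<comment> \<open>The infimum depends on the cells only. It lies below \<open>d\<close>, so a code
    rounded down from a coupling costs no more than that coupling; and \<open>d\<close> exceeds it
    by at most two diameters, so the spread-out code costs little more than the code.\<close>
  define c0 where "c0 k l = (INF u\<in>A k. INF v\<in>A l. ennreal (d u v))" for k l
  have d_c0: "ennreal (d u v) \<le> c0 (\<phi> u) (\<phi> v) + ennreal (2 * \<delta>)" if uv: "u \<in> space S" "v \<in> space S" for u v
  proof -
    have "ennreal (d u v) - ennreal (2 * \<delta>) \<le> ennreal (d u' v')" if "u' \<in> A (\<phi> u)" "v' \<in> A (\<phi> v)" for u' v'
    proof -
      have *: "u' \<in> space S" "v' \<in> space S" "\<phi> u = \<phi> u'" "\<phi> v' = \<phi> v" using that by (auto simp: A_def)
      have "d u v \<le> d u u' + (d u' v' + d v' v)"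
        using d_triangle[of u u' v] d_triangle[of u' v' v] * uv by linarith
      also have "\<dots> \<le> d u' v' + 2 * \<delta>" using diam[of u u'] diam[of v' v] * uv by linarith
      finally have "d u v - 2 * \<delta> \<le> d u' v'" by simp
      then show ?thesis using \<delta>(1) by (simp add: ennreal_minus ennreal_leI)
    qed
    then have "ennreal (d u v) - ennreal (2 * \<delta>) \<le> c0 (\<phi> u) (\<phi> v)"
      unfolding c0_def by (intro INF_greatest)
    then show ?thesis by (simp add: ennreal_minus_le_iff add.commute)
  qed
  have c0_d: "c0 (\<phi> u) (\<phi> v) \<le> ennreal (d u v)" if "u \<in> space S" "v \<in> space S" for u v
    unfolding c0_def using that by (intro INF_lower2[of u] INF_lower2[of v]) (auto simp: A_def)
  \<comment> \<open>Each clause is a countable family of inequalities between measurable functions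
    of \<open>x\<close>, so the set of \<open>x\<close> for which a fixed code is good is
    measurable.\<close>
  define good where "good e x \<longleftrightarrow> (\<forall>k. (\<Sum>l. grid_weight e k l) \<le> a x k) \<and>
      (\<forall>l. (\<Sum>k. grid_weight e k l) \<le> b x l) \<and> 1 - ennreal \<delta>' \<le> (\<Sum>k. \<Sum>l. grid_weight e k l) \<and>
      (\<Sum>k. \<Sum>l. grid_weight e k l * c0 k l) \<le> ennreal (c x + \<delta>)" for e x
  have good_ex: "\<exists>e. good e x" if x: "x \<in> space X" for x
  proof -
    obtain \<pi> where \<pi>: "\<pi> \<in> couplings (\<mu> x) (\<nu> x)"
      and cost: "transport_cost d \<pi> \<le> ennreal (c x + \<delta>)"
      using ex[OF x \<delta>(1)] by (rule transport_leE)
    have sets_\<pi> [measurable_cong]: "sets \<pi> = sets ?SS"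
      using couplings_sets[OF \<pi>] pS[OF x] by (simp cong: sets_pair_measure_cong)
    have space_\<pi>: "space \<pi> = space S \<times> space S"
      using couplings_space[OF \<pi>] spS[OF x] by simp
    \<comment> \<open>The cell masses of an almost optimal coupling have the required row and column
      sums; rounding them down yields a good code.\<close>
    define p where "p k l = emeasure \<pi> (A k \<times> A l)" for k l
    have p_l: "(\<Sum>l. p k l) = a x k" for k
    proof -
      have "(\<Sum>l. p k l) = emeasure \<pi> (\<Union>l. A k \<times> A l)"
        unfolding p_def by (rule suminf_emeasure) (auto simp: disjoint_family_on_def A_def sets_\<pi>)
      also have "(\<Union>l. A k \<times> A l) = A k \<times> space S" by (auto simp: A_def)
      finally show ?thesis using couplings_emeasure(1)[OF \<pi>, of "A k"] by (simp add: a_def pS[OF x] spS[OF x])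
    qed
    have p_k: "(\<Sum>k. p k l) = b x l" for l
    proof -
      have "(\<Sum>k. p k l) = emeasure \<pi> (\<Union>k. A k \<times> A l)"
        unfolding p_def by (rule suminf_emeasure) (auto simp: disjoint_family_on_def A_def sets_\<pi>)
      also have "(\<Union>k. A k \<times> A l) = space S \<times> A l" by (auto simp: A_def)
      finally show ?thesis using couplings_emeasure(2)[OF \<pi>, of "A l"] by (simp add: b_def pS[OF x] spS[OF x])
    qed
    have "(\<Sum>k. a x k) = emeasure (\<mu> x) (\<Union>k. A k)"
      unfolding a_def by (rule suminf_emeasure) (auto simp: disjoint_family_on_def A_def pS[OF x])
    also have "(\<Union>k. A k) = space (\<mu> x)" by (auto simp: A_def spS[OF x])
    finally have "(\<Sum>k. \<Sum>l. p k l) = 1"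
      using prob_space.emeasure_space_1[OF pS(1)[OF x]] by (simp add: p_l)
    from exists_grid_weight[OF this \<delta>(2)] obtain e where
      e: "\<And>k l. grid_weight e k l \<le> p k l" "1 - ennreal \<delta>' \<le> (\<Sum>k. \<Sum>l. grid_weight e k l)"
      by blast
    have "(\<Sum>k. \<Sum>l. grid_weight e k l * c0 k l) \<le> (\<Sum>k. \<Sum>l. c0 k l * p k l)"
      using e(1) by (intro suminf_le allI) (auto simp: mult.commute intro!: mult_left_mono)
    also have "\<dots> = (\<Sum>i. case prod_decode i of (k, l) \<Rightarrow> c0 k l * p k l)"
      using suminf_ennreal_2dimen[of "\<lambda>k. \<Sum>l. c0 k l * p k l" "\<lambda>(k, l). c0 k l * p k l"]
      by (simp add: case_prod_unfold)
    also have "\<dots> = (\<integral>\<^sup>+z. (case prod_decode (prod_encode (\<phi> (fst z), \<phi> (snd z))) of (k, l) \<Rightarrow> c0 k l) \<partial>\<pi>)"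
    proof (subst nn_integral_nat_valued[where \<phi>="\<lambda>z. prod_encode (\<phi> (fst z), \<phi> (snd z))"])
      show "(\<lambda>z. prod_encode (\<phi> (fst z), \<phi> (snd z))) \<in> \<pi> \<rightarrow>\<^sub>M count_space UNIV" by measurable
      have "(\<lambda>z. prod_encode (\<phi> (fst z), \<phi> (snd z))) -` {i} \<inter> space \<pi> =
          A (fst (prod_decode i)) \<times> A (snd (prod_decode i))" for i
        by (auto simp: A_def space_\<pi>)
      then show "(\<Sum>i. case prod_decode i of (k, l) \<Rightarrow> c0 k l * p k l) =
        (\<Sum>k. (case prod_decode k of (k, l) \<Rightarrow> c0 k l) *
           emeasure \<pi> ((\<lambda>z. prod_encode (\<phi> (fst z), \<phi> (snd z))) -` {k} \<inter> space \<pi>))"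
        by (simp add: case_prod_unfold p_def)
    qed
    also have "\<dots> \<le> transport_cost d \<pi>"
      using c0_d by (intro nn_integral_mono) (auto simp: space_\<pi>)
    also note cost
    finally have "good e x"
      using e(2) suminf_le[of "grid_weight e _" "p _"] suminf_le[of "\<lambda>k. grid_weight e k _" "\<lambda>k. p k _"]
      unfolding good_def p_l[symmetric] p_k[symmetric] by (auto intro!: suminf_le e(1))
    then show ?thesis ..
  qed
  define sel where "sel x = (from_nat (LEAST n. good (from_nat n) x) :: nat \<times> nat list)" for x
  have good_sel: "good (sel x) x" if x: "x \<in> space X" for x
  proof -
    obtain e where "good e x" using good_ex[OF x] ..
    then have "good (from_nat (to_nat e)) x" by simp
    then show ?thesis unfolding sel_def by (rule LeastI)
  qed
  have [measurable]: "Measurable.pred X (good e)" for e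
    unfolding good_def by measurable
  have sel [measurable]: "sel \<in> X \<rightarrow>\<^sub>M count_space UNIV"
    unfolding sel_def by measurable
  define w where "w x k l = grid_weight (sel x) k l" for x k l
  have w: "(\<Sum>l. w x k l) \<le> a x k" "(\<Sum>k. w x k l) \<le> b x l"
     "1 - ennreal \<delta>' \<le> (\<Sum>k. \<Sum>l. w x k l)" "(\<Sum>k. \<Sum>l. w x k l * c0 k l) \<le> ennreal (c x + \<delta>)"
    if "x \<in> space X" for x k l
    using good_sel[OF that] by (auto simp: good_def w_def)
  have w_le: "w x k l \<le> a x k" "w x k l \<le> b x l" if "x \<in> space X" for x k l
    using w(1,2)[OF that, of k] w(2)[OF that, of l]
      sum_le_suminf[of "w x k" "{l}"] sum_le_suminf[of "\<lambda>k. w x k l" "{k}"] by (auto intro: order_trans)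
  \<comment> \<open>The weight \<open>w x k l\<close> is distributed over the product of the cells k
    and l in proportion to the product law. On null cells \<open>w\<close> vanishes as well.\<close>
  define h where "h x z = (case z of (u, v) \<Rightarrow> w x (\<phi> u) (\<phi> v) / (a x (\<phi> u) * b x (\<phi> v)))" for x z
  \<comment> \<open>\<open>sel\<close> and \<phi> take countably many values, so measurability is
    checked for each fixed code and pair of cells.\<close>
  have h [measurable]: "(\<lambda>(x, z). h x z) \<in> borel_measurable (X \<Otimes>\<^sub>M ?SS)"
  proof -
    have 1: "(\<lambda>p. grid_weight (fst (n p)) (fst (snd (n p))) (snd (snd (n p))) / (a (fst p) (fst (snd (n p))) * b (fst p) (snd (snd (n p)))))
        \<in> borel_measurable (X \<Otimes>\<^sub>M ?SS)"
      if "n \<in> (X \<Otimes>\<^sub>M ?SS) \<rightarrow>\<^sub>M count_space UNIV" for n :: "_ \<Rightarrow> (nat \<times> nat list) \<times> (nat \<times> nat)"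
      using that by (rule measurable_compose_countable[rotated]) measurable
    have "(\<lambda>p. (sel (fst p), (\<phi> (fst (snd p)), \<phi> (snd (snd p))))) \<in> (X \<Otimes>\<^sub>M ?SS) \<rightarrow>\<^sub>M count_space UNIV"
      by measurable
    from 1[OF this] show ?thesis by (simp add: h_def w_def case_prod_unfold)
  qed
  define \<gamma> where "\<gamma> x = density (?P x) (h x)" for x
  have sets_P [measurable_cong]: "sets (?P x) = sets ?SS" if "x \<in> space X" for x
    using pS[OF that] by (simp cong: sets_pair_measure_cong)
  have hx: "h x \<in> borel_measurable ?SS" if "x \<in> space X" for x
    using measurable_compose[OF measurable_Pair1'[OF that] h] by simp
  have \<gamma>_sets: "sets (\<gamma> x) = sets ?SS" if "x \<in> space X" for x
    using sets_P[OF that] by (simp add: \<gamma>_def)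
  have \<gamma>_int: "(\<integral>\<^sup>+z. f z \<partial>\<gamma> x) = (\<integral>\<^sup>+u. \<integral>\<^sup>+v. h x (u, v) * f (u, v) \<partial>\<nu> x \<partial>\<mu> x)"
    if x: "x \<in> space X" and f [measurable]: "f \<in> borel_measurable ?SS" for x f
  proof -
    interpret \<nu>: prob_space "\<nu> x" by (rule pS(2)[OF x])
    note [measurable] = hx[OF x]
    note sets_P[OF x, measurable_cong]
    show ?thesis
      unfolding \<gamma>_def by (subst nn_integral_density) (simp_all add: \<nu>.nn_integral_fst[symmetric])
  qed
  have \<phi>': "\<phi> \<in> \<mu> x \<rightarrow>\<^sub>M count_space UNIV" "\<phi> \<in> \<nu> x \<rightarrow>\<^sub>M count_space UNIV" if "x \<in> space X" for x
    by (simp_all add: measurable_cong_sets[OF pS(3)[OF that] refl] measurable_cong_sets[OF pS(4)[OF that] refl])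
  have ab: "a x k = emeasure (\<mu> x) (\<phi> -` {k} \<inter> space (\<mu> x))" "b x k = emeasure (\<nu> x) (\<phi> -` {k} \<inter> space (\<nu> x))"
    if "x \<in> space X" for x k
    by (simp_all add: a_def b_def A_def spS[OF that])
  \<comment> \<open>For an integrand that depends on the cells only, integration against \<gamma> is
    summation against the code.\<close>
  have \<gamma>_grid: "(\<integral>\<^sup>+u. \<integral>\<^sup>+v. h x (u, v) * F (\<phi> u) (\<phi> v) \<partial>\<nu> x \<partial>\<mu> x) = (\<Sum>k. \<Sum>l. w x k l * F k l)"
    if x: "x \<in> space X" for x and F :: "nat \<Rightarrow> nat \<Rightarrow> ennreal"
  proof -
    note pS(3,4)[OF x, measurable_cong]
    have "(\<integral>\<^sup>+v. h x (u, v) * F (\<phi> u) (\<phi> v) \<partial>\<nu> x) =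
        (\<Sum>l. w x (\<phi> u) l / (a x (\<phi> u) * b x l) * F (\<phi> u) l * b x l)" for u
      using nn_integral_nat_valued[OF \<phi>'(2)[OF x], of "\<lambda>l. w x (\<phi> u) l / (a x (\<phi> u) * b x l) * F (\<phi> u) l"]
      by (simp add: h_def ab[OF x])
    then have "(\<integral>\<^sup>+u. \<integral>\<^sup>+v. h x (u, v) * F (\<phi> u) (\<phi> v) \<partial>\<nu> x \<partial>\<mu> x) =
      (\<Sum>k. (\<Sum>l. w x k l / (a x k * b x l) * F k l * b x l) * a x k)"
      using nn_integral_nat_valued[OF \<phi>'(1)[OF x], of "\<lambda>k. \<Sum>l. w x k l / (a x k * b x l) * F k l * b x l"]
      by (simp add: ab[OF x])
    also have "\<dots> = (\<Sum>k. \<Sum>l. w x k l * F k l)"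
    proof (intro suminf_cong)
      fix k
      have "w x k l / (a x k * b x l) * F k l * b x l * a x k = w x k l * F k l" for l
        using ennreal_divide_mult_eq[OF fin(1)[OF x] fin(2)[OF x] w_le(1)[OF x] w_le(2)[OF x], of k l]
        by (simp add: ac_simps)
      then show "(\<Sum>l. w x k l / (a x k * b x l) * F k l * b x l) * a x k = (\<Sum>l. w x k l * F k l)"
        by (simp flip: ennreal_suminf_multc)
    qed
    finally show ?thesis .
  qed
  have \<gamma>1: "emeasure (\<gamma> x) (B \<times> space S) \<le> emeasure (\<mu> x) B" if x: "x \<in> space X" and B [measurable]: "B \<in> sets S" for x B
  proof -
    have "emeasure (\<gamma> x) (B \<times> space S) = (\<integral>\<^sup>+z. indicator (B \<times> space S) z \<partial>\<gamma> x)"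
      using x by (simp add: \<gamma>_sets)
    also have "\<dots> = (\<integral>\<^sup>+u. \<integral>\<^sup>+v. h x (u, v) * indicator (B \<times> space S) (u, v) \<partial>\<nu> x \<partial>\<mu> x)"
      by (rule \<gamma>_int[OF x]) measurable
    also have "\<dots> = (\<integral>\<^sup>+u. (\<integral>\<^sup>+v. h x (u, v) \<partial>\<nu> x) * indicator B u \<partial>\<mu> x)"
      by (intro nn_integral_cong) (auto simp: indicator_def spS[OF x] intro!: nn_integral_cong)
    also have "\<dots> \<le> (\<integral>\<^sup>+u. 1 * indicator B u \<partial>\<mu> x)"
      using nn_integral_grid_le_1[OF \<phi>'(2)[OF x] w(1)[OF x] fin(1)[OF x] ab(2)[OF x] fin(2)[OF x]]
      by (intro nn_integral_mono mult_right_mono) (simp_all add: h_def)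
    finally show ?thesis using B pS(3)[OF x] by simp
  qed
  have \<gamma>2: "emeasure (\<gamma> x) (space S \<times> B) \<le> emeasure (\<nu> x) B" if x: "x \<in> space X" and B [measurable]: "B \<in> sets S" for x B
  proof -
    interpret \<mu>: prob_space "\<mu> x" by (rule pS(1)[OF x])
    interpret \<nu>: prob_space "\<nu> x" by (rule pS(2)[OF x])
    interpret \<mu>\<nu>: pair_sigma_finite "\<mu> x" "\<nu> x" ..
    note [measurable] = hx[OF x]
    have "emeasure (\<gamma> x) (space S \<times> B) = (\<integral>\<^sup>+z. indicator (space S \<times> B) z \<partial>\<gamma> x)"
      using x by (simp add: \<gamma>_sets)
    also have "\<dots> = (\<integral>\<^sup>+u. \<integral>\<^sup>+v. h x (u, v) * indicator (space S \<times> B) (u, v) \<partial>\<nu> x \<partial>\<mu> x)"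
      by (rule \<gamma>_int[OF x]) measurable
    also have "\<dots> = (\<integral>\<^sup>+v. \<integral>\<^sup>+u. h x (u, v) * indicator (space S \<times> B) (u, v) \<partial>\<mu> x \<partial>\<nu> x)"
    proof (rule \<mu>\<nu>.Fubini'[symmetric])
      show "(\<lambda>(u, v). h x (u, v) * indicator (space S \<times> B) (u, v)) \<in> borel_measurable (?P x)"
        unfolding measurable_cong_sets[OF sets_P[OF x] refl] by measurable
    qed
    also have "\<dots> = (\<integral>\<^sup>+v. (\<integral>\<^sup>+u. h x (u, v) \<partial>\<mu> x) * indicator B v \<partial>\<nu> x)"
      by (intro nn_integral_cong) (auto simp: indicator_def spS[OF x] intro!: nn_integral_cong)
    also have "\<dots> \<le> (\<integral>\<^sup>+v. 1 * indicator B v \<partial>\<nu> x)"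
      using nn_integral_grid_le_1[OF \<phi>'(1)[OF x] w(2)[OF x] fin(2)[OF x] ab(1)[OF x] fin(1)[OF x]]
      by (intro nn_integral_mono mult_right_mono) (simp_all add: h_def mult.commute[of "b x _" "a x _"])
    finally show ?thesis using B pS(4)[OF x] by simp
  qed
  have \<gamma>_mass: "emeasure (\<gamma> x) (space (\<gamma> x)) = (\<Sum>k. \<Sum>l. w x k l)" if x: "x \<in> space X" for x
  proof -
    have "emeasure (\<gamma> x) (space (\<gamma> x)) = (\<integral>\<^sup>+z. 1 \<partial>\<gamma> x)" by simp
    also have "\<dots> = (\<Sum>k. \<Sum>l. w x k l)"
      using \<gamma>_int[OF x, of "\<lambda>_. 1"] \<gamma>_grid[OF x, of "\<lambda>_ _. 1"] by simp
    finally show ?thesis .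
  qed
  have \<gamma>_space: "space (\<gamma> x) = space S \<times> space S" if "x \<in> space X" for x
    using sets_eq_imp_space_eq[OF \<gamma>_sets[OF that]] by (simp add: space_pair_measure)
  have \<gamma>_le_1: "emeasure (\<gamma> x) (space (\<gamma> x)) \<le> 1" if x: "x \<in> space X" for x
    using \<gamma>1[OF x sets.top] prob_space.emeasure_space_1[OF pS(1)[OF x]] by (simp add: \<gamma>_space x spS)
  have \<gamma> [measurable]: "\<gamma> \<in> X \<rightarrow>\<^sub>M subprob_algebra ?SS"
  proof (rule measurable_subprob_algebra)
    fix x assume x: "x \<in> space X"
    show "subprob_space (\<gamma> x)"
      using \<gamma>_le_1[OF x] prob_space.not_empty[OF pS(1)[OF x]] by (intro subprob_spaceI) (auto simp: \<gamma>_space x spS)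
    show "sets (\<gamma> x) = sets ?SS" by (rule \<gamma>_sets[OF x])
  next
    fix C assume [measurable]: "C \<in> sets ?SS"
    have "emeasure (\<gamma> x) C = (\<integral>\<^sup>+z. h x z * indicator C z \<partial>(?P x))" if x: "x \<in> space X" for x
      unfolding \<gamma>_def using hx[OF x] sets_P[OF x]
      by (intro emeasure_density) (simp_all cong: measurable_cong_sets)
    moreover have "(\<lambda>x. \<integral>\<^sup>+z. h x z * indicator C z \<partial>(?P x)) \<in> borel_measurable X"
      by (rule nn_integral_measurable_subprob_algebra2[where N="?SS"])
        (measurable, intro measurable_pair_measure, measurable)
    ultimately show "(\<lambda>x. emeasure (\<gamma> x) C) \<in> borel_measurable X"
      by (subst measurable_cong)
  qed
  define K where "K x = complete_coupling (\<mu> x) (\<nu> x) (\<gamma> x)" for x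
  show ?thesis
  proof (intro bexI ballI conjI)
    show "K \<in> X \<rightarrow>\<^sub>M prob_algebra ?SS"
      unfolding K_def by (rule measurable_complete_coupling[OF \<mu> \<nu> \<gamma> \<gamma>1 \<gamma>2])
    fix x assume x: "x \<in> space X"
    have s: "sets (\<gamma> x) = sets (?P x)" by (simp add: \<gamma>_sets sets_P x)
    have m1: "emeasure (\<gamma> x) (A \<times> space (\<nu> x)) \<le> emeasure (\<mu> x) A" if "A \<in> sets (\<mu> x)" for A
      using \<gamma>1[OF x] that by (simp add: spS pS x)
    have m2: "emeasure (\<gamma> x) (space (\<mu> x) \<times> A) \<le> emeasure (\<nu> x) A" if "A \<in> sets (\<nu> x)" for A
      using \<gamma>2[OF x] that by (simp add: spS pS x)
    show "K x \<in> couplings (\<mu> x) (\<nu> x)"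
      unfolding K_def by (rule complete_coupling[OF pS(1,2)[OF x] s m1 m2])
    obtain u0 where u0: "u0 \<in> space S" using prob_space.not_empty[OF pS(1)[OF x]] spS[OF x] by auto
    have D: "0 \<le> D" using d_nonneg[OF u0 u0] d_le[OF u0 u0] by linarith
    have "transport_cost d (K x) \<le>
      transport_cost d (\<gamma> x) + ennreal D * (1 - emeasure (\<gamma> x) (space (\<gamma> x)))"
      unfolding K_def
    proof (rule complete_coupling_cost[OF pS(1,2)[OF x] s m1 m2])
      show "(\<lambda>(u, v). ennreal (d u v)) \<in> borel_measurable (\<gamma> x)"
        by (simp add: measurable_cong_sets[OF \<gamma>_sets[OF x] refl])
    qed (auto simp: \<gamma>_space x intro!: ennreal_leI d_le)
    also have "ennreal D * (1 - emeasure (\<gamma> x) (space (\<gamma> x))) \<le> ennreal D * ennreal \<delta>'"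
    proof (intro mult_left_mono)
      have "1 \<le> emeasure (\<gamma> x) (space (\<gamma> x)) + ennreal \<delta>'"
        using w(3)[OF x] by (simp add: \<gamma>_mass[OF x] ennreal_minus_le_iff add.commute)
      then show "1 - emeasure (\<gamma> x) (space (\<gamma> x)) \<le> ennreal \<delta>'"
        by (simp add: ennreal_minus_le_iff)
    qed simp
    also have "ennreal D * ennreal \<delta>' \<le> ennreal \<delta>"
      using \<delta> D by (simp add: ennreal_mult[symmetric] ennreal_leI)
    also have "transport_cost d (\<gamma> x) = (\<integral>\<^sup>+u. \<integral>\<^sup>+v. h x (u, v) * ennreal (d u v) \<partial>\<nu> x \<partial>\<mu> x)"
      by (subst \<gamma>_int[OF x]) (simp_all)
    also have "\<dots> \<le> (\<integral>\<^sup>+u. \<integral>\<^sup>+v. h x (u, v) * (c0 (\<phi> u) (\<phi> v) + ennreal (2 * \<delta>)) \<partial>\<nu> x \<partial>\<mu> x)"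
      by (intro nn_integral_mono mult_left_mono d_c0) (auto simp: spS[OF x])
    also have "\<dots> = (\<Sum>k. \<Sum>l. w x k l * (c0 k l + ennreal (2 * \<delta>)))"
      by (rule \<gamma>_grid[OF x])
    also have "\<dots> = (\<Sum>k. \<Sum>l. w x k l * c0 k l) + (\<Sum>k. \<Sum>l. w x k l) * ennreal (2 * \<delta>)"
      by (simp add: distrib_left suminf_add[symmetric])
    also have "\<dots> \<le> ennreal (c x + \<delta>) + 1 * ennreal (2 * \<delta>)"
      using w(4)[OF x] \<gamma>_le_1[OF x] by (intro add_mono mult_right_mono) (simp_all add: \<gamma>_mass[OF x])
    also have "ennreal (c x + \<delta>) + 1 * ennreal (2 * \<delta>) + ennreal \<delta> = ennreal (c x + \<epsilon>)"
      using \<delta> c_nonneg[OF x] by (simp add: ennreal_plus[symmetric] \<delta>_def del: ennreal_plus)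
    finally show "transport_cost d (K x) \<le> ennreal (c x + \<epsilon>)"
      by (simp add: add_right_mono)
  qed
qed

end

section \<open>Coupled uniformized chains\<close>

primrec kernel_power :: "'s measure \<Rightarrow> ('s \<Rightarrow> 's measure) \<Rightarrow> nat \<Rightarrow> 's \<Rightarrow> 's measure" where
  "kernel_power S K 0 = return S"
| "kernel_power S K (Suc n) = (\<lambda>x. K x \<bind> kernel_power S K n)"

lemma measurable_kernel_power:
  assumes "K \<in> S \<rightarrow>\<^sub>M prob_algebra S"
  shows "kernel_power S K n \<in> S \<rightarrow>\<^sub>M prob_algebra S"
  by (induction n) (auto intro!: measurable_bind_prob_space assms)

lemma kernel_power_space:
  assumes "K \<in> S \<rightarrow>\<^sub>M prob_algebra S" "x \<in> space S"
  shows "prob_space (kernel_power S K n x)" "sets (kernel_power S K n x) = sets S"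
  using measurable_space[OF measurable_kernel_power[OF assms(1)] assms(2)]
  by (auto simp: space_prob_algebra)

lemma nn_integral_kernel_power_Suc:
  assumes K: "K \<in> S \<rightarrow>\<^sub>M prob_algebra S" and x: "x \<in> space S" and f: "f \<in> borel_measurable S"
  shows "(\<integral>\<^sup>+z. f z \<partial>kernel_power S K (Suc n) x) = (\<integral>\<^sup>+y. \<integral>\<^sup>+z. f z \<partial>kernel_power S K n y \<partial>K x)"
proof -
  have "sets (K x) = sets S" using measurable_space[OF K x] by (simp add: space_prob_algebra)
  then have "kernel_power S K n \<in> K x \<rightarrow>\<^sub>M subprob_algebra S"
    using measurable_prob_algebraD[OF measurable_kernel_power[OF K]] by (simp cong: measurable_cong_sets)
  from nn_integral_bind[OF f this] show ?thesis by simp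
qed

lemma emeasure_kernel_power_Suc:
  assumes K: "K \<in> S \<rightarrow>\<^sub>M prob_algebra S" and x: "x \<in> space S" and A: "A \<in> sets S"
  shows "emeasure (kernel_power S K (Suc n) x) A = (\<integral>\<^sup>+y. emeasure (kernel_power S K n y) A \<partial>K x)"
  by (simp add: emeasure_bind_prob_algebra[OF measurable_space[OF K x] measurable_kernel_power[OF K] A])

lemma kernel_power_absorbing:
  assumes K: "K \<in> S \<rightarrow>\<^sub>M prob_algebra S" and x: "x \<in> space S" and "K x = return S x"
  shows "kernel_power S K n x = return S x"
proof (induction n)
  case (Suc n)
  then show ?case
    using assms bind_return[OF measurable_prob_algebraD[OF measurable_kernel_power[OF K]] x, of n] by simp
qed simp

text \<open>For \<open>m = r * t\<close> this is the law at time t of the process that applies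
  \<open>K\<close> at rate \<open>r\<close>; as an operator it is
  \<open>exp (r * t * (K - I))\<close>.\<close>

definition poisson_mixture :: "'s measure \<Rightarrow> ('s \<Rightarrow> 's measure) \<Rightarrow> real \<Rightarrow> 's \<Rightarrow> 's measure" where
  "poisson_mixture S K m x = measure_pmf (poisson_pmf m) \<bind> (\<lambda>n. kernel_power S K n x)"

lemma poisson_mixture_kernel:
  assumes "K \<in> S \<rightarrow>\<^sub>M prob_algebra S" "x \<in> space S"
  shows "(\<lambda>n. kernel_power S K n x) \<in> measure_pmf p \<rightarrow>\<^sub>M prob_algebra S"
  using kernel_power_space[OF assms] by (auto simp: space_prob_algebra measurable_def)

lemma poisson_mixture_space:
  assumes "K \<in> S \<rightarrow>\<^sub>M prob_algebra S" "x \<in> space S"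
  shows "prob_space (poisson_mixture S K m x)" "sets (poisson_mixture S K m x) = sets S"
  using prob_space_bind'[OF _ poisson_mixture_kernel[OF assms]] sets_bind'[OF _ poisson_mixture_kernel[OF assms]]
  by (auto simp: poisson_mixture_def space_prob_algebra prob_space_measure_pmf)

abbreviation poisson_weight :: "real \<Rightarrow> nat \<Rightarrow> ennreal" where
  "poisson_weight m n \<equiv> ennreal (m ^ n / fact n * exp (- m))"

lemma nn_integral_poisson_mixture:
  assumes K: "K \<in> S \<rightarrow>\<^sub>M prob_algebra S" and x: "x \<in> space S" and f: "f \<in> borel_measurable S" and m: "0 < m"
  shows "(\<integral>\<^sup>+z. f z \<partial>poisson_mixture S K m x) =
    (\<Sum>n. poisson_weight m n * (\<integral>\<^sup>+z. f z \<partial>kernel_power S K n x))"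
proof -
  have "(\<integral>\<^sup>+z. f z \<partial>poisson_mixture S K m x) = (\<integral>\<^sup>+n. \<integral>\<^sup>+z. f z \<partial>kernel_power S K n x \<partial>measure_pmf (poisson_pmf m))"
    unfolding poisson_mixture_def
    by (rule nn_integral_bind[OF f measurable_prob_algebraD[OF poisson_mixture_kernel[OF K x]]])
  then show ?thesis
    using m by (simp add: nn_integral_measure_pmf nn_integral_count_space_nat)
qed

lemma emeasure_poisson_mixture:
  assumes K: "K \<in> S \<rightarrow>\<^sub>M prob_algebra S" and x: "x \<in> space S" and A: "A \<in> sets S" and m: "0 < m"
  shows "emeasure (poisson_mixture S K m x) A =
    (\<Sum>n. poisson_weight m n * emeasure (kernel_power S K n x) A)"
  using nn_integral_poisson_mixture[OF K x _ m, of "indicator A"] A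
  by (simp add: poisson_mixture_space[OF K x] kernel_power_space[OF K x])

text \<open>The generating function of the Poisson law: it turns a factor \<rho> per step into an
  exponential in time.\<close>

lemma poisson_sum:
  assumes "0 \<le> m" "0 \<le> \<rho>"
  shows "(\<Sum>n. poisson_weight m n * ennreal (\<rho> ^ n)) = ennreal (exp (- m * (1 - \<rho>)))"
proof -
  have "(\<lambda>n. exp (- m) * ((m * \<rho>) ^ n /\<^sub>R fact n)) sums (exp (- m) * exp (m * \<rho>))"
    by (intro sums_mult exp_converges)
  then have s: "(\<lambda>n. m ^ n / fact n * exp (- m) * \<rho> ^ n) sums (exp (- m) * exp (m * \<rho>))"
    by (simp add: power_mult_distrib field_simps)
  have "(\<Sum>n. poisson_weight m n * ennreal (\<rho> ^ n)) = (\<Sum>n. ennreal (m ^ n / fact n * exp (- m) * \<rho> ^ n))"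
    using assms by (intro suminf_cong, subst ennreal_mult[symmetric]) auto
  also have "\<dots> = ennreal (exp (- m) * exp (m * \<rho>))"
    using s assms by (intro suminf_ennreal_eq) auto
  also have "exp (- m) * exp (m * \<rho>) = exp (- m * (1 - \<rho>))"
    by (simp add: exp_add[symmetric] algebra_simps)
  finally show ?thesis .
qed

text \<open>A coupled chain whose one-step projection depends only on the projected state projects
  onto a single chain. It is used with \<open>fst\<close> and \<open>snd\<close> to recover the
  marginals of the coupled chain.\<close>

lemma distr_kernel_power:
  assumes C: "C \<in> Z \<rightarrow>\<^sub>M prob_algebra Z" and K: "K \<in> S \<rightarrow>\<^sub>M prob_algebra S" and f: "f \<in> Z \<rightarrow>\<^sub>M S"
    and proj: "\<And>z. z \<in> space Z \<Longrightarrow> distr (C z) S f = K (f z)"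
  shows "z \<in> space Z \<Longrightarrow> distr (kernel_power Z C n z) S f = kernel_power S K n (f z)"
proof (induction n arbitrary: z)
  case 0
  then show ?case using f by (simp add: distr_return)
next
  case (Suc n)
  have Cz: "sets (C z) = sets Z" "space (C z) \<noteq> {}"
    using measurable_space[OF C Suc.prems] by (auto simp: space_prob_algebra dest: prob_space.not_empty)
  note m = measurable_prob_algebraD[OF measurable_kernel_power[OF C, of n]] measurable_prob_algebraD[OF measurable_kernel_power[OF K, of n]]
  have "distr (C z \<bind> kernel_power Z C n) S f = C z \<bind> (\<lambda>w. distr (kernel_power Z C n w) S f)"
    using m(1) Cz f by (intro distr_bind[where K=Z]) (simp_all cong: measurable_cong_sets)
  also have "\<dots> = C z \<bind> (\<lambda>w. kernel_power S K n (f w))"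
    using Suc.IH sets_eq_imp_space_eq[OF Cz(1)] by (intro bind_cong) auto
  also have "\<dots> = distr (C z) S f \<bind> kernel_power S K n"
    using f Cz m(2) by (intro bind_distr[symmetric]) (simp_all cong: measurable_cong_sets)
  finally show ?case using proj[OF Suc.prems] by simp
qed

lemma distr_poisson_mixture:
  assumes C: "C \<in> Z \<rightarrow>\<^sub>M prob_algebra Z" and K: "K \<in> S \<rightarrow>\<^sub>M prob_algebra S" and f: "f \<in> Z \<rightarrow>\<^sub>M S"
    and proj: "\<And>z. z \<in> space Z \<Longrightarrow> distr (C z) S f = K (f z)" and z: "z \<in> space Z"
  shows "distr (poisson_mixture Z C m z) S f = poisson_mixture S K m (f z)"
proof -
  have "distr (poisson_mixture Z C m z) S f = measure_pmf (poisson_pmf m) \<bind> (\<lambda>n. distr (kernel_power Z C n z) S f)"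
    unfolding poisson_mixture_def
    using measurable_prob_algebraD[OF poisson_mixture_kernel[OF C z]] f by (intro distr_bind) simp_all
  then show ?thesis
    by (simp add: distr_kernel_power[OF C K f proj z] poisson_mixture_def)
qed

section \<open>Coupling of two uniformized chains\<close>

context separable_cost
begin

text \<open>Both chains are run with a measurable, almost optimal coupling of each step and observed
  at the same Poisson time. Outside \<open>G \<times> G\<close> no contraction is known, but there
  one component is frozen outside \<open>G\<close> for good, so the pair no longer contributes to
  the integral.\<close>

lemma uniformized_coupling:
  assumes Q: "Q \<in> S \<rightarrow>\<^sub>M prob_algebra S" and G [measurable]: "G \<in> sets S"
    and absorbing: "\<And>x. x \<in> space S \<Longrightarrow> x \<notin> G \<Longrightarrow> Q x = return S x"
    and \<rho>: "0 \<le> \<rho>" and m: "0 < m" and \<epsilon>: "0 < \<epsilon>"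
    and contr: "\<And>x y e. x \<in> G \<Longrightarrow> y \<in> G \<Longrightarrow> 0 < e \<Longrightarrow>
      transport_le d (Q x) (Q y) (ennreal (\<rho> * d x y + e))"
    and x: "x \<in> space S" and y: "y \<in> space S"
  shows "\<exists>\<gamma>\<in>couplings (poisson_mixture S Q m x) (poisson_mixture S Q m y).
      (\<integral>\<^sup>+(u, v). ennreal (d u v) * indicator (G \<times> G) (u, v) \<partial>\<gamma>) \<le> ennreal (exp (- m * (1 - \<rho>)) * d x y + \<epsilon>)"
proof -
  let ?SS = "S \<Otimes>\<^sub>M S"
  \<comment> \<open>\<open>\<rho>\<close> may exceed 1, so the error of \<open>n\<close> steps is only bounded by \<open>\<delta> * (2 * b) ^ n\<close>; its Poisson average
    is compensated by the choice of \<open>\<delta>\<close>\<close>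
  define b where "b = max 1 \<rho>"
  have b: "1 \<le> b" "\<rho> \<le> b" by (auto simp: b_def)
  define \<delta> where "\<delta> = \<epsilon> * exp (m * (1 - 2 * b))"
  have \<delta>: "0 < \<delta>" using \<epsilon> by (simp add: \<delta>_def)
  have D: "0 \<le> D" using d_nonneg[OF x x] d_le[OF x x] by linarith
  have G_sub: "z \<in> space S" if "z \<in> G" for z using that sets.sets_into_space[OF G] by auto
  \<comment> \<open>Off \<open>G \<times> G\<close> any coupling will do, so only the trivial bound
    \<open>D\<close> is prescribed there.\<close>
  define c where "c z = (if fst z \<in> G \<and> snd z \<in> G then \<rho> * d (fst z) (snd z) else D)" for z
  have [measurable]: "(\<lambda>z. d (fst z) (snd z)) \<in> borel_measurable ?SS"
    using d_measurable by (simp add: case_prod_unfold)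
  have Q_sp: "prob_space (Q x)" "sets (Q x) = sets S" if "x \<in> space S" for x
    using measurable_space[OF Q that] by (auto simp: space_prob_algebra)
  have "\<exists>C\<in>?SS \<rightarrow>\<^sub>M prob_algebra ?SS. \<forall>z\<in>space ?SS. C z \<in> couplings (Q (fst z)) (Q (snd z)) \<and>
      transport_cost d (C z) \<le> ennreal (c z + \<delta>)"
  proof (rule exists_measurable_coupling)
    show "c \<in> borel_measurable ?SS"
      unfolding c_def by measurable
    fix z assume "z \<in> space ?SS"
    then have z: "fst z \<in> space S" "snd z \<in> space S" by (auto simp: space_pair_measure)
    show "0 \<le> c z" using \<rho> D d_nonneg[OF z] by (simp add: c_def)
    fix e :: real assume e: "0 < e"
    show "transport_le d (Q (fst z)) (Q (snd z)) (ennreal (c z + e))"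
    proof (cases "fst z \<in> G \<and> snd z \<in> G")
      case True
      then show ?thesis using contr[OF _ _ e] by (simp add: c_def)
    next
      case False
      have "transport_le d (Q (fst z)) (Q (snd z)) (ennreal D)"
        by (rule transport_le_bounded[OF d_measurable]) (simp_all add: Q_sp z d_le)
      then show ?thesis
        by (rule transport_le_mono) (use False e in \<open>auto simp: c_def intro!: ennreal_leI\<close>)
    qed
  qed (rule measurable_compose[OF measurable_fst Q] measurable_compose[OF measurable_snd Q] \<delta>)+
  then obtain C where C: "C \<in> ?SS \<rightarrow>\<^sub>M prob_algebra ?SS"
    and C': "\<And>z. z \<in> space ?SS \<Longrightarrow> C z \<in> couplings (Q (fst z)) (Q (snd z)) \<and>
      transport_cost d (C z) \<le> ennreal (c z + \<delta>)"
    by blast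
  have cost: "transport_cost d (C (x, y)) \<le> ennreal (c (x, y) + \<delta>)" if "x \<in> space S" "y \<in> space S" for x y
    using C'[of "(x, y)"] that by (simp add: space_pair_measure)
  have proj: "distr (C z) S fst = Q (fst z)" "distr (C z) S snd = Q (snd z)" if "z \<in> space ?SS" for z
    using C'[OF that] that
      distr_cong[OF refl Q_sp(2), of "fst z" "C z" fst fst] distr_cong[OF refl Q_sp(2), of "snd z" "C z" snd snd]
    by (auto simp: couplings_def space_pair_measure)
  let ?f = "\<lambda>(u, v). ennreal (d u v) * indicator (G \<times> G) (u, v)"
  have f [measurable]: "?f \<in> borel_measurable ?SS" by measurable
  have step: "(\<integral>\<^sup>+z. ?f z \<partial>kernel_power ?SS C n (x, y)) \<le> ennreal (\<rho> ^ n * d x y + \<delta> * (2 * b) ^ n)"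
    if "x \<in> space S" "y \<in> space S" for n x y
    using that
  proof (induction n arbitrary: x y)
    case 0
    then have "(x, y) \<in> space ?SS" by (simp add: space_pair_measure)
    then have "(\<integral>\<^sup>+z. ?f z \<partial>kernel_power ?SS C 0 (x, y)) = ?f (x, y)"
      by (simp add: nn_integral_return)
    also have "\<dots> \<le> ennreal (d x y + \<delta>)"
      using \<delta> by (auto simp: indicator_def intro!: ennreal_leI)
    finally show ?case by simp
  next
    case (Suc n)
    have xy: "(x, y) \<in> space ?SS" using Suc.prems by (simp add: space_pair_measure)
    have sC [measurable_cong]: "sets (C (x, y)) = sets ?SS"
      using measurable_space[OF C xy] by (simp add: space_prob_algebra)
    interpret C: prob_space "C (x, y)"
      using measurable_space[OF C xy] by (simp add: space_prob_algebra)
    show ?case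
    proof (cases "x \<in> G \<and> y \<in> G")
      case False
      let ?M = "kernel_power ?SS C (Suc n) (x, y)"
      have sM: "sets ?M = sets ?SS" by (rule kernel_power_space(2)[OF C xy])
      have "distr ?M S fst = kernel_power S Q (Suc n) x" "distr ?M S snd = kernel_power S Q (Suc n) y"
        using distr_kernel_power[OF C Q measurable_fst proj(1) xy] distr_kernel_power[OF C Q measurable_snd proj(2) xy]
        by (simp_all del: kernel_power.simps)
      then have "x \<notin> G \<Longrightarrow> emeasure ?M (G \<times> space S) = 0" "y \<notin> G \<Longrightarrow> emeasure ?M (space S \<times> G) = 0"
        using emeasure_distr_proj[OF sM] Suc.prems kernel_power_absorbing[OF Q _ absorbing]
        by (simp_all del: kernel_power.simps flip: emeasure_distr_proj[OF sM])
      moreover have "emeasure ?M (G \<times> G) \<le> emeasure ?M (G \<times> space S)" "emeasure ?M (G \<times> G) \<le> emeasure ?M (space S \<times> G)"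
        using G_sub by (auto intro!: emeasure_mono simp: sM simp del: kernel_power.simps)
      ultimately have "emeasure ?M (G \<times> G) = 0"
        using False by (auto simp del: kernel_power.simps)
      moreover have "(\<integral>\<^sup>+z. ?f z \<partial>?M) \<le> (\<integral>\<^sup>+z. ennreal D * indicator (G \<times> G) z \<partial>?M)"
        by (intro nn_integral_mono) (auto simp: indicator_def G_sub intro!: ennreal_leI d_le)
      ultimately have "(\<integral>\<^sup>+z. ?f z \<partial>?M) = 0"
        by (simp add: sM nn_integral_cmult_indicator del: kernel_power.simps)
      then show ?thesis by simp
    next
      case True
      have "(\<integral>\<^sup>+z. ?f z \<partial>kernel_power ?SS C (Suc n) (x, y)) =
        (\<integral>\<^sup>+w. \<integral>\<^sup>+z. ?f z \<partial>kernel_power ?SS C n w \<partial>C (x, y))"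
        by (rule nn_integral_kernel_power_Suc[OF C xy f])
      \<comment> \<open>The induction hypothesis is affine in \<open>d u v\<close>, so integrating
        it over one coupled step only involves the transport cost of that step.\<close>
      also have "\<dots> \<le> (\<integral>\<^sup>+(u, v). ennreal (\<rho> ^ n) * ennreal (d u v) + ennreal (\<delta> * (2 * b) ^ n) \<partial>C (x, y))"
      proof (intro nn_integral_mono)
        fix w assume "w \<in> space (C (x, y))"
        then obtain u v where w: "w = (u, v)" "u \<in> space S" "v \<in> space S"
          using sets_eq_imp_space_eq[OF sC] by (auto simp: space_pair_measure)
        show "(\<integral>\<^sup>+z. ?f z \<partial>kernel_power ?SS C n w)
            \<le> (case w of (u, v) \<Rightarrow> ennreal (\<rho> ^ n) * ennreal (d u v) + ennreal (\<delta> * (2 * b) ^ n))"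
          using Suc.IH[OF w(2,3)] \<rho> \<delta> b d_nonneg[OF w(2,3)]
          by (simp add: w(1) ennreal_mult[symmetric] ennreal_plus[symmetric] del: ennreal_plus)
      qed
      also have "\<dots> = ennreal (\<rho> ^ n) * transport_cost d (C (x, y)) + ennreal (\<delta> * (2 * b) ^ n)"
        by (simp add: case_prod_unfold nn_integral_add nn_integral_cmult C.emeasure_space_1)
      also have "\<dots> \<le> ennreal (\<rho> ^ n) * ennreal (\<rho> * d x y + \<delta>) + ennreal (\<delta> * (2 * b) ^ n)"
        using cost[OF Suc.prems] True by (intro add_right_mono mult_left_mono) (auto simp: c_def)
      also have "\<dots> = ennreal (\<rho> ^ n * (\<rho> * d x y + \<delta>) + \<delta> * (2 * b) ^ n)"
        using \<rho> \<delta> b d_nonneg[OF Suc.prems] by (simp add: ennreal_mult ennreal_plus)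
      also have "\<dots> \<le> ennreal (\<rho> ^ Suc n * d x y + \<delta> * (2 * b) ^ Suc n)"
      proof (rule ennreal_leI)
        \<comment> \<open>The factor 2 absorbs the sum of two errors, the one accumulated so far and
          the new one, which the remaining steps multiply by \<open>\<rho> ^ n\<close>.\<close>
        have "\<rho> ^ n \<le> (2 * b) ^ n" using \<rho> b by (intro power_mono) auto
        moreover have "1 * (2 * b) ^ n \<le> b * (2 * b) ^ n" using b by (intro mult_right_mono) auto
        ultimately have "\<rho> ^ n + (2 * b) ^ n \<le> (2 * b) ^ Suc n"
          unfolding power_Suc mult.assoc[of 2 b "(2 * b) ^ n"] by linarith
        then have "\<delta> * (\<rho> ^ n + (2 * b) ^ n) \<le> \<delta> * (2 * b) ^ Suc n" using \<delta> by (intro mult_left_mono) auto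
        then show "\<rho> ^ n * (\<rho> * d x y + \<delta>) + \<delta> * (2 * b) ^ n \<le> \<rho> ^ Suc n * d x y + \<delta> * (2 * b) ^ Suc n"
          by (simp add: algebra_simps)
      qed
      finally show ?thesis .
    qed
  qed
  have xy: "(x, y) \<in> space ?SS" using x y by (simp add: space_pair_measure)
  have "(\<integral>\<^sup>+z. ?f z \<partial>poisson_mixture ?SS C m (x, y)) =
     (\<Sum>n. poisson_weight m n * (\<integral>\<^sup>+z. ?f z \<partial>kernel_power ?SS C n (x, y)))"
    by (rule nn_integral_poisson_mixture[OF C xy f m])
  also have "\<dots> \<le> (\<Sum>n. poisson_weight m n * ennreal (\<rho> ^ n) * ennreal (d x y) +
      poisson_weight m n * ennreal ((2 * b) ^ n) * ennreal \<delta>)"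
  proof (intro suminf_le allI)
    fix n
    have "poisson_weight m n * (\<integral>\<^sup>+z. ?f z \<partial>kernel_power ?SS C n (x, y))
      \<le> poisson_weight m n * ennreal (\<rho> ^ n * d x y + \<delta> * (2 * b) ^ n)"
      by (intro mult_left_mono step x y) simp
    also have "ennreal (\<rho> ^ n * d x y + \<delta> * (2 * b) ^ n) = ennreal (\<rho> ^ n) * ennreal (d x y) + ennreal ((2 * b) ^ n) * ennreal \<delta>"
      using \<rho> \<delta> b d_nonneg[OF x y] by (simp add: ennreal_mult ennreal_plus mult.commute)
    finally show "poisson_weight m n * (\<integral>\<^sup>+z. ?f z \<partial>kernel_power ?SS C n (x, y)) \<le>
      poisson_weight m n * ennreal (\<rho> ^ n) * ennreal (d x y) +
      poisson_weight m n * ennreal ((2 * b) ^ n) * ennreal \<delta>"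
      by (simp add: distrib_left mult.assoc)
  qed auto
  also have "\<dots> = ennreal (exp (- m * (1 - \<rho>))) * ennreal (d x y) + ennreal (exp (- m * (1 - 2 * b))) * ennreal \<delta>"
    using m \<rho> b poisson_sum[of m \<rho>] poisson_sum[of m "2 * b"]
    by (subst suminf_add[symmetric]) (simp_all add: ennreal_suminf_multc)
  also have "\<dots> = ennreal (exp (- m * (1 - \<rho>)) * d x y + exp (- m * (1 - 2 * b)) * \<delta>)"
    using \<delta> d_nonneg[OF x y] by (simp add: ennreal_mult ennreal_plus)
  also have "exp (- m * (1 - 2 * b)) * \<delta> = \<epsilon> * (exp (- m * (1 - 2 * b)) * exp (m * (1 - 2 * b)))"
    by (simp add: \<delta>_def)
  also have "exp (- m * (1 - 2 * b)) * exp (m * (1 - 2 * b)) = 1"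
    by (simp add: exp_add[symmetric])
  finally have "(\<integral>\<^sup>+z. ?f z \<partial>poisson_mixture ?SS C m (x, y)) \<le> ennreal (exp (- m * (1 - \<rho>)) * d x y + \<epsilon>)"
    by simp
  moreover have "poisson_mixture ?SS C m (x, y) \<in> couplings (poisson_mixture S Q m x) (poisson_mixture S Q m y)"
    using distr_poisson_mixture[OF C Q measurable_fst proj(1) xy, of m] distr_poisson_mixture[OF C Q measurable_snd proj(2) xy, of m]
      poisson_mixture_space(2)[OF C xy, of m] poisson_mixture_space(2)[OF Q x, of m] poisson_mixture_space(2)[OF Q y, of m]
    by (simp add: couplings_def cong: sets_pair_measure_cong distr_cong)
  ultimately show ?thesis by blast
qed

lemma wasserstein_le_restricted_coupling:
  assumes \<gamma>: "\<gamma> \<in> couplings \<mu>' \<nu>'" and "sets \<mu>' = sets S" "sets \<nu>' = sets S" "prob_space \<mu>'" "prob_space \<nu>'"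
    and \<mu>: "prob_space \<mu>" "sets \<mu> = sets S" and \<nu>: "prob_space \<nu>" "sets \<nu> = sets S"
    and G [measurable]: "G \<in> sets S"
    and le1: "\<And>A. A \<in> sets S \<Longrightarrow> emeasure \<mu>' (A \<inter> G) \<le> emeasure \<mu> A"
    and le2: "\<And>A. A \<in> sets S \<Longrightarrow> emeasure \<nu>' (A \<inter> G) \<le> emeasure \<nu> A"
  shows "wasserstein d \<mu> \<nu> \<le> (\<integral>\<^sup>+(u, v). ennreal (d u v) * indicator (G \<times> G) (u, v) \<partial>\<gamma>) +
    ennreal D * ((1 - emeasure \<mu>' G) + (1 - emeasure \<nu>' G))"
proof -
  interpret \<mu>': prob_space \<mu>' by fact
  interpret \<nu>': prob_space \<nu>' by fact
  note sp = assms(2,3)[THEN sets_eq_imp_space_eq] \<mu>(2)[THEN sets_eq_imp_space_eq] \<nu>(2)[THEN sets_eq_imp_space_eq]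
  have s\<gamma> [measurable_cong]: "sets \<gamma> = sets (S \<Otimes>\<^sub>M S)"
    using couplings_sets[OF \<gamma>] assms(2,3) by (simp cong: sets_pair_measure_cong)
  have sp\<gamma>: "space \<gamma> = space S \<times> space S" using couplings_space[OF \<gamma>] sp by simp
  note em = couplings_emeasure[OF \<gamma>, unfolded assms(2,3) sp]
  interpret \<gamma>: prob_space \<gamma>
    using em(1)[OF sets.top] \<mu>'.emeasure_space_1 by (intro prob_spaceI) (simp add: sp\<gamma> sp)
  let ?g = "density \<gamma> (indicator (G \<times> G))"
  have sg: "sets ?g = sets (\<mu> \<Otimes>\<^sub>M \<nu>)" using \<mu>(2) \<nu>(2) s\<gamma> by (simp cong: sets_pair_measure_cong)
  have eg: "emeasure ?g C = emeasure \<gamma> (C \<inter> (G \<times> G))" if "C \<in> sets (S \<Otimes>\<^sub>M S)" for C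
    using that by (subst emeasure_density) (auto simp: indicator_inter_arith[symmetric] mult.commute s\<gamma> Int_commute)
  have m1: "emeasure ?g (A \<times> space \<nu>) \<le> emeasure \<mu> A" if "A \<in> sets \<mu>" for A
  proof -
    have [measurable]: "A \<in> sets S" using that \<mu> by simp
    have "emeasure ?g (A \<times> space \<nu>) = emeasure \<gamma> (A \<times> space S \<inter> G \<times> G)" by (simp add: eg sp)
    also have "\<dots> \<le> emeasure \<gamma> ((A \<inter> G) \<times> space S)"
      by (intro emeasure_mono) (auto simp: s\<gamma>)
    also have "\<dots> \<le> emeasure \<mu> A" using le1[of A] by (simp add: em)
    finally show ?thesis .
  qed
  have m2: "emeasure ?g (space \<mu> \<times> A) \<le> emeasure \<nu> A" if "A \<in> sets \<nu>" for A
  proof -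
    have [measurable]: "A \<in> sets S" using that \<nu> by simp
    have "emeasure ?g (space \<mu> \<times> A) = emeasure \<gamma> (space S \<times> A \<inter> G \<times> G)" by (simp add: eg sp)
    also have "\<dots> \<le> emeasure \<gamma> (space S \<times> (A \<inter> G))"
      by (intro emeasure_mono) (auto simp: s\<gamma>)
    also have "\<dots> \<le> emeasure \<nu> A" using le2[of A] by (simp add: em)
    finally show ?thesis .
  qed
  note cc = complete_coupling[OF \<mu>(1) \<nu>(1) sg m1 m2]
  have "wasserstein d \<mu> \<nu> \<le> transport_cost d (complete_coupling \<mu> \<nu> ?g)"
    unfolding wasserstein_def by (rule INF_lower[OF cc])
  also have "\<dots> \<le> transport_cost d ?g + ennreal D * (1 - emeasure ?g (space ?g))"
    by (rule complete_coupling_cost[OF \<mu>(1) \<nu>(1) sg m1 m2])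
      (auto simp: sp\<gamma> intro!: ennreal_leI d_le cong: measurable_cong_sets)
  also have "transport_cost d ?g = (\<integral>\<^sup>+(u, v). ennreal (d u v) * indicator (G \<times> G) (u, v) \<partial>\<gamma>)"
    by (subst nn_integral_density) (auto simp: mult.commute case_prod_unfold)
  also have "1 - emeasure ?g (space ?g) \<le> (1 - emeasure \<mu>' G) + (1 - emeasure \<nu>' G)"
  proof -
    have GS: "G \<subseteq> space S" using sets.sets_into_space[OF G] .
    have "1 = emeasure \<gamma> (space S \<times> space S)" using \<gamma>.emeasure_space_1 by (simp add: sp\<gamma>)
    also have "\<dots> \<le> emeasure \<gamma> (G \<times> G \<union> ((space S - G) \<times> space S \<union> space S \<times> (space S - G)))"
      by (intro emeasure_mono) (auto simp: s\<gamma>)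
    also have "\<dots> \<le> emeasure \<gamma> (G \<times> G) + (emeasure \<gamma> ((space S - G) \<times> space S) + emeasure \<gamma> (space S \<times> (space S - G)))"
      by (intro order_trans[OF emeasure_subadditive] add_left_mono) (auto simp: s\<gamma> intro!: emeasure_subadditive)
    also have "emeasure \<gamma> ((space S - G) \<times> space S) = 1 - emeasure \<mu>' G"
      using emeasure_compl[of G \<mu>'] by (simp add: em assms sp \<mu>'.emeasure_space_1[unfolded sp])
    also have "emeasure \<gamma> (space S \<times> (space S - G)) = 1 - emeasure \<nu>' G"
      using emeasure_compl[of G \<nu>'] by (simp add: em assms sp \<nu>'.emeasure_space_1[unfolded sp])
    finally have "1 \<le> emeasure \<gamma> (G \<times> G) + ((1 - emeasure \<mu>' G) + (1 - emeasure \<nu>' G))" .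
    moreover have "emeasure ?g (space ?g) = emeasure \<gamma> (G \<times> G)"
      using GS by (simp add: sp\<gamma> eg) (auto intro!: arg_cong[where f="emeasure \<gamma>"])
    ultimately show ?thesis by (simp add: ennreal_minus_le_iff)
  qed
  finally show ?thesis by (simp add: add_left_mono mult_left_mono)
qed

end

section \<open>Truncated jump kernels\<close>

text \<open>On exponential generating functions of bounded sequences, differentiation is the shift
  to \<open>\<alpha> (Suc n)\<close>. This turns a recursion in the number of steps into a
  differential equation in time.\<close>

lemma bounded_exp_series:
  fixes \<alpha> :: "nat \<Rightarrow> real"
  assumes "\<And>n. \<bar>\<alpha> n\<bar> \<le> B"
  shows "summable (\<lambda>n. \<alpha> n / fact n * y ^ n)"
    and "((\<lambda>y. \<Sum>n. \<alpha> n / fact n * y ^ n) has_field_derivative (\<Sum>n. \<alpha> (Suc n) / fact n * y ^ n)) (at y)"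
proof -
  have s: "summable (\<lambda>n. \<alpha> n / fact n * y ^ n)" for y
  proof (rule summable_comparison_test)
    have "summable (\<lambda>n. \<bar>y\<bar> ^ n /\<^sub>R fact n)" by (rule summable_exp_generic)
    then show "summable (\<lambda>n. B * (\<bar>y\<bar> ^ n /\<^sub>R fact n))" by (rule summable_mult)
    have "norm (\<alpha> n / fact n * y ^ n) \<le> B * (\<bar>y\<bar> ^ n /\<^sub>R fact n)" for n
      using mult_right_mono[OF assms[of n], of "\<bar>y\<bar> ^ n / fact n"]
      by (simp add: abs_mult power_abs divide_inverse ac_simps)
    then show "\<exists>N. \<forall>n\<ge>N. norm (\<alpha> n / fact n * y ^ n) \<le> B * (\<bar>y\<bar> ^ n /\<^sub>R fact n)" by blast
  qed
  then show "summable (\<lambda>n. \<alpha> n / fact n * y ^ n)" .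
  have "diffs (\<lambda>n. \<alpha> n / fact n) = (\<lambda>n. \<alpha> (Suc n) / fact n)"
    by (rule ext) (simp add: diffs_def field_simps del: of_nat_Suc)
  then show "((\<lambda>y. \<Sum>n. \<alpha> n / fact n * y ^ n) has_field_derivative (\<Sum>n. \<alpha> (Suc n) / fact n * y ^ n)) (at y)"
    using termdiffs_strong_converges_everywhere[of "\<lambda>n. \<alpha> n / fact n" y, OF s] by simp
qed

lemma poisson_weight_series:
  fixes \<alpha> :: "nat \<Rightarrow> real"
  assumes "\<And>n. 0 \<le> \<alpha> n" "\<And>n. \<alpha> n \<le> B" "0 \<le> m"
  shows "(\<Sum>n. poisson_weight m n * ennreal (\<alpha> n)) = ennreal (exp (- m) * (\<Sum>n. \<alpha> n / fact n * m ^ n))"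
proof -
  have abs: "\<bar>\<alpha> n\<bar> \<le> B" for n using assms(1,2)[of n] by auto
  have "(\<lambda>n. \<alpha> n / fact n * m ^ n) sums (\<Sum>n. \<alpha> n / fact n * m ^ n)"
    by (intro summable_sums bounded_exp_series(1)[OF abs])
  then have s: "(\<lambda>n. exp (- m) * (\<alpha> n / fact n * m ^ n)) sums (exp (- m) * (\<Sum>n. \<alpha> n / fact n * m ^ n))"
    by (rule sums_mult)
  have "poisson_weight m n * ennreal (\<alpha> n) = ennreal (exp (- m) * (\<alpha> n / fact n * m ^ n))" for n
  proof -
    have *: "exp (- m) * (\<alpha> n / fact n * m ^ n) = m ^ n / fact n * exp (- m) * \<alpha> n" by simp
    show ?thesis unfolding * by (rule ennreal_mult[symmetric]) (use assms in auto)
  qed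
  then show ?thesis
    by (simp only: suminf_ennreal_eq[OF _ s] assms mult_nonneg_nonneg divide_nonneg_nonneg exp_ge_zero fact_ge_zero zero_le_power suminf_mult[OF bounded_exp_series(1)[OF abs]])
qed

text \<open>
  Duhamel's formula for the semigroup generated by the bounded operator
  \<open>\<alpha> n \<mapsto> r * (\<alpha> (Suc n) - \<alpha> n)\<close>, which by \<open>rec\<close> equals \<open>\<beta> n - l * \<alpha> n\<close>.
\<close>

lemma poisson_weight_duhamel:
  fixes \<alpha> \<beta> :: "nat \<Rightarrow> real"
  assumes \<alpha>: "\<And>n. 0 \<le> \<alpha> n" "\<And>n. \<alpha> n \<le> B" and \<beta>: "\<And>n. 0 \<le> \<beta> n" "\<And>n. \<beta> n \<le> B"
    and r: "0 \<le> r" and t: "0 \<le> t"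
    and rec: "\<And>n. r * \<alpha> (Suc n) = \<beta> n + (r - l) * \<alpha> n"
  shows "(\<Sum>n. poisson_weight (r * t) n * ennreal (\<alpha> n)) = ennreal (exp (- l * t) * \<alpha> 0) +
    (\<integral>\<^sup>+s. ennreal (exp (- l * s)) * (\<Sum>n. poisson_weight (r * (t - s)) n * ennreal (\<beta> n)) * indicator {0..t} s \<partial>lborel)"
proof -
  define f where "f a y = (\<Sum>n. a n / fact n * y ^ n)" for a :: "nat \<Rightarrow> real" and y :: real
  have ab: "\<bar>\<alpha> n\<bar> \<le> B" "\<bar>\<alpha> (Suc n)\<bar> \<le> B" "\<bar>\<beta> n\<bar> \<le> B" for n
    using \<alpha>[of n] \<alpha>[of "Suc n"] \<beta>[of n] by auto
  have f\<alpha>: "(f \<alpha> has_field_derivative f (\<lambda>n. \<alpha> (Suc n)) y) (at y)" for y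
    unfolding f_def[abs_def] by (rule bounded_exp_series(2)) (rule ab)
  have f\<beta>: "isCont (f \<beta>) y" for y
    unfolding f_def[abs_def] by (rule DERIV_isCont[OF bounded_exp_series(2)]) (rule ab)
  have f_rec: "r * f (\<lambda>n. \<alpha> (Suc n)) y = f \<beta> y + (r - l) * f \<alpha> y" for y
  proof -
    note s = bounded_exp_series(1)[where y=y]
    have s1: "summable (\<lambda>n. \<alpha> n / fact n * y ^ n)" by (rule s) (rule ab)
    have s2: "summable (\<lambda>n. \<alpha> (Suc n) / fact n * y ^ n)" by (rule s[of "\<lambda>n. \<alpha> (Suc n)"]) (rule ab)
    have s3: "summable (\<lambda>n. \<beta> n / fact n * y ^ n)" by (rule s) (rule ab)
    have "r * f (\<lambda>n. \<alpha> (Suc n)) y = (\<Sum>n. r * (\<alpha> (Suc n) / fact n * y ^ n))"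
      unfolding f_def by (rule suminf_mult[symmetric, OF s2])
    also have "\<dots> = (\<Sum>n. \<beta> n / fact n * y ^ n + (r - l) * (\<alpha> n / fact n * y ^ n))"
    proof (rule suminf_cong)
      fix n
      have "r * (\<alpha> (Suc n) / fact n * y ^ n) = (r * \<alpha> (Suc n)) / fact n * y ^ n" by simp
      also have "\<dots> = \<beta> n / fact n * y ^ n + (r - l) * (\<alpha> n / fact n * y ^ n)"
        unfolding rec by (simp add: field_simps)
      finally show "r * (\<alpha> (Suc n) / fact n * y ^ n) = \<beta> n / fact n * y ^ n + (r - l) * (\<alpha> n / fact n * y ^ n)" .
    qed
    also have "\<dots> = f \<beta> y + (r - l) * f \<alpha> y"
      unfolding f_def suminf_mult[OF s1, symmetric] by (rule suminf_add[symmetric, OF s3 summable_mult[OF s1]])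
    finally show ?thesis .
  qed
  \<comment> \<open>\<open>U\<close> and \<open>V\<close> are the Poisson averages of \<alpha> and
    \<beta> at mean \<open>r * s\<close>; the recursion \<open>rec\<close> becomes the equation
    \<open>U' = V - l * U\<close>.\<close>
  define U where "U s = exp (- (r * s)) * f \<alpha> (r * s)" for s
  define V where "V s = exp (- (r * s)) * f \<beta> (r * s)" for s
  have U: "(\<Sum>n. poisson_weight (r * s) n * ennreal (\<alpha> n)) = ennreal (U s)" if "0 \<le> s" for s
    unfolding U_def f_def using \<alpha> r that by (intro poisson_weight_series[of _ B]) auto
  have V: "(\<Sum>n. poisson_weight (r * s) n * ennreal (\<beta> n)) = ennreal (V s)" if "0 \<le> s" for s
    unfolding V_def f_def using \<beta> r that by (intro poisson_weight_series[of _ B]) auto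
  have V_nonneg: "0 \<le> V s" if "0 \<le> s" for s
    unfolding V_def f_def using \<beta> r that ab bounded_exp_series(1)[of \<beta> B]
    by (intro mult_nonneg_nonneg suminf_nonneg) auto
  have U': "(U has_field_derivative V s - l * U s) (at s)" for s
  proof -
    have "(U has_field_derivative exp (- (r * s)) * (- r) * f \<alpha> (r * s) +
        exp (- (r * s)) * (f (\<lambda>n. \<alpha> (Suc n)) (r * s) * r)) (at s)"
      unfolding U_def[abs_def]
      by (auto intro!: derivative_eq_intros DERIV_chain2[OF f\<alpha>])
    also have "exp (- (r * s)) * (- r) * f \<alpha> (r * s) + exp (- (r * s)) * (f (\<lambda>n. \<alpha> (Suc n)) (r * s) * r) =
        exp (- (r * s)) * (r * f (\<lambda>n. \<alpha> (Suc n)) (r * s) - r * f \<alpha> (r * s))"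
      by (simp add: algebra_simps)
    also have "\<dots> = V s - l * U s"
      unfolding f_rec by (simp add: U_def V_def algebra_simps)
    finally show ?thesis .
  qed
  have U0: "U 0 = \<alpha> 0"
    unfolding U_def f_def using powser_zero[of "\<lambda>n. \<alpha> n / fact n"] by simp
  have "continuous_on UNIV V"
    unfolding V_def[abs_def]
    by (intro continuous_at_imp_continuous_on ballI continuous_intros isCont_o2[OF _ f\<beta>])
  then have V_meas [measurable]: "V \<in> borel_measurable borel"
    by (rule borel_measurable_continuous_onI)
  have "(\<integral>\<^sup>+s. ennreal (exp (- l * s)) * (\<Sum>n. poisson_weight (r * (t - s)) n * ennreal (\<beta> n)) * indicator {0..t} s \<partial>lborel) =
      (\<integral>\<^sup>+s. ennreal (exp (- l * s) * V (t - s)) * indicator {0..t} s \<partial>lborel)"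
  proof (intro nn_integral_cong)
    fix s
    show "ennreal (exp (- l * s)) * (\<Sum>n. poisson_weight (r * (t - s)) n * ennreal (\<beta> n)) * indicator {0..t} s =
        ennreal (exp (- l * s) * V (t - s)) * indicator {0..t} s"
    proof (cases "s \<in> {0..t}")
      case True
      then have "0 \<le> t - s" by simp
      then show ?thesis using V_nonneg[of "t - s"] unfolding V[OF \<open>0 \<le> t - s\<close>] by (simp add: ennreal_mult)
    qed simp
  qed
  \<comment> \<open>In the derivative of \<open>- exp (- l * s) * U (t - s)\<close> the two terms
    with \<open>l * U\<close> cancel, which leaves the integrand.\<close>
  also have "\<dots> = ennreal (- exp (- l * t) * U (t - t) - - exp (- l * 0) * U (t - 0))"
  proof (rule nn_integral_FTC_Icc)
    fix s assume s: "s \<in> {0..t}"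
    show "((\<lambda>s. - exp (- l * s) * U (t - s)) has_real_derivative exp (- l * s) * V (t - s)) (at s)"
      by (auto intro!: derivative_eq_intros DERIV_chain2[OF U'] simp: algebra_simps)
    show "0 \<le> exp (- l * s) * V (t - s)" using s by (simp add: V_nonneg)
  qed (use t in auto)
  also have "\<dots> = ennreal (U t - exp (- l * t) * \<alpha> 0)"
    by (simp add: U0)
  finally have I: "(\<integral>\<^sup>+s. ennreal (exp (- l * s)) * (\<Sum>n. poisson_weight (r * (t - s)) n * ennreal (\<beta> n)) * indicator {0..t} s \<partial>lborel) =
      ennreal (U t - exp (- l * t) * \<alpha> 0)" .
  \<comment> \<open>\<open>ennreal\<close> sends negative reals to 0, so the sign of this difference
    matters; it holds because the antiderivative is nondecreasing.\<close>
  have "exp (- l * t) * \<alpha> 0 \<le> U t"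
  proof -
    have "((\<lambda>s. - exp (- l * s) * U (t - s)) has_real_derivative exp (- l * s) * V (t - s)) (at s)" for s
      by (auto intro!: derivative_eq_intros DERIV_chain2[OF U'] simp: algebra_simps)
    then have "- exp (- l * 0) * U (t - 0) \<le> - exp (- l * t) * U (t - t)"
      using t V_nonneg by (intro DERIV_nonneg_imp_nondecreasing[of 0 t "\<lambda>s. - exp (- l * s) * U (t - s)"]) (auto intro!: exI)
    then show ?thesis by (simp add: U0)
  qed
  then have "ennreal (U t) = ennreal (exp (- l * t) * \<alpha> 0) + ennreal (U t - exp (- l * t) * \<alpha> 0)"
    using \<alpha>(1)[of 0] by (subst ennreal_plus[symmetric]) auto
  then show ?thesis unfolding I U[OF t] .
qed

section \<open>Uniformized kernels and their truncated semigroups\<close>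

locale jump_kernel =
  fixes S :: "'s measure" and L :: "'s \<Rightarrow> 's measure"
  assumes sets_L: "\<And>x. x \<in> space S \<Longrightarrow> sets (L x) = sets S"
    and finite_L: "\<And>x. x \<in> space S \<Longrightarrow> finite_measure (L x)"
    and measurable_L: "\<And>A. A \<in> sets S \<Longrightarrow> (\<lambda>x. emeasure (L x) A) \<in> borel_measurable S"
begin

definition rate :: "'s \<Rightarrow> real" where
  "rate x = measure (L x) (space S)"

definition bounded_rate :: "real \<Rightarrow> 's set" where
  "bounded_rate R = {x \<in> space S. rate x \<le> R}"

text \<open>The added point mass stands for jumps that do not move. It leaves the generator
  unchanged and brings the total mass to \<open>r\<close>, provided \<open>rate x \<le> r\<close>,
  as \<open>ennreal\<close> cuts negative values to 0.\<close>

definition padded :: "real \<Rightarrow> 's \<Rightarrow> 's measure" where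
  "padded r x = L x \<oplus>\<^sub>\<mu> scale_measure (ennreal (r - rate x)) (return S x)"

text \<open>
  Outside \<open>bounded_rate R\<close> the chain is frozen, so that it cannot return and its law restricted to
  \<open>bounded_rate R\<close> is that of the chain killed on exit.
\<close>

definition uniformized :: "real \<Rightarrow> real \<Rightarrow> 's \<Rightarrow> 's measure" where
  "uniformized R r x = (if x \<in> bounded_rate R then scale_measure (ennreal (1 / r)) (padded r x) else return S x)"

lemma space_L: "x \<in> space S \<Longrightarrow> space (L x) = space S"
  by (rule sets_eq_imp_space_eq[OF sets_L])

lemma rate_nonneg: "0 \<le> rate x"
  by (simp add: rate_def)

lemma emeasure_L_space: "x \<in> space S \<Longrightarrow> emeasure (L x) (space S) = ennreal (rate x)"
  using finite_measure.emeasure_eq_measure[OF finite_L] by (simp add: rate_def)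

lemma measurable_rate [measurable]: "rate \<in> borel_measurable S"
  unfolding rate_def[abs_def] measure_def
  by (intro borel_measurable_enn2real measurable_L) simp

lemma bounded_rate [measurable]: "bounded_rate R \<in> sets S"
  unfolding bounded_rate_def by measurable

lemma bounded_rate_space: "x \<in> bounded_rate R \<Longrightarrow> x \<in> space S" "x \<in> bounded_rate R \<Longrightarrow> rate x \<le> R"
  by (auto simp: bounded_rate_def)

lemma sets_uniformized: "x \<in> space S \<Longrightarrow> sets (uniformized R r x) = sets S"
  by (simp add: uniformized_def padded_def sets_L)

lemma nn_integral_uniformized:
  assumes x: "x \<in> bounded_rate R" and f: "f \<in> borel_measurable S"
  shows "(\<integral>\<^sup>+z. f z \<partial>uniformized R r x) = ennreal (1 / r) * ((\<integral>\<^sup>+z. f z \<partial>L x) + ennreal (r - rate x) * f x)"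
proof -
  have xS: "x \<in> space S" using x by (rule bounded_rate_space)
  have "f \<in> borel_measurable (L x)" using f sets_L[OF xS] by (simp cong: measurable_cong_sets)
  then show ?thesis
    using x f xS by (simp add: uniformized_def padded_def nn_integral_scale_measure nn_integral_plus_measure sets_L nn_integral_return)
qed

lemma emeasure_uniformized:
  assumes x: "x \<in> bounded_rate R" and A: "A \<in> sets S"
  shows "emeasure (uniformized R r x) A = ennreal (1 / r) * (emeasure (L x) A + ennreal (r - rate x) * indicator A x)"
  using nn_integral_uniformized[OF x, of "indicator A" r] A x bounded_rate_space[OF x]
  by (simp add: sets_uniformized sets_L)

lemma measurable_uniformized:
  assumes "R \<le> r" "0 < r"
  shows "uniformized R r \<in> S \<rightarrow>\<^sub>M prob_algebra S"
proof (rule measurable_prob_algebraI)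
  show prob: "prob_space (uniformized R r x)" if x: "x \<in> space S" for x
  proof (cases "x \<in> bounded_rate R")
    case True
    have sp: "space (uniformized R r x) = space S" by (rule sets_eq_imp_space_eq[OF sets_uniformized[OF x]])
    have "emeasure (uniformized R r x) (space S) = ennreal (1 / r) * (ennreal (rate x) + ennreal (r - rate x))"
      using True x by (simp add: emeasure_uniformized emeasure_L_space)
    also have "\<dots> = ennreal (1 / r * (rate x + (r - rate x)))"
      using assms bounded_rate_space(2)[OF True] rate_nonneg[of x]
      by (simp add: ennreal_mult[symmetric] ennreal_plus[symmetric] del: ennreal_plus)
    also have "\<dots> = 1" using assms by simp
    finally show ?thesis by (intro prob_spaceI) (simp add: sp)
  next
    case False
    then show ?thesis using x by (simp add: uniformized_def prob_space_return)
  qed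
  show "uniformized R r \<in> S \<rightarrow>\<^sub>M subprob_algebra S"
  proof (rule measurable_subprob_algebra)
    fix x assume x: "x \<in> space S"
    show "subprob_space (uniformized R r x)" using prob[OF x] by (rule prob_space_imp_subprob_space)
    show "sets (uniformized R r x) = sets S" by (rule sets_uniformized[OF x])
  next
    fix A assume A [measurable]: "A \<in> sets S"
    note [measurable] = measurable_L[OF A]
    have "emeasure (uniformized R r x) A = (if x \<in> bounded_rate R
      then ennreal (1 / r) * (emeasure (L x) A + ennreal (r - rate x) * indicator A x) else indicator A x)" for x
      using A by (auto simp: emeasure_uniformized) (simp add: uniformized_def)
    then show "(\<lambda>x. emeasure (uniformized R r x) A) \<in> borel_measurable S"
      by simp
  qed
qed

text \<open>The semigroup killed on leaving \<open>bounded_rate R\<close>, applied to the indicator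
  of \<open>A\<close>. As a series it also has the right value at \<open>t = 0\<close>, and joint
  measurability in \<open>t\<close> and \<open>x\<close> is seen term by term.\<close>

definition truncated_semigroup :: "real \<Rightarrow> real \<Rightarrow> 's set \<Rightarrow> real \<Rightarrow> 's \<Rightarrow> ennreal" where
  "truncated_semigroup R r A t x =
     (\<Sum>n. poisson_weight (r * t) n * emeasure (kernel_power S (uniformized R r) n x) (A \<inter> bounded_rate R))"

context
  fixes R r :: real and A :: "'s set"
  assumes R: "R \<le> r" and r: "0 < r" and A [measurable]: "A \<in> sets S"
begin

lemma truncated_semigroup_outside:
  assumes "x \<in> space S" "x \<notin> bounded_rate R"
  shows "truncated_semigroup R r A t x = 0"
  using assms kernel_power_absorbing[OF measurable_uniformized[OF R r] assms(1)]
  by (simp add: truncated_semigroup_def uniformized_def)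

lemma measurable_truncated_semigroup [measurable]:
  "(\<lambda>(t, x). truncated_semigroup R r A t x) \<in> borel_measurable (borel \<Otimes>\<^sub>M S)"
proof -
  have [measurable]: "(\<lambda>x. emeasure (kernel_power S (uniformized R r) n x) (A \<inter> bounded_rate R)) \<in> borel_measurable S" for n
    by (rule measurable_compose[OF measurable_prob_algebraD[OF measurable_kernel_power[OF measurable_uniformized[OF R r]]]
          measurable_emeasure_subprob_algebra]) measurable
  show ?thesis unfolding truncated_semigroup_def by measurable
qed

lemma truncated_semigroup_le_1:
  assumes x: "x \<in> space S" and t: "0 \<le> t"
  shows "truncated_semigroup R r A t x \<le> 1"
proof -
  have "truncated_semigroup R r A t x \<le> (\<Sum>n. poisson_weight (r * t) n * ennreal (1 ^ n))"
    unfolding truncated_semigroup_def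
    using prob_space.emeasure_le_1[OF kernel_power_space(1)[OF measurable_uniformized[OF R r] x]]
    by (intro suminf_le allI mult_left_mono) auto
  also have "\<dots> = ennreal (exp (- (r * t) * (1 - 1)))"
    using r t by (intro poisson_sum) auto
  also have "\<dots> = 1" by simp
  finally show ?thesis .
qed

text \<open>The backward equation, split at the first jump. Its coefficients are those of
  \<open>L\<close>: the artificial rate \<open>r\<close> has dropped out of them, so the equation
  can be matched with the jump process, whose description does not involve \<open>r\<close>.\<close>

lemma truncated_semigroup_duhamel:
  assumes x: "x \<in> bounded_rate R" and t: "0 \<le> t"
  shows "truncated_semigroup R r A t x = ennreal (exp (- rate x * t)) * indicator A x +
    (\<integral>\<^sup>+s. ennreal (exp (- rate x * s)) * (\<integral>\<^sup>+z. truncated_semigroup R r A (t - s) z \<partial>L x) * indicator {0..t} s \<partial>lborel)"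
proof -
  note Q = measurable_uniformized[OF R r]
  have xS: "x \<in> space S" using x by (rule bounded_rate_space)
  define a where "a n z = emeasure (kernel_power S (uniformized R r) n z) (A \<inter> bounded_rate R)" for n z
  have a_meas [measurable]: "a n \<in> borel_measurable S" for n
    unfolding a_def
    by (rule measurable_compose[OF measurable_prob_algebraD[OF measurable_kernel_power[OF Q]]
          measurable_emeasure_subprob_algebra]) measurable
  note [measurable_cong] = sets_L[OF xS]
  have a_le: "a n z \<le> 1" if "z \<in> space S" for n z
    unfolding a_def using kernel_power_space(1)[OF Q that] by (rule prob_space.emeasure_le_1)
  define \<alpha> where "\<alpha> n = enn2real (a n x)" for n
  define \<beta> where "\<beta> n = enn2real (\<integral>\<^sup>+z. a n z \<partial>L x)" for n
  have \<alpha>: "a n x = ennreal (\<alpha> n)" "\<alpha> n \<le> 1" "0 \<le> \<alpha> n" for n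
    using a_le[OF xS, of n] le_less_trans[OF a_le[OF xS, of n] ennreal_one_less_top] unfolding \<alpha>_def
    by (auto intro!: enn2real_leI)
  have "(\<integral>\<^sup>+z. a n z \<partial>L x) \<le> (\<integral>\<^sup>+z. 1 \<partial>L x)" for n
    by (intro nn_integral_mono a_le) (simp add: space_L[OF xS])
  then have b_le: "(\<integral>\<^sup>+z. a n z \<partial>L x) \<le> ennreal (rate x)" for n
    by (simp add: emeasure_L_space[OF xS] space_L[OF xS])
  have \<beta>: "(\<integral>\<^sup>+z. a n z \<partial>L x) = ennreal (\<beta> n)" "\<beta> n \<le> rate x" "0 \<le> \<beta> n" for n
    using b_le[of n] rate_nonneg[of x] le_less_trans[OF b_le[of n] ennreal_less_top] unfolding \<beta>_def
    by (auto intro!: enn2real_leI)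
  \<comment> \<open>The jumps added by padding do not move and so return \<open>\<alpha> n\<close>
    itself; this is the term with \<open>r - rate x\<close>.\<close>
  have rec: "r * \<alpha> (Suc n) = \<beta> n + (r - rate x) * \<alpha> n" for n
  proof -
    have "a (Suc n) x = (\<integral>\<^sup>+z. a n z \<partial>uniformized R r x)"
      unfolding a_def by (rule emeasure_kernel_power_Suc[OF Q xS]) measurable
    also have "\<dots> = ennreal (1 / r) * (ennreal (\<beta> n) + ennreal (r - rate x) * ennreal (\<alpha> n))"
      by (simp add: nn_integral_uniformized[OF x] \<alpha>(1) \<beta>(1))
    also have "\<dots> = ennreal (1 / r * (\<beta> n + (r - rate x) * \<alpha> n))"
      using r R bounded_rate_space(2)[OF x] \<alpha>(3) \<beta>(3)
      by (simp add: ennreal_mult[symmetric] ennreal_plus[symmetric] del: ennreal_plus)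
    finally have "\<alpha> (Suc n) = 1 / r * (\<beta> n + (r - rate x) * \<alpha> n)"
      using r R bounded_rate_space(2)[OF x] \<alpha>(3) \<beta>(3) by (simp add: \<alpha>(1))
    then show ?thesis using r by simp
  qed
  have "truncated_semigroup R r A t x = (\<Sum>n. poisson_weight (r * t) n * ennreal (\<alpha> n))"
    by (simp add: truncated_semigroup_def a_def[symmetric] \<alpha>(1))
  also have "\<dots> = ennreal (exp (- rate x * t) * \<alpha> 0) +
    (\<integral>\<^sup>+s. ennreal (exp (- rate x * s)) * (\<Sum>n. poisson_weight (r * (t - s)) n * ennreal (\<beta> n)) * indicator {0..t} s \<partial>lborel)"
  proof (rule poisson_weight_duhamel[where B="max 1 (rate x)"])
    show "\<alpha> n \<le> max 1 (rate x)" "\<beta> n \<le> max 1 (rate x)" for n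
      using \<alpha>(2)[of n] \<beta>(2)[of n] by auto
  qed (use \<alpha> \<beta> r t rec in auto)
  also have "ennreal (exp (- rate x * t) * \<alpha> 0) = ennreal (exp (- rate x * t)) * indicator A x"
    using x xS \<alpha>(3)[of 0] by (simp add: ennreal_mult \<alpha>(1)[symmetric] a_def)  (simp add: indicator_def)
  finally have *: "truncated_semigroup R r A t x = ennreal (exp (- rate x * t)) * indicator A x +
    (\<integral>\<^sup>+s. ennreal (exp (- rate x * s)) * (\<Sum>n. poisson_weight (r * (t - s)) n * ennreal (\<beta> n)) * indicator {0..t} s \<partial>lborel)" .
  have "(\<Sum>n. poisson_weight (r * s) n * ennreal (\<beta> n)) = (\<integral>\<^sup>+z. truncated_semigroup R r A s z \<partial>L x)" for s
    unfolding truncated_semigroup_def a_def[symmetric]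
    by (subst nn_integral_suminf) (simp_all add: nn_integral_cmult \<beta>(1))
  with * show ?thesis by simp
qed

end

end

section \<open>The law of the next jump\<close>

lemma measure_eqI_rectangles:
  assumes M: "sets M = sets (A \<Otimes>\<^sub>M B)" and N: "sets N = sets (A \<Otimes>\<^sub>M B)" and fin: "emeasure M (space M) \<noteq> \<infinity>"
    and eq: "\<And>a b. a \<in> sets A \<Longrightarrow> b \<in> sets B \<Longrightarrow> emeasure M (a \<times> b) = emeasure N (a \<times> b)"
  shows "M = N"
proof (rule measure_eqI_generator_eq[OF Int_stable_pair_measure_generator[of A B], where A="\<lambda>_::nat. space A \<times> space B"])
  show "{a \<times> b |a b. a \<in> sets A \<and> b \<in> sets B} \<subseteq> Pow (space A \<times> space B)"
    by (auto dest: sets.sets_into_space)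
  have "space M = space A \<times> space B"
    using sets_eq_imp_space_eq[OF M] by (simp add: space_pair_measure)
  then show "emeasure M (space A \<times> space B) \<noteq> \<infinity>" using fin by simp
qed (use M N eq in \<open>auto simp: sets_pair_measure\<close>)

context jump_kernel
begin

definition holding :: "'s \<Rightarrow> real measure" where
  "holding y = density lborel (\<lambda>s. ennreal (exponential_density (rate y) s))"

text \<open>For \<open>rate y = 0\<close> both \<open>holding y\<close> and \<open>jump_law y\<close> are null measures (\<open>1 / 0 = \<infinity>\<close> and \<open>\<infinity> * 0 = 0\<close>).\<close>

definition jump_law :: "'s \<Rightarrow> 's measure" where
  "jump_law y = scale_measure (1 / emeasure (L y) (space S)) (L y)"

lemma holding_eq_0: "rate y = 0 \<Longrightarrow> emeasure (holding y) A = 0"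
proof -
  assume "rate y = 0"
  then have "(\<lambda>s. ennreal (exponential_density (rate y) s)) = (\<lambda>_. 0)"
    by (auto simp: fun_eq_iff exponential_density_def)
  then have "holding y = density lborel (\<lambda>_. 0)"
    by (simp add: holding_def)
  then show ?thesis
    by (cases "A \<in> sets lborel") (simp_all add: emeasure_density emeasure_notin_sets)
qed

lemma holding_subprob: "subprob_space (holding y)"
proof (cases "rate y = 0")
  case True
  then show ?thesis by (intro subprob_spaceI) (simp_all add: holding_eq_0, simp add: holding_def)
next
  case False
  then show ?thesis
    using rate_nonneg[of y] unfolding holding_def
    by (intro prob_space_imp_subprob_space prob_space_exponential_density) simp
qed

text \<open>The maximum covers negative \<open>t\<close>, where the ray has full mass. Rays from all
  real points are used later to determine a measure on the line.\<close>

lemma holding_greaterThan: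
  assumes "rate y \<noteq> 0"
  shows "emeasure (holding y) {t<..} = ennreal (exp (- rate y * max t 0))"
proof -
  have l: "0 < rate y" using assms rate_nonneg[of y] by simp
  interpret H: prob_space "holding y" unfolding holding_def by (rule prob_space_exponential_density[OF l])
  have "emeasure (holding y) {..t} = ennreal (erlang_CDF 0 (rate y) t)"
    unfolding holding_def by (rule emeasure_erlang_density[OF l])
  moreover have "{t<..} = space (holding y) - {..t}" by (auto simp: holding_def)
  ultimately have "emeasure (holding y) {t<..} = 1 - ennreal (erlang_CDF 0 (rate y) t)"
    using emeasure_compl[of "{..t}" "holding y"] H.emeasure_space_1 by (simp add: holding_def)
  also have "\<dots> = ennreal (exp (- rate y * max t 0))"
    using l ennreal_minus[of "erlang_CDF 0 (rate y) t" 1] by (simp add: erlang_CDF_def max_def)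
  finally show ?thesis .
qed

lemma measurable_holding: "holding \<in> S \<rightarrow>\<^sub>M subprob_algebra borel"
proof (rule measurable_subprob_algebra[OF holding_subprob])
  fix A :: "real set" assume [measurable]: "A \<in> sets borel"
  have "emeasure (holding y) A = (\<integral>\<^sup>+s. ennreal (exponential_density (rate y) s) * indicator A s \<partial>lborel)" for y
    unfolding holding_def by (rule emeasure_density) simp_all
  moreover have "(\<lambda>y. \<integral>\<^sup>+s. ennreal (exponential_density (rate y) s) * indicator A s \<partial>lborel) \<in> borel_measurable S"
    unfolding exponential_density_def by measurable
  ultimately show "(\<lambda>y. emeasure (holding y) A) \<in> borel_measurable S" by simp
qed (simp add: holding_def)

lemma measurable_jump_law: "jump_law \<in> S \<rightarrow>\<^sub>M subprob_algebra S"
proof (rule measurable_subprob_algebra)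
  fix y assume y: "y \<in> space S"
  show s: "sets (jump_law y) = sets S" by (simp add: jump_law_def sets_L[OF y])
  have "1 / ennreal (rate y) * ennreal (rate y) \<le> 1"
  proof (cases "rate y = 0")
    case False
    then have "1 / ennreal (rate y) = ennreal (1 / rate y)"
      using rate_nonneg[of y] by (simp add: divide_ennreal[symmetric])
    then show ?thesis using False rate_nonneg[of y] by (simp add: ennreal_mult[symmetric])
  qed simp
  then show "subprob_space (jump_law y)"
    using y by (intro subprob_spaceI, unfold sets_eq_imp_space_eq[OF s]) (auto simp: jump_law_def emeasure_L_space)
next
  fix A assume A: "A \<in> sets S"
  note [measurable] = measurable_L[OF A] measurable_L[OF sets.top]
  show "(\<lambda>y. emeasure (jump_law y) A) \<in> borel_measurable S"
    by (simp add: jump_law_def)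
qed

lemma measurable_jump_pair: "(\<lambda>y. holding y \<Otimes>\<^sub>M jump_law y) \<in> S \<rightarrow>\<^sub>M subprob_algebra (borel \<Otimes>\<^sub>M S)"
  by (rule measurable_pair_measure[OF measurable_holding measurable_jump_law])

lemma nn_integral_jump_law:
  assumes y: "y \<in> space S" and g: "g \<in> borel_measurable S"
  shows "(\<integral>\<^sup>+z. g z \<partial>L y) = ennreal (rate y) * (\<integral>\<^sup>+z. g z \<partial>jump_law y)"
proof -
  have gL: "g \<in> borel_measurable (L y)" using g by (simp add: measurable_cong_sets[OF sets_L[OF y] refl])
  have "(\<integral>\<^sup>+z. g z \<partial>jump_law y) = 1 / ennreal (rate y) * (\<integral>\<^sup>+z. g z \<partial>L y)"
    unfolding jump_law_def emeasure_L_space[OF y] by (rule nn_integral_scale_measure[OF gL])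
  moreover have "(\<integral>\<^sup>+z. g z \<partial>L y) = 0" if "rate y = 0"
  proof -
    have "(\<integral>\<^sup>+z. g z \<partial>L y) \<le> (\<integral>\<^sup>+z. \<top> \<partial>L y)" by (intro nn_integral_mono) simp
    also have "\<dots> = 0" using y that by (simp add: space_L emeasure_L_space)
    finally show ?thesis by simp
  qed
  moreover have "ennreal (rate y) * (1 / ennreal (rate y) * I) = I" if "rate y \<noteq> 0" for I
  proof -
    have "1 / ennreal (rate y) = ennreal (1 / rate y)"
      using that rate_nonneg[of y] by (simp add: divide_ennreal[symmetric])
    moreover have "ennreal (rate y) * ennreal (1 / rate y) = 1"
      using that rate_nonneg[of y] by (simp add: ennreal_mult[symmetric])
    ultimately show ?thesis by (simp add: mult.assoc[symmetric])
  qed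
  ultimately show ?thesis by (cases "rate y = 0") auto
qed

text \<open>\<open>L x\<close> may have any finite mass, so \<open>L\<close> is written as
  \<open>rate\<close> times the subprobability kernel \<open>jump_law\<close>, to which the
  measurability theorem for such kernels applies.\<close>

lemma measurable_nn_integral_L:
  assumes f [measurable]: "(\<lambda>(x, z). f x z) \<in> borel_measurable (N \<Otimes>\<^sub>M S)" and h [measurable]: "h \<in> N \<rightarrow>\<^sub>M S"
  shows "(\<lambda>x. \<integral>\<^sup>+z. f x z \<partial>L (h x)) \<in> borel_measurable N"
proof -
  have [measurable]: "(\<lambda>x. \<integral>\<^sup>+z. f x z \<partial>jump_law (h x)) \<in> borel_measurable N"
    by (rule nn_integral_measurable_subprob_algebra2[OF f measurable_compose[OF h measurable_jump_law]])
  have "(\<integral>\<^sup>+z. f x z \<partial>L (h x)) = ennreal (rate (h x)) * (\<integral>\<^sup>+z. f x z \<partial>jump_law (h x))" if x: "x \<in> space N" for x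
    using measurable_compose[OF measurable_Pair1'[OF x] f]
    by (intro nn_integral_jump_law measurable_space[OF h x]) simp
  then show ?thesis by (subst measurable_cong) measurable
qed

text \<open>The factor \<open>rate y\<close> of the exponential density cancels the normalisation of
  \<open>jump_law\<close>. The result involves \<open>L y\<close> itself, as the backward equation
  does, and is valid for \<open>rate y = 0\<close> too.\<close>

lemma nn_integral_jump_pair:
  assumes y: "y \<in> space S" and g [measurable]: "g \<in> borel_measurable (borel \<Otimes>\<^sub>M S)"
  shows "(\<integral>\<^sup>+p. g p \<partial>(holding y \<Otimes>\<^sub>M jump_law y)) =
    (\<integral>\<^sup>+s. ennreal (exp (- rate y * s)) * (\<integral>\<^sup>+z. g (s, z) \<partial>L y) * indicator {0..} s \<partial>lborel)"
proof -
  have sets_j [measurable_cong]: "sets (jump_law y) = sets S" by (simp add: jump_law_def sets_L[OF y])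
  have sets_h [measurable_cong]: "sets (holding y) = sets borel" by (simp add: holding_def)
  note sets_L[OF y, measurable_cong]
  interpret j: subprob_space "jump_law y"
    using measurable_space[OF measurable_jump_law y] by (simp add: space_subprob_algebra)
  interpret l: finite_measure "L y" by (rule finite_L[OF y])
  have "(\<integral>\<^sup>+p. g p \<partial>(holding y \<Otimes>\<^sub>M jump_law y)) = (\<integral>\<^sup>+s. \<integral>\<^sup>+z. g (s, z) \<partial>jump_law y \<partial>holding y)"
    by (rule j.nn_integral_fst[symmetric]) measurable
  also have "\<dots> = (\<integral>\<^sup>+s. ennreal (exponential_density (rate y) s) * (\<integral>\<^sup>+z. g (s, z) \<partial>jump_law y) \<partial>lborel)"
    unfolding holding_def by (subst nn_integral_density) simp_all
  also have "\<dots> = (\<integral>\<^sup>+s. ennreal (exp (- rate y * s)) * (\<integral>\<^sup>+z. g (s, z) \<partial>L y) * indicator {0..} s \<partial>lborel)"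
  proof (intro nn_integral_cong)
    fix s :: real
    have "ennreal (exponential_density (rate y) s) = ennreal (exp (- rate y * s)) * ennreal (rate y) * indicator {0..} s"
      using rate_nonneg[of y] by (auto simp: exponential_density_def ennreal_mult[symmetric] mult.commute)
    then show "ennreal (exponential_density (rate y) s) * (\<integral>\<^sup>+z. g (s, z) \<partial>jump_law y) =
      ennreal (exp (- rate y * s)) * (\<integral>\<^sup>+z. g (s, z) \<partial>L y) * indicator {0..} s"
      by (subst nn_integral_jump_law[OF y]) (measurable, simp add: ac_simps)
  qed
  finally show ?thesis .
qed

end

section \<open>Joint law of a jump and its past\<close>

locale jump_kernel_process =
  jump_kernel S L + nonexplosive_jump_process M S L x\<^sub>0 T Y X
  for S :: "'s measure" and L and M :: "'w measure" and x\<^sub>0 T Y X +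
  assumes x\<^sub>0: "x\<^sub>0 \<in> space S"
begin

lemmas [measurable] = measurable_T measurable_Y

lemma Y_space: "\<omega> \<in> space M \<Longrightarrow> Y n \<omega> \<in> space S"
  using measurable_space[OF measurable_Y] .

lemma AE_T_nonneg: "AE \<omega> in M. \<forall>n. 0 \<le> T n \<omega>"
  unfolding AE_all_countable
proof
  fix n
  show "AE \<omega> in M. 0 \<le> T n \<omega>"
  proof (induction n)
    case 0
    show ?case using initial by eventually_elim simp
  next
    case (Suc n)
    show ?case using Suc increasing[of n] by eventually_elim auto
  qed
qed

definition history :: "nat \<Rightarrow> 'w \<Rightarrow> nat \<Rightarrow> ereal \<times> 's" where
  "history n \<omega> = (\<lambda>k\<in>{..n}. (T k \<omega>, Y k \<omega>))"

abbreviation histories :: "nat \<Rightarrow> (nat \<Rightarrow> ereal \<times> 's) measure" where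
  "histories n \<equiv> \<Pi>\<^sub>M k\<in>{..n}. borel \<Otimes>\<^sub>M S"

abbreviation jump_time :: "nat \<Rightarrow> 'w \<Rightarrow> real" where
  "jump_time n \<omega> \<equiv> real_of_ereal (T n \<omega>)"

lemma measurable_history [measurable]: "history n \<in> M \<rightarrow>\<^sub>M histories n"
  unfolding history_def[abs_def] by measurable

lemma next_jump_rectangle:
  assumes B: "B \<in> sets (histories n)" and A: "A \<in> sets S"
  shows "emeasure M {\<omega> \<in> space M. history n \<omega> \<in> B \<and> T (Suc n) \<omega> < \<infinity> \<and> t < jump_time (Suc n) \<omega> - jump_time n \<omega> \<and> Y (Suc n) \<omega> \<in> A} =
    (\<integral>\<^sup>+\<omega>. indicator B (history n \<omega>) * indicator {..<\<infinity>} (T n \<omega>) *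
      (emeasure (holding (Y n \<omega>)) {t<..} * emeasure (jump_law (Y n \<omega>)) A) \<partial>M)"
proof -
  note [measurable] = B A
  \<comment> \<open>\<open>next_jump\<close> speaks of \<open>t \<ge> 0\<close> only. For negative
    \<open>t\<close> the bound on the holding time is void, and so it is almost surely for 0, since
    finite increments are positive.\<close>
  let ?t = "max t 0"
  have "emeasure M {\<omega> \<in> space M. history n \<omega> \<in> B \<and> T (Suc n) \<omega> < \<infinity> \<and> t < jump_time (Suc n) \<omega> - jump_time n \<omega> \<and> Y (Suc n) \<omega> \<in> A} =
    emeasure M {\<omega> \<in> space M. history n \<omega> \<in> B \<and> T n \<omega> + ereal ?t < T (Suc n) \<omega> \<and> T (Suc n) \<omega> < \<infinity> \<and> Y (Suc n) \<omega> \<in> A}"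
  proof (rule emeasure_eq_AE, use AE_T_nonneg increasing[of n] in eventually_elim)
    case (elim \<omega>)
    note a = elim(1) and b = elim(2)
    have "t < jump_time (Suc n) \<omega> - jump_time n \<omega> \<longleftrightarrow> T n \<omega> + ereal ?t < T (Suc n) \<omega>" if "T (Suc n) \<omega> < \<infinity>"
      using that b a[rule_format, of n] a[rule_format, of "Suc n"]
      by (cases "T n \<omega>"; cases "T (Suc n) \<omega>") (auto simp: max_def)
    then show ?case
      by auto
  qed measurable
  also have "\<dots> = (\<integral>\<^sup>+\<omega>. indicator B (history n \<omega>) * indicator {..<\<infinity>} (T n \<omega>) *
          ennreal (exp (- rate (Y n \<omega>) * ?t)) * (emeasure (L (Y n \<omega>)) A / emeasure (L (Y n \<omega>)) (space S)) \<partial>M)"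
    unfolding history_def rate_def by (rule next_jump[OF B A]) simp
  also have "\<dots> = (\<integral>\<^sup>+\<omega>. indicator B (history n \<omega>) * indicator {..<\<infinity>} (T n \<omega>) *
      (emeasure (holding (Y n \<omega>)) {t<..} * emeasure (jump_law (Y n \<omega>)) A) \<partial>M)"
  proof (intro nn_integral_cong)
    fix \<omega> assume \<omega>: "\<omega> \<in> space M"
    let ?y = "Y n \<omega>"
    have y: "?y \<in> space S" by (rule Y_space[OF \<omega>])
    have "ennreal (exp (- rate ?y * ?t)) * (emeasure (L ?y) A / emeasure (L ?y) (space S)) =
        emeasure (holding ?y) {t<..} * emeasure (jump_law ?y) A"
    proof (cases "rate ?y = 0")
      case True
      moreover have "emeasure (L ?y) A \<le> emeasure (L ?y) (space S)"
        using emeasure_space[of "L ?y" A] by (simp add: space_L[OF y])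
      ultimately show ?thesis by (simp add: emeasure_L_space[OF y] holding_eq_0)
    next
      case False
      then show ?thesis
        by (simp add: holding_greaterThan jump_law_def divide_ennreal_def mult.commute)
    qed
    then show "indicator B (history n \<omega>) * indicator {..<\<infinity>} (T n \<omega>) * ennreal (exp (- rate ?y * ?t)) *
        (emeasure (L ?y) A / emeasure (L ?y) (space S)) =
      indicator B (history n \<omega>) * indicator {..<\<infinity>} (T n \<omega>) *
        (emeasure (holding ?y) {t<..} * emeasure (jump_law ?y) A)"
      by (simp add: mult.assoc)
  qed
  finally show ?thesis .
qed

text \<open>\<open>next_jump\<close> prescribes the law only on events in which the holding time
  lies in a ray. Both sides are integrals of \<open>g\<close> against measures, \<open>m1\<close>
  and \<open>m2\<close>; their equality is extended from rays to Borel sets of times and then to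
  products, one coordinate after the other. \<open>g\<close> may depend on the current jump time
  because later the remaining time does.\<close>

lemma nn_integral_next_jump:
  assumes B: "B \<in> sets (histories n)" and g: "g \<in> borel_measurable (borel \<Otimes>\<^sub>M (borel \<Otimes>\<^sub>M S))"
  shows "(\<integral>\<^sup>+\<omega>. indicator B (history n \<omega>) * indicator {..<\<infinity>} (T (Suc n) \<omega>) *
        g (jump_time n \<omega>, jump_time (Suc n) \<omega> - jump_time n \<omega>, Y (Suc n) \<omega>) \<partial>M) =
    (\<integral>\<^sup>+\<omega>. indicator B (history n \<omega>) * indicator {..<\<infinity>} (T n \<omega>) *
        (\<integral>\<^sup>+s. ennreal (exp (- rate (Y n \<omega>) * s)) * (\<integral>\<^sup>+z. g (jump_time n \<omega>, s, z) \<partial>L (Y n \<omega>)) * indicator {0..} s \<partial>lborel) \<partial>M)"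
proof -
  note [measurable] = B g
  let ?P = "borel \<Otimes>\<^sub>M (borel \<Otimes>\<^sub>M S) :: (real \<times> real \<times> 's) measure"
  let ?H = "\<lambda>\<omega>. holding (Y n \<omega>) \<Otimes>\<^sub>M jump_law (Y n \<omega>)"
  let ?w1 = "\<lambda>\<omega>. indicator B (history n \<omega>) * indicator {..<\<infinity>} (T (Suc n) \<omega>) :: ennreal"
  let ?w2 = "\<lambda>\<omega>. indicator B (history n \<omega>) * indicator {..<\<infinity>} (T n \<omega>) :: ennreal"
  let ?f = "\<lambda>\<omega>. (jump_time n \<omega>, jump_time (Suc n) \<omega> - jump_time n \<omega>, Y (Suc n) \<omega>)"
  let ?K = "\<lambda>\<omega>. distr (?H \<omega>) ?P (\<lambda>p. (jump_time n \<omega>, p))"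
  define m1 where "m1 = distr (density M ?w1) ?P ?f"
  define m2 where "m2 = density M ?w2 \<bind> ?K"
  have f [measurable]: "?f \<in> M \<rightarrow>\<^sub>M ?P" by measurable
  have K: "?K \<in> M \<rightarrow>\<^sub>M subprob_algebra ?P"
    by (rule measurable_distr2[OF _ measurable_compose[OF measurable_Y measurable_jump_pair]]) measurable
  have K': "?K \<in> density M ?w2 \<rightarrow>\<^sub>M subprob_algebra ?P"
    using K by (simp cong: measurable_cong_sets)
  have ne: "space (density M ?w2) \<noteq> {}" using not_empty by simp
  have int1: "(\<integral>\<^sup>+p. h p \<partial>m1) = (\<integral>\<^sup>+\<omega>. ?w1 \<omega> * h (?f \<omega>) \<partial>M)" if [measurable]: "h \<in> borel_measurable ?P" for h
    unfolding m1_def by (subst nn_integral_distr) (simp_all add: nn_integral_density)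
  have K_int: "(\<integral>\<^sup>+p. h p \<partial>?K \<omega>) = (\<integral>\<^sup>+p. h (jump_time n \<omega>, p) \<partial>?H \<omega>)"
    if [measurable]: "h \<in> borel_measurable ?P" and \<omega>: "\<omega> \<in> space M" for h \<omega>
  proof -
    have [measurable_cong]: "sets (?H \<omega>) = sets (borel \<Otimes>\<^sub>M S)"
      using measurable_space[OF measurable_jump_pair Y_space[OF \<omega>]] by (simp add: space_subprob_algebra)
    show ?thesis by (rule nn_integral_distr) measurable
  qed
  have int2: "(\<integral>\<^sup>+p. h p \<partial>m2) = (\<integral>\<^sup>+\<omega>. ?w2 \<omega> * (\<integral>\<^sup>+p. h (jump_time n \<omega>, p) \<partial>?H \<omega>) \<partial>M)"
    if [measurable]: "h \<in> borel_measurable ?P" for h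
  proof -
    have [measurable]: "(\<lambda>\<omega>. \<integral>\<^sup>+p. h p \<partial>?K \<omega>) \<in> borel_measurable M"
      by (rule measurable_compose[OF K nn_integral_measurable_subprob_algebra]) measurable
    have "(\<integral>\<^sup>+p. h p \<partial>m2) = (\<integral>\<^sup>+\<omega>. \<integral>\<^sup>+p. h p \<partial>?K \<omega> \<partial>density M ?w2)"
      unfolding m2_def by (rule nn_integral_bind[OF _ K']) measurable
    also have "\<dots> = (\<integral>\<^sup>+\<omega>. ?w2 \<omega> * (\<integral>\<^sup>+p. h p \<partial>?K \<omega>) \<partial>M)"
      by (rule nn_integral_density) measurable
    also have "\<dots> = (\<integral>\<^sup>+\<omega>. ?w2 \<omega> * (\<integral>\<^sup>+p. h (jump_time n \<omega>, p) \<partial>?H \<omega>) \<partial>M)"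
      by (intro nn_integral_cong) (simp only: K_int[OF that])
    finally show ?thesis .
  qed
  have sets1 [simp, measurable_cong]: "sets m1 = sets ?P" by (simp add: m1_def)
  have sets2 [simp, measurable_cong]: "sets m2 = sets ?P"
    unfolding m2_def by (rule sets_bind[OF _ ne]) simp
  have fin1: "emeasure m1 C \<noteq> \<infinity>" for C
  proof -
    have "emeasure m1 C \<le> emeasure m1 (space m1)" by (rule emeasure_space)
    also have "\<dots> = (\<integral>\<^sup>+p. 1 \<partial>m1)" by simp
    also have "\<dots> = (\<integral>\<^sup>+\<omega>. ?w1 \<omega> * 1 \<partial>M)" by (rule int1) simp
    also have "\<dots> \<le> (\<integral>\<^sup>+\<omega>. 1 \<partial>M)" by (intro nn_integral_mono) (auto simp: indicator_def)
    also have "\<dots> = 1" by (simp add: emeasure_space_1)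
    finally show ?thesis by (auto simp: top_unique)
  qed
  have ray: "emeasure m1 (C \<times> ({t<..} \<times> A)) = emeasure m2 (C \<times> ({t<..} \<times> A))"
    if [measurable]: "C \<in> sets borel" "A \<in> sets S" for C t A
  proof -
    let ?R = "C \<times> ({t<..} \<times> A)"
    \<comment> \<open>A condition on the current jump time is a condition on the history and can be
      absorbed into \<open>B\<close>.\<close>
    define B' where "B' = {h \<in> space (histories n). h \<in> B \<and> real_of_ereal (fst (h n)) \<in> C}"
    have B' [measurable]: "B' \<in> sets (histories n)" unfolding B'_def by measurable
    have hist: "history n \<omega> \<in> B' \<longleftrightarrow> history n \<omega> \<in> B \<and> jump_time n \<omega> \<in> C" if "\<omega> \<in> space M" for \<omega>
      using measurable_space[OF measurable_history that] by (auto simp: history_def B'_def)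
    have "emeasure m1 ?R = (\<integral>\<^sup>+p. indicator ?R p \<partial>m1)" by simp
    also have "\<dots> = (\<integral>\<^sup>+\<omega>. ?w1 \<omega> * indicator ?R (?f \<omega>) \<partial>M)" by (rule int1) measurable
    also have "\<dots> = (\<integral>\<^sup>+\<omega>. indicator {\<omega> \<in> space M. history n \<omega> \<in> B' \<and> T (Suc n) \<omega> < \<infinity> \<and> t < jump_time (Suc n) \<omega> - jump_time n \<omega> \<and> Y (Suc n) \<omega> \<in> A} \<omega> \<partial>M)"
      by (intro nn_integral_cong) (auto simp: hist indicator_def)
    also have "\<dots> = emeasure M {\<omega> \<in> space M. history n \<omega> \<in> B' \<and> T (Suc n) \<omega> < \<infinity> \<and> t < jump_time (Suc n) \<omega> - jump_time n \<omega> \<and> Y (Suc n) \<omega> \<in> A}"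
      by (rule nn_integral_indicator) measurable
    also have "\<dots> = (\<integral>\<^sup>+\<omega>. indicator B' (history n \<omega>) * indicator {..<\<infinity>} (T n \<omega>) *
      (emeasure (holding (Y n \<omega>)) {t<..} * emeasure (jump_law (Y n \<omega>)) A) \<partial>M)"
      by (rule next_jump_rectangle[OF B']) fact
    also have "\<dots> = (\<integral>\<^sup>+\<omega>. ?w2 \<omega> * (\<integral>\<^sup>+p. indicator ?R (jump_time n \<omega>, p) \<partial>?H \<omega>) \<partial>M)"
    proof (intro nn_integral_cong)
      fix \<omega> assume \<omega>: "\<omega> \<in> space M"
      have y: "Y n \<omega> \<in> space S" by (rule Y_space[OF \<omega>])
      interpret j: subprob_space "jump_law (Y n \<omega>)"
        using measurable_space[OF measurable_jump_law y] by (simp add: space_subprob_algebra)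
      have s: "{t<..} \<in> sets (holding (Y n \<omega>))" "A \<in> sets (jump_law (Y n \<omega>))"
        by (simp_all add: holding_def jump_law_def sets_L[OF y] that)
      have "(\<integral>\<^sup>+p. indicator ?R (jump_time n \<omega>, p) \<partial>?H \<omega>) =
          (\<integral>\<^sup>+p. indicator C (jump_time n \<omega>) * indicator ({t<..} \<times> A) p \<partial>?H \<omega>)"
        by (intro nn_integral_cong) (auto simp: indicator_def)
      also have "\<dots> = indicator C (jump_time n \<omega>) * (emeasure (holding (Y n \<omega>)) {t<..} * emeasure (jump_law (Y n \<omega>)) A)"
        using s by (simp add: nn_integral_cmult_indicator j.emeasure_pair_measure_Times)
      finally show "indicator B' (history n \<omega>) * indicator {..<\<infinity>} (T n \<omega>) *
          (emeasure (holding (Y n \<omega>)) {t<..} * emeasure (jump_law (Y n \<omega>)) A) =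
        ?w2 \<omega> * (\<integral>\<^sup>+p. indicator ?R (jump_time n \<omega>, p) \<partial>?H \<omega>)"
        using hist[OF \<omega>] by (auto simp: indicator_def)
    qed
    also have "\<dots> = (\<integral>\<^sup>+p. indicator ?R p \<partial>m2)" by (rule int2[symmetric]) measurable
    also have "\<dots> = emeasure m2 ?R" by simp
    finally show ?thesis .
  qed
  \<comment> \<open>A device to fix all coordinates but one: restricting to \<open>Z\<close> and
    mapping by \<open>\<psi>\<close> leaves a measure in the remaining coordinate, to which a
    uniqueness theorem on generators applies.\<close>
  have restr: "emeasure (distr (density m (indicator Z)) N \<psi>) D = emeasure m (Z \<inter> (\<psi> -` D \<inter> space ?P))"
    if "sets m = sets ?P" "Z \<in> sets ?P" "\<psi> \<in> ?P \<rightarrow>\<^sub>M N" "D \<in> sets N" for m Z \<psi> D and N :: "'z measure"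
  proof -
    note [measurable_cong] = that(1) and [measurable] = that(2-4)
    have sp: "space m = space ?P" by (rule sets_eq_imp_space_eq[OF that(1)])
    have [measurable]: "\<psi> -` D \<inter> space ?P \<in> sets ?P" by measurable
    have "emeasure (distr (density m (indicator Z)) N \<psi>) D = emeasure (density m (indicator Z)) (\<psi> -` D \<inter> space ?P)"
      by (subst emeasure_distr) (simp_all add: sp)
    also have "\<dots> = emeasure m (Z \<inter> (\<psi> -` D \<inter> space ?P))"
      by (subst emeasure_density) (simp_all add: indicator_inter_arith[symmetric] that)
    finally show ?thesis .
  qed
  have box: "emeasure m1 (C \<times> (D \<times> A)) = emeasure m2 (C \<times> (D \<times> A))"
    if [measurable]: "C \<in> sets borel" "D \<in> sets borel" "A \<in> sets S" for C D A
  proof -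
    let ?Z = "C \<times> (UNIV \<times> A) :: (real \<times> real \<times> 's) set"
    let ?\<psi> = "\<lambda>p. fst (snd p) :: real"
    have A_sub: "A \<subseteq> space S" using that(3) by (rule sets.sets_into_space)
    have Z: "?Z \<inter> (?\<psi> -` D' \<inter> space ?P) = C \<times> (D' \<times> A)" for D' :: "real set"
      using A_sub by (auto simp: space_pair_measure)
    have "distr (density m1 (indicator ?Z)) borel ?\<psi> = distr (density m2 (indicator ?Z)) borel ?\<psi>"
      by (rule measure_eqI_lessThan)
        (use fin1 in \<open>simp_all add: restr Z ray[symmetric] less_top[symmetric]\<close>)
    then have "emeasure (distr (density m1 (indicator ?Z)) borel ?\<psi>) D = emeasure (distr (density m2 (indicator ?Z)) borel ?\<psi>) D"
      by simp
    then show ?thesis by (simp add: restr Z)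
  qed
  have half: "emeasure m1 (C \<times> D) = emeasure m2 (C \<times> D)"
    if [measurable]: "C \<in> sets borel" "D \<in> sets (borel \<Otimes>\<^sub>M S)" for C D
  proof -
    let ?Z = "C \<times> space (borel \<Otimes>\<^sub>M S) :: (real \<times> real \<times> 's) set"
    have Z: "?Z \<inter> (snd -` D' \<inter> space ?P) = C \<times> D'" if "D' \<in> sets (borel \<Otimes>\<^sub>M S)" for D'
      using sets.sets_into_space[OF that] by (auto simp: space_pair_measure)
    have "distr (density m1 (indicator ?Z)) (borel \<Otimes>\<^sub>M S) snd = distr (density m2 (indicator ?Z)) (borel \<Otimes>\<^sub>M S) snd"
      by (rule measure_eqI_rectangles[where A=borel and B=S])
        (use fin1 in \<open>simp_all add: restr Z box[symmetric]\<close>)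
    then have "emeasure (distr (density m1 (indicator ?Z)) (borel \<Otimes>\<^sub>M S) snd) D = emeasure (distr (density m2 (indicator ?Z)) (borel \<Otimes>\<^sub>M S) snd) D"
      by simp
    then show ?thesis by (simp add: restr Z)
  qed
  have "m1 = m2"
    by (rule measure_eqI_rectangles[where A=borel and B="borel \<Otimes>\<^sub>M S"]) (use fin1 half in auto)
  then have "(\<integral>\<^sup>+p. g p \<partial>m1) = (\<integral>\<^sup>+p. g p \<partial>m2)" by simp
  also have "(\<integral>\<^sup>+p. g p \<partial>m2) = (\<integral>\<^sup>+\<omega>. ?w2 \<omega> *
        (\<integral>\<^sup>+s. ennreal (exp (- rate (Y n \<omega>) * s)) * (\<integral>\<^sup>+z. g (jump_time n \<omega>, s, z) \<partial>L (Y n \<omega>)) * indicator {0..} s \<partial>lborel) \<partial>M)"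
    unfolding int2[OF g]
    by (intro nn_integral_cong) (subst nn_integral_jump_pair, simp_all add: Y_space)
  finally show ?thesis by (simp add: int1)
qed

end

section \<open>Contraction of jump processes\<close>

context jump_kernel_process
begin

lemma measurable_next_jump_integral:
  assumes g [measurable]: "g \<in> borel_measurable (borel \<Otimes>\<^sub>M (borel \<Otimes>\<^sub>M S))"
  shows "(\<lambda>\<omega>. \<integral>\<^sup>+s. ennreal (exp (- rate (Y n \<omega>) * s)) * (\<integral>\<^sup>+z. g (jump_time n \<omega>, s, z) \<partial>L (Y n \<omega>)) * indicator {0..} s \<partial>lborel)
    \<in> borel_measurable M"
proof -
  have "(\<lambda>\<omega>. \<integral>\<^sup>+p. g (jump_time n \<omega>, p) \<partial>(holding (Y n \<omega>) \<Otimes>\<^sub>M jump_law (Y n \<omega>))) \<in> borel_measurable M"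
    by (rule nn_integral_measurable_subprob_algebra2[OF _ measurable_compose[OF measurable_Y measurable_jump_pair]]) measurable
  also have "?this \<longleftrightarrow> ?thesis"
    by (intro measurable_cong) (subst nn_integral_jump_pair, simp_all add: Y_space)
  finally show ?thesis .
qed

text \<open>\<open>next_jump\<close> describes finite next jump times only, whereas passing
  \<open>t\<close> includes the case of no further jump. The probability is therefore obtained as a
  complement: a next jump up to \<open>t\<close> is removed from \<open>T n \<le> t\<close>.\<close>

lemma emeasure_next_jump_after:
  assumes B: "B \<in> sets (histories n)"
  shows "emeasure M {\<omega> \<in> space M. history n \<omega> \<in> B \<and> T n \<omega> \<le> ereal t \<and> ereal t < T (Suc n) \<omega>} =
    (\<integral>\<^sup>+\<omega>. indicator B (history n \<omega>) * indicator {..ereal t} (T n \<omega>) *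
      ennreal (exp (- rate (Y n \<omega>) * (t - jump_time n \<omega>))) \<partial>M)" (is "emeasure M ?after = ?I")
proof -
  note [measurable] = B
  let ?w = "\<lambda>\<omega>. indicator B (history n \<omega>) * indicator {..ereal t} (T n \<omega>) :: ennreal"
  let ?e = "\<lambda>\<omega>. exp (- rate (Y n \<omega>) * (t - jump_time n \<omega>))"
  let ?before = "{\<omega> \<in> space M. history n \<omega> \<in> B \<and> T n \<omega> \<le> ereal t \<and> T (Suc n) \<omega> \<le> ereal t}"
  let ?g = "\<lambda>(\<tau>, s, z). indicator {..t} (\<tau> + s) :: ennreal"
  have "emeasure M ?before = (\<integral>\<^sup>+\<omega>. indicator ?before \<omega> \<partial>M)"
    by (rule nn_integral_indicator[symmetric]) measurable
  also have "\<dots> = (\<integral>\<^sup>+\<omega>. indicator B (history n \<omega>) * indicator {..<\<infinity>} (T (Suc n) \<omega>) *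
        ?g (jump_time n \<omega>, jump_time (Suc n) \<omega> - jump_time n \<omega>, Y (Suc n) \<omega>) \<partial>M)"
  proof (rule nn_integral_cong_AE, use AE_T_nonneg increasing[of n] AE_space in eventually_elim)
    case (elim \<omega>)
    note a = elim(1) and b = elim(2) and \<omega> = elim(3)
    have "T n \<omega> \<le> ereal t \<and> T (Suc n) \<omega> \<le> ereal t \<longleftrightarrow> T (Suc n) \<omega> < \<infinity> \<and> jump_time (Suc n) \<omega> \<le> t"
      using b a[rule_format, of n] a[rule_format, of "Suc n"]
      by (cases "T n \<omega>"; cases "T (Suc n) \<omega>") auto
    then show ?case
      using \<omega> by (simp add: indicator_def)
  qed
  also have "\<dots> = (\<integral>\<^sup>+\<omega>. indicator B (history n \<omega>) * indicator {..<\<infinity>} (T n \<omega>) *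
        (\<integral>\<^sup>+s. ennreal (exp (- rate (Y n \<omega>) * s)) * (\<integral>\<^sup>+z. ?g (jump_time n \<omega>, s, z) \<partial>L (Y n \<omega>)) * indicator {0..} s \<partial>lborel) \<partial>M)"
    by (rule nn_integral_next_jump[OF B]) measurable
  also have "\<dots> = (\<integral>\<^sup>+\<omega>. ?w \<omega> * ennreal (1 - ?e \<omega>) \<partial>M)"
  proof (rule nn_integral_cong_AE, use AE_T_nonneg AE_space in eventually_elim)
    case (elim \<omega>)
    note a = elim(1) and \<omega> = elim(2)
    let ?l = "rate (Y n \<omega>)" and ?\<tau> = "jump_time n \<omega>"
    have "(\<integral>\<^sup>+s. ennreal (exp (- ?l * s)) * (\<integral>\<^sup>+z. ?g (?\<tau>, s, z) \<partial>L (Y n \<omega>)) * indicator {0..} s \<partial>lborel) =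
        (\<integral>\<^sup>+s. ennreal (?l * exp (- ?l * s)) * indicator {0..t - ?\<tau>} s \<partial>lborel)"
      using rate_nonneg[of "Y n \<omega>"]
      by (intro nn_integral_cong)
        (auto simp: indicator_def space_L[OF Y_space[OF \<omega>]] emeasure_L_space[OF Y_space[OF \<omega>]] ennreal_mult mult.commute)
    moreover have "(\<integral>\<^sup>+s. ennreal (?l * exp (- ?l * s)) * indicator {0..t - ?\<tau>} s \<partial>lborel) = ennreal (1 - ?e \<omega>)"
      if "?\<tau> \<le> t"
    proof -
      have "(\<integral>\<^sup>+s. ennreal (?l * exp (- ?l * s)) * indicator {0..t - ?\<tau>} s \<partial>lborel) =
          ennreal (- exp (- ?l * (t - ?\<tau>)) - - exp (- ?l * 0))"
        using that rate_nonneg[of "Y n \<omega>"]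
        by (intro nn_integral_FTC_Icc) (auto intro!: derivative_eq_intros)
      then show ?thesis by simp
    qed
    moreover have "indicator {..<\<infinity>} (T n \<omega>) = (indicator {..ereal t} (T n \<omega>) :: ennreal) \<or>
        (t < ?\<tau> \<and> indicator {..ereal t} (T n \<omega>) = (0 :: ennreal))"
      using a[rule_format, of n] by (cases "T n \<omega>") (auto simp: indicator_def)
    moreover have "?\<tau> \<le> t \<or> indicator {..ereal t} (T n \<omega>) = (0 :: ennreal)"
      using a[rule_format, of n] by (cases "T n \<omega>") (auto simp: indicator_def)
    moreover have "(\<integral>\<^sup>+s. ennreal (?l * exp (- ?l * s)) * indicator {0..t - ?\<tau>} s \<partial>lborel) = 0" if "t < ?\<tau>"
      using that by simp
    ultimately show ?case
      by auto
  qed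
  finally have before: "emeasure M ?before = (\<integral>\<^sup>+\<omega>. ?w \<omega> * ennreal (1 - ?e \<omega>) \<partial>M)" .
  have "emeasure M ?after + emeasure M ?before = emeasure M (?after \<union> ?before)"
    by (rule plus_emeasure) auto
  also have "?after \<union> ?before = {\<omega> \<in> space M. history n \<omega> \<in> B \<and> T n \<omega> \<le> ereal t}"
    by auto
  also have "emeasure M \<dots> = (\<integral>\<^sup>+\<omega>. indicator {\<omega> \<in> space M. history n \<omega> \<in> B \<and> T n \<omega> \<le> ereal t} \<omega> \<partial>M)"
    by (rule nn_integral_indicator[symmetric]) measurable
  also have "\<dots> = (\<integral>\<^sup>+\<omega>. ?w \<omega> * ennreal (?e \<omega>) + ?w \<omega> * ennreal (1 - ?e \<omega>) \<partial>M)"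
  proof (rule nn_integral_cong_AE, use AE_T_nonneg AE_space in eventually_elim)
    case (elim \<omega>)
    note a = elim(1) and \<omega> = elim(2)
    have "ennreal (?e \<omega>) + ennreal (1 - ?e \<omega>) = 1" if "T n \<omega> \<le> ereal t"
    proof -
      have "jump_time n \<omega> \<le> t" using that a[rule_format, of n] by (cases "T n \<omega>") auto
      then have "?e \<omega> \<le> 1" using rate_nonneg[of "Y n \<omega>"] by simp
      then show ?thesis by (subst ennreal_plus[symmetric]) auto
    qed
    then show ?case
      using \<omega> by (auto simp: indicator_def)
  qed
  also have "\<dots> = ?I + emeasure M ?before"
    unfolding before by (rule nn_integral_add) measurable
  finally have "emeasure M ?before + emeasure M ?after = emeasure M ?before + ?I"
    by (subst (1 2) add.commute)
  then show ?thesis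
    using emeasure_finite[of ?before] by (simp only: ennreal_add_left_cancel) simp
qed

text \<open>The backward equation at the n-th position, averaged over the paths. Its first term is
  the probability of no further jump up to \<open>t\<close>; its integral term is the same quantity
  after one more jump.\<close>

lemma truncated_semigroup_jump:
  fixes R r t :: real
  assumes R: "R \<le> r" and r: "0 < r" and A [measurable]: "A \<in> sets S"
  defines "N n \<equiv> {\<omega> \<in> space M. \<forall>k\<le>n. Y k \<omega> \<in> bounded_rate R}"
  defines "I n \<equiv> \<integral>\<^sup>+\<omega>. indicator (N n) \<omega> * indicator {..ereal t} (T n \<omega>) *
      truncated_semigroup R r A (t - jump_time n \<omega>) (Y n \<omega>) \<partial>M"
  shows "I n = emeasure M {\<omega> \<in> space M. T n \<omega> \<le> ereal t \<and> ereal t < T (Suc n) \<omega> \<and> Y n \<omega> \<in> A \<and> \<omega> \<in> N n} + I (Suc n)"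
proof -
  let ?G = "bounded_rate R"
  note semi [measurable] = measurable_truncated_semigroup[OF R r A]
  define B where "B = {h \<in> space (histories n). \<forall>k\<in>{..n}. snd (h k) \<in> ?G}"
  have B [measurable]: "B \<in> sets (histories n)" unfolding B_def by measurable
  define BA where "BA = {h \<in> space (histories n). h \<in> B \<and> snd (h n) \<in> A}"
  have BA [measurable]: "BA \<in> sets (histories n)" unfolding BA_def by measurable
  have hist: "history n \<omega> \<in> B \<longleftrightarrow> \<omega> \<in> N n" "history n \<omega> \<in> BA \<longleftrightarrow> \<omega> \<in> N n \<and> Y n \<omega> \<in> A" if "\<omega> \<in> space M" for \<omega>
    using measurable_space[OF measurable_history that] that by (auto simp: history_def B_def BA_def N_def)
  let ?w = "\<lambda>\<omega>. indicator B (history n \<omega>) * indicator {..ereal t} (T n \<omega>) :: ennreal"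
  \<comment> \<open>The truncated semigroup for the time left after a next jump at
    \<open>\<tau> + s\<close>. The indicator discards jumps after \<open>t\<close>, for which that
    time would be negative.\<close>
  let ?g = "\<lambda>(\<tau>, s, z). indicator {..t} (\<tau> + s) * truncated_semigroup R r A (t - (\<tau> + s)) z"
  have g [measurable]: "?g \<in> borel_measurable (borel \<Otimes>\<^sub>M (borel \<Otimes>\<^sub>M S))"
  proof -
    have "(\<lambda>p. truncated_semigroup R r A (t - (fst p + fst (snd p))) (snd (snd p))) \<in> borel_measurable (borel \<Otimes>\<^sub>M (borel \<Otimes>\<^sub>M S))"
      using measurable_compose[OF _ semi, of "\<lambda>p. (t - (fst p + fst (snd p)), snd (snd p))" "borel \<Otimes>\<^sub>M (borel \<Otimes>\<^sub>M S)"]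
      by simp
    then show ?thesis by (simp add: case_prod_unfold)
  qed
  let ?J = "\<lambda>\<omega>. \<integral>\<^sup>+s. ennreal (exp (- rate (Y n \<omega>) * s)) * (\<integral>\<^sup>+z. ?g (jump_time n \<omega>, s, z) \<partial>L (Y n \<omega>)) * indicator {0..} s \<partial>lborel"
  have J [measurable]: "?J \<in> borel_measurable M"
    by (rule measurable_next_jump_integral[OF g])
  let ?a = "\<lambda>\<omega>. ennreal (exp (- rate (Y n \<omega>) * (t - jump_time n \<omega>))) * indicator A (Y n \<omega>)"
  have "I n = (\<integral>\<^sup>+\<omega>. ?w \<omega> * ?a \<omega> + indicator B (history n \<omega>) * indicator {..<\<infinity>} (T n \<omega>) * ?J \<omega> \<partial>M)"
    unfolding I_def
  proof (rule nn_integral_cong_AE, use AE_T_nonneg AE_space in eventually_elim)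
    case (elim \<omega>)
    note a = elim(1) and \<omega> = elim(2)
    let ?\<tau> = "jump_time n \<omega>"
    note sets_L[OF Y_space[OF \<omega>], measurable_cong]
    have Ju: "?J \<omega> = (\<integral>\<^sup>+s. ennreal (exp (- rate (Y n \<omega>) * s)) *
        (\<integral>\<^sup>+z. truncated_semigroup R r A (t - ?\<tau> - s) z \<partial>L (Y n \<omega>)) * indicator {0..t - ?\<tau>} s \<partial>lborel)"
      by (intro nn_integral_cong) (auto simp: indicator_def algebra_simps)
    show ?case
    proof (cases "\<omega> \<in> N n \<and> T n \<omega> < \<infinity>")
      case True
      then have G: "Y n \<omega> \<in> ?G" by (simp add: N_def)
      show ?thesis
      proof (cases "?\<tau> \<le> t")
        case le: True
        then have "T n \<omega> \<le> ereal t" using True a[rule_format, of n] by (cases "T n \<omega>") auto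
        moreover have "0 \<le> t - ?\<tau>" using le by simp
        note truncated_semigroup_duhamel[OF R r A G this]
        ultimately show ?thesis
          using True hist[OF \<omega>] unfolding Ju by (simp add: indicator_def)
      next
        case False
        then have "\<not> T n \<omega> \<le> ereal t" using True a[rule_format, of n] by (cases "T n \<omega>") auto
        then show ?thesis using False unfolding Ju by (simp add: indicator_def)
      qed
    next
      case False
      then have "\<omega> \<notin> N n \<or> (T n \<omega> = \<infinity>)" by auto
      then show ?thesis using hist[OF \<omega>] by (auto simp: indicator_def)
    qed
  qed
  also have "\<dots> = (\<integral>\<^sup>+\<omega>. ?w \<omega> * ?a \<omega> \<partial>M) + (\<integral>\<^sup>+\<omega>. indicator B (history n \<omega>) * indicator {..<\<infinity>} (T n \<omega>) * ?J \<omega> \<partial>M)"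
    by (rule nn_integral_add) measurable
  also have "(\<integral>\<^sup>+\<omega>. ?w \<omega> * ?a \<omega> \<partial>M) = (\<integral>\<^sup>+\<omega>. indicator BA (history n \<omega>) * indicator {..ereal t} (T n \<omega>) *
      ennreal (exp (- rate (Y n \<omega>) * (t - jump_time n \<omega>))) \<partial>M)"
    using hist by (intro nn_integral_cong) (auto simp: indicator_def)
  also have "\<dots> = emeasure M {\<omega> \<in> space M. history n \<omega> \<in> BA \<and> T n \<omega> \<le> ereal t \<and> ereal t < T (Suc n) \<omega>}"
    by (rule emeasure_next_jump_after[OF BA, symmetric])
  also have "{\<omega> \<in> space M. history n \<omega> \<in> BA \<and> T n \<omega> \<le> ereal t \<and> ereal t < T (Suc n) \<omega>} =
      {\<omega> \<in> space M. T n \<omega> \<le> ereal t \<and> ereal t < T (Suc n) \<omega> \<and> Y n \<omega> \<in> A \<and> \<omega> \<in> N n}"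
    using hist by auto
  also have "(\<integral>\<^sup>+\<omega>. indicator B (history n \<omega>) * indicator {..<\<infinity>} (T n \<omega>) * ?J \<omega> \<partial>M) =
    (\<integral>\<^sup>+\<omega>. indicator B (history n \<omega>) * indicator {..<\<infinity>} (T (Suc n) \<omega>) *
        ?g (jump_time n \<omega>, jump_time (Suc n) \<omega> - jump_time n \<omega>, Y (Suc n) \<omega>) \<partial>M)"
    by (rule nn_integral_next_jump[OF B g, symmetric])
  also have "\<dots> = I (Suc n)"
    unfolding I_def
  proof (rule nn_integral_cong_AE, use AE_T_nonneg AE_space in eventually_elim)
    case (elim \<omega>)
    note a = elim(1) and \<omega> = elim(2)
    have 1: "T (Suc n) \<omega> \<le> ereal t \<longleftrightarrow> T (Suc n) \<omega> < \<infinity> \<and> jump_time (Suc n) \<omega> \<le> t"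
      using a[rule_format, of "Suc n"] by (cases "T (Suc n) \<omega>") auto
    have 2: "\<omega> \<in> N (Suc n) \<longleftrightarrow> \<omega> \<in> N n \<and> Y (Suc n) \<omega> \<in> ?G"
      by (auto simp: N_def le_Suc_eq)
    \<comment> \<open>A jump out of \<open>bounded_rate R\<close> contributes nothing, as the
      truncated semigroup vanishes there; so the condition on \<open>Y (Suc n)\<close> in
      \<open>N (Suc n)\<close> comes for free.\<close>
    show ?case
      using truncated_semigroup_outside[OF R r A Y_space[OF \<omega>, of "Suc n"]] hist(1)[OF \<omega>]
      unfolding indicator_def by (auto simp: 1 2)
  qed
  finally show ?thesis .
qed

lemma emeasure_T_le_tendsto: "(\<lambda>n. emeasure M {\<omega> \<in> space M. T n \<omega> \<le> ereal t}) \<longlonglongrightarrow> 0"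
proof (rule tendsto_sandwich[OF _ _ tendsto_const])
  \<comment> \<open>The events \<open>T n \<le> t\<close> decrease only up to null sets, while
    \<open>?D n\<close> decreases everywhere.\<close>
  let ?D = "\<lambda>n. {\<omega> \<in> space M. \<exists>m\<in>{n..}. T m \<omega> \<le> ereal t}"
  have "(\<lambda>n. emeasure M (?D n)) \<longlonglongrightarrow> emeasure M (\<Inter>n. ?D n)"
    by (rule Lim_emeasure_decseq) (auto simp: decseq_def intro!: emeasure_finite)
  moreover have "AE \<omega> in M. \<omega> \<notin> (\<Inter>n. ?D n)"
    using nonexplosive
  proof eventually_elim
    fix \<omega> assume "(\<lambda>n. T n \<omega>) \<longlonglongrightarrow> \<infinity>"
    then have "eventually (\<lambda>n. ereal t < T n \<omega>) sequentially" by (rule order_tendstoD) simp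
    then obtain k where "\<And>n. n \<ge> k \<Longrightarrow> ereal t < T n \<omega>" by (auto simp: eventually_sequentially)
    then have "\<omega> \<notin> ?D k" by (auto simp: not_le)
    then show "\<omega> \<notin> (\<Inter>n. ?D n)" by blast
  qed
  then have "emeasure M (\<Inter>n. ?D n) = emeasure M {}"
    by (intro emeasure_eq_AE) auto
  ultimately show "(\<lambda>n. emeasure M (?D n)) \<longlonglongrightarrow> 0" by simp
  show "eventually (\<lambda>n. emeasure M {\<omega> \<in> space M. T n \<omega> \<le> ereal t} \<le> emeasure M (?D n)) sequentially"
    by (intro always_eventually allI emeasure_mono) auto
qed simp

lemma truncated_semigroup_eq:
  fixes R r t :: real
  assumes R: "R \<le> r" and r: "0 < r" and A [measurable]: "A \<in> sets S" and t: "0 \<le> t"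
  shows "truncated_semigroup R r A t x\<^sub>0 = emeasure M {\<omega> \<in> space M. X t \<omega> \<in> A \<and>
    (\<exists>n. T n \<omega> \<le> ereal t \<and> ereal t < T (Suc n) \<omega> \<and> (\<forall>k\<le>n. Y k \<omega> \<in> bounded_rate R))}"
proof -
  note [measurable] = measurable_X[OF t]
  let ?G = "bounded_rate R"
  define N where "N n = {\<omega> \<in> space M. \<forall>k\<le>n. Y k \<omega> \<in> ?G}" for n
  have [measurable]: "N n \<in> sets M" for n
  proof -
    have "N n = {\<omega> \<in> space M. \<forall>k\<in>{..n}. Y k \<omega> \<in> ?G}" by (auto simp: N_def)
    also have "\<dots> \<in> sets M" by measurable
    finally show ?thesis .
  qed
  define I where "I n = (\<integral>\<^sup>+\<omega>. indicator (N n) \<omega> * indicator {..ereal t} (T n \<omega>) *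
      truncated_semigroup R r A (t - jump_time n \<omega>) (Y n \<omega>) \<partial>M)" for n
  define E where "E n = {\<omega> \<in> space M. T n \<omega> \<le> ereal t \<and> ereal t < T (Suc n) \<omega> \<and> Y n \<omega> \<in> A \<and> \<omega> \<in> N n}" for n
  have [measurable]: "E n \<in> sets M" for n unfolding E_def by measurable
  let ?W = "{\<omega> \<in> space M. X t \<omega> \<in> A \<and> (\<exists>n. T n \<omega> \<le> ereal t \<and> ereal t < T (Suc n) \<omega> \<and> (\<forall>k\<le>n. Y k \<omega> \<in> ?G))}"
  have W: "?W = {\<omega> \<in> space M. X t \<omega> \<in> A \<and> (\<exists>n. T n \<omega> \<le> ereal t \<and> ereal t < T (Suc n) \<omega> \<and> \<omega> \<in> N n)}"
    by (auto simp: N_def)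
  have W_sets [measurable]: "?W \<in> sets M" unfolding W by measurable
  have step: "I n = emeasure M (E n) + I (Suc n)" for n
    unfolding I_def E_def N_def by (rule truncated_semigroup_jump[OF R r A])
  have sum: "I 0 = (\<Sum>k<n. emeasure M (E k)) + I n" for n
  proof (induction n)
    case (Suc n)
    then show ?case unfolding step[of n] by (simp add: add.assoc)
  qed simp
  have "I n \<le> emeasure M {\<omega> \<in> space M. T n \<omega> \<le> ereal t}" for n
  proof -
    have "I n \<le> (\<integral>\<^sup>+\<omega>. indicator {\<omega> \<in> space M. T n \<omega> \<le> ereal t} \<omega> \<partial>M)"
      unfolding I_def
    proof (rule nn_integral_mono_AE, use AE_T_nonneg AE_space in eventually_elim)
      case (elim \<omega>)
      note a = elim(1) and \<omega> = elim(2)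
      have "truncated_semigroup R r A (t - jump_time n \<omega>) (Y n \<omega>) \<le> 1" if "T n \<omega> \<le> ereal t"
      proof (rule truncated_semigroup_le_1[OF R r A Y_space[OF \<omega>]])
        show "0 \<le> t - jump_time n \<omega>" using that a[rule_format, of n] by (cases "T n \<omega>") auto
      qed
      then show ?case
        using \<omega> by (auto simp: indicator_def)
    qed
    then show ?thesis by simp
  qed
  then have I_lim: "I \<longlonglongrightarrow> 0"
    by (intro tendsto_sandwich[OF _ _ tendsto_const emeasure_T_le_tendsto] always_eventually allI) auto
  have "(\<lambda>n. (\<Sum>k<n. emeasure M (E k)) + I n) \<longlonglongrightarrow> (\<Sum>k. emeasure M (E k)) + 0"
    by (intro tendsto_add I_lim summable_LIMSEQ) simp
  then have "I 0 = (\<Sum>k. emeasure M (E k))"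
    by (simp add: sum[symmetric] LIMSEQ_const_iff)
  also have "\<dots> = (\<Sum>k. \<integral>\<^sup>+\<omega>. indicator (E k) \<omega> \<partial>M)" by simp
  also have "\<dots> = (\<integral>\<^sup>+\<omega>. (\<Sum>k. indicator (E k) \<omega>) \<partial>M)"
    by (rule nn_integral_suminf[symmetric]) measurable
  \<comment> \<open>The sets \<open>E k\<close> are almost surely disjoint because the jump times
    increase, and by \<open>path\<close> their union is almost surely \<open>?W\<close>.\<close>
  also have "\<dots> = (\<integral>\<^sup>+\<omega>. indicator ?W \<omega> \<partial>M)"
  proof (rule nn_integral_cong_AE)
    have "AE \<omega> in M. \<forall>n. T n \<omega> < T (Suc n) \<omega> \<or> (T n \<omega> = \<infinity> \<and> T (Suc n) \<omega> = \<infinity>)"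
      using increasing by (simp add: AE_all_countable)
    moreover have "AE \<omega> in M. \<forall>n. T n \<omega> \<le> ereal t \<and> ereal t < T (Suc n) \<omega> \<longrightarrow> X t \<omega> = Y n \<omega>"
      using path[OF t] by (simp add: AE_all_countable)
    ultimately show "AE \<omega> in M. (\<Sum>k. indicator (E k) \<omega>) = (indicator ?W \<omega> :: ennreal)"
      using AE_space
    proof eventually_elim
      fix \<omega> assume inc: "\<forall>n. T n \<omega> < T (Suc n) \<omega> \<or> (T n \<omega> = \<infinity> \<and> T (Suc n) \<omega> = \<infinity>)"
        and X: "\<forall>n. T n \<omega> \<le> ereal t \<and> ereal t < T (Suc n) \<omega> \<longrightarrow> X t \<omega> = Y n \<omega>" and \<omega>: "\<omega> \<in> space M"
      have mono: "T i \<omega> \<le> T j \<omega>" if "i \<le> j" for i j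
        using that
      proof (rule lift_Suc_mono_le[rotated])
        show "T n \<omega> \<le> T (Suc n) \<omega>" for n using inc[rule_format, of n] by auto
      qed
      have uniq: "i = j" if "\<omega> \<in> E i" "\<omega> \<in> E j" for i j
      proof (rule ccontr)
        assume "i \<noteq> j"
        then have "Suc i \<le> j \<or> Suc j \<le> i" by auto
        then show False
          using that mono[of "Suc i" j] mono[of "Suc j" i] by (auto simp: E_def)
      qed
      have WE: "\<omega> \<in> ?W \<longleftrightarrow> (\<exists>n. \<omega> \<in> E n)"
        unfolding W E_def using X \<omega> by auto
      show "(\<Sum>k. indicator (E k) \<omega>) = (indicator ?W \<omega> :: ennreal)"
      proof (cases "\<exists>n. \<omega> \<in> E n")
        case True
        then obtain n where n: "\<omega> \<in> E n" ..
        then have "(\<Sum>k. indicator (E k) \<omega>) = (\<Sum>k\<in>{n}. indicator (E k) \<omega> :: ennreal)"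
          using uniq by (intro suminf_finite) (auto simp: indicator_def)
        then show ?thesis using True n unfolding WE[symmetric] by (simp add: indicator_def)
      next
        case False
        then have "indicator (E k) \<omega> = (0 :: ennreal)" for k by (auto simp: indicator_def)
        then show ?thesis using False unfolding WE[symmetric] by (simp add: indicator_def)
      qed
    qed
  qed
  also have "\<dots> = emeasure M ?W" by simp
  also have "I 0 = (\<integral>\<^sup>+\<omega>. truncated_semigroup R r A t x\<^sub>0 \<partial>M)"
    unfolding I_def
  proof (rule nn_integral_cong_AE)
    show "AE \<omega> in M. indicator (N 0) \<omega> * indicator {..ereal t} (T 0 \<omega>) *
        truncated_semigroup R r A (t - jump_time 0 \<omega>) (Y 0 \<omega>) = truncated_semigroup R r A t x\<^sub>0"
      using initial AE_space
    proof eventually_elim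
      case (elim \<omega>)
      then show ?case
        using t truncated_semigroup_outside[OF R r A x\<^sub>0] by (auto simp: N_def indicator_def zero_ereal_def)
    qed
  qed
  finally show ?thesis by (simp add: emeasure_space_1)
qed

text \<open>Almost surely only finitely many positions are visited up to time \<open>t\<close>, so
  their rates lie below some natural number, which may vary with the path.\<close>

lemma truncated_semigroup_tendsto_1:
  assumes r: "\<And>n. real n \<le> r n" "\<And>n. 0 < r n" and t: "0 \<le> t"
  shows "(\<lambda>n. truncated_semigroup (real n) (r n) (space S) t x\<^sub>0) \<longlonglongrightarrow> 1"
proof -
  note [measurable] = measurable_X[OF t]
  define W where "W R = {\<omega> \<in> space M. \<exists>n. T n \<omega> \<le> ereal t \<and> ereal t < T (Suc n) \<omega> \<and> (\<forall>k\<in>{..n}. Y k \<omega> \<in> bounded_rate (real R))}" for R :: nat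
  have [measurable]: "W R \<in> sets M" for R unfolding W_def by measurable
  have eq: "truncated_semigroup (real n) (r n) (space S) t x\<^sub>0 = emeasure M (W n)" for n
    unfolding truncated_semigroup_eq[OF r sets.top t] W_def
    using measurable_space[OF measurable_X[OF t]] by (intro arg_cong[where f="emeasure M"]) auto
  have "(\<lambda>n. emeasure M (W n)) \<longlonglongrightarrow> emeasure M (\<Union>n. W n)"
  proof (rule Lim_emeasure_incseq)
    show "incseq W"
    proof (rule monoI)
      fix m n :: nat assume "m \<le> n"
      then have "bounded_rate (real m) \<subseteq> bounded_rate (real n)" by (auto simp: bounded_rate_def)
      then show "W m \<subseteq> W n" unfolding W_def by blast
    qed
  qed auto
  moreover have "AE \<omega> in M. \<omega> \<in> (\<Union>n. W n)"
    using nonexplosive initial AE_space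
  proof eventually_elim
    fix \<omega> assume lim: "(\<lambda>n. T n \<omega>) \<longlonglongrightarrow> \<infinity>" and init: "T 0 \<omega> = 0 \<and> Y 0 \<omega> = x\<^sub>0" and \<omega>: "\<omega> \<in> space M"
    have "eventually (\<lambda>n. ereal t < T n \<omega>) sequentially" using lim by (rule order_tendstoD) simp
    then obtain m where "ereal t < T m \<omega>" by (auto simp: eventually_sequentially)
    moreover have "\<not> ereal t < T 0 \<omega>" using init t by (simp add: zero_ereal_def)
    ultimately obtain n where n: "\<not> ereal t < T n \<omega>" "ereal t < T (Suc n) \<omega>"
      using ex_least_nat_less[of "\<lambda>k. ereal t < T k \<omega>" m] by blast
    obtain R :: nat where R: "Max ((\<lambda>k. rate (Y k \<omega>)) ` {..n}) \<le> real R" using real_arch_simple by blast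
    have "Y k \<omega> \<in> bounded_rate (real R)" if "k \<le> n" for k
      using R that Y_space[OF \<omega>] by (auto simp: bounded_rate_def)
    then have "\<omega> \<in> W R" using n \<omega> by (auto simp: W_def not_less)
    then show "\<omega> \<in> (\<Union>n. W n)" by blast
  qed
  then have "emeasure M (\<Union>n. W n) = 1"
    by (subst emeasure_eq_1_AE) (auto simp: emeasure_space_1)
  ultimately show ?thesis unfolding eq by simp
qed

lemma distr_X_0: "distr M S (X 0) = return S x\<^sub>0"
proof -
  have "AE \<omega> in M. X 0 \<omega> = x\<^sub>0"
    using initial increasing[of 0] path[OF order_refl, of 0]
  proof eventually_elim
    case (elim \<omega>)
    then show ?case by (auto simp: zero_ereal_def)
  qed
  then have "distr M S (X 0) = distr M S (\<lambda>_. x\<^sub>0)"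
    using x\<^sub>0 measurable_X[of 0] by (intro distr_cong_AE) auto
  then show ?thesis using x\<^sub>0 by simp
qed

end

text \<open>The hypothesis \<open>contr\<close> says that a coupled generator applied to
  \<open>d\<close> is at most \<open>- \<kappa> * d\<close>, up to \<open>e\<close>; adding
  \<open>r * d\<close> to both sides replaces the signed generator by positive measures of equal
  mass. The processes share only their kernel, so they may live on different spaces.\<close>

theorem jump_process_contraction:
  assumes "separable_cost S d D" and "jump_kernel S L"
    and px: "nonexplosive_jump_process Mx S L x Tx Yx Xx" and py: "nonexplosive_jump_process My S L y Ty Yy Xy"
    and x: "x \<in> space S" and y: "y \<in> space S" and t: "0 \<le> t"
    and contr: "\<And>u v r e. u \<in> space S \<Longrightarrow> v \<in> space S \<Longrightarrow>
      jump_kernel.rate S L u + jump_kernel.rate S L v \<le> r \<Longrightarrow> \<kappa> \<le> r \<Longrightarrow> 0 < e \<Longrightarrow>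
      transport_le d (jump_kernel.padded S L r u) (jump_kernel.padded S L r v) (ennreal ((r - \<kappa>) * d u v + e))"
  shows "wasserstein d (distr Mx S (Xx t)) (distr My S (Xy t)) \<le> ennreal (exp (- \<kappa> * t) * d x y)"
proof -
  interpret separable_cost S d D by fact
  interpret jump_kernel S L by fact
  interpret px: jump_kernel_process S L Mx x Tx Yx Xx
    using px x by (simp add: jump_kernel_process_def jump_kernel_process_axioms_def jump_kernel_axioms)
  interpret py: jump_kernel_process S L My y Ty Yy Xy
    using py y by (simp add: jump_kernel_process_def jump_kernel_process_axioms_def jump_kernel_axioms)
  show ?thesis
  proof (cases "t = 0")
    \<comment> \<open>The Poisson mean has to be positive, so time 0 is treated apart.\<close>
    case True
    have "wasserstein d (return S x) (return S y) \<le> ennreal (d x y)"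
      by (rule wasserstein_le_transport[OF transport_le_return[OF d_measurable x y]])
    then show ?thesis using True by (simp add: px.distr_X_0 py.distr_X_0)
  next
    case False
    with t have t: "0 < t" by simp
    \<comment> \<open>\<open>r n\<close> dominates the sum of two rates bounded by \<open>n\<close>,
      is positive, and is at least \<kappa>, which makes the one-step factor \<rho>
      nonnegative.\<close>
    define r where "r n = 2 * real n + \<bar>\<kappa>\<bar> + 1" for n
    have r: "real n \<le> r n" "0 < r n" "2 * real n \<le> r n" "\<kappa> \<le> r n" for n by (auto simp: r_def)
    let ?ux = "\<lambda>n. truncated_semigroup (real n) (r n) (space S) t x"
    let ?uy = "\<lambda>n. truncated_semigroup (real n) (r n) (space S) t y"
    have bound: "wasserstein d (distr Mx S (Xx t)) (distr My S (Xy t)) \<le>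
      ennreal (exp (- \<kappa> * t) * d x y + 1 / real (Suc n)) + ennreal D * ((1 - ?ux n) + (1 - ?uy n))" for n
    proof -
      let ?G = "bounded_rate (real n)"
      let ?Q = "uniformized (real n) (r n)"
      note Q = measurable_uniformized[OF r(1,2)[of n]]
      \<comment> \<open>With this choice \<open>r n * t * (1 - \<rho>) = \<kappa> * t\<close>, so
        the exponential factor does not depend on the truncation.\<close>
      define \<rho> where "\<rho> = 1 - \<kappa> / r n"
      have \<rho>: "0 \<le> \<rho>" using r[of n] by (simp add: \<rho>_def)
      have m: "0 < r n * t" using r[of n] t by simp
      have "\<exists>\<gamma>\<in>couplings (poisson_mixture S ?Q (r n * t) x) (poisson_mixture S ?Q (r n * t) y).
        (\<integral>\<^sup>+(u, v). ennreal (d u v) * indicator (?G \<times> ?G) (u, v) \<partial>\<gamma>) \<le>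
        ennreal (exp (- (r n * t) * (1 - \<rho>)) * d x y + 1 / real (Suc n))"
      proof (rule uniformized_coupling[OF Q bounded_rate _ \<rho> m _ _ x y])
        fix u v e assume u: "u \<in> ?G" and v: "v \<in> ?G" and e: "0 < (e :: real)"
        note uS = bounded_rate_space[OF u] and vS = bounded_rate_space[OF v]
        have "transport_le d (padded (r n) u) (padded (r n) v) (ennreal ((r n - \<kappa>) * d u v + r n * e))"
          using uS vS r[of n] e by (intro contr) auto
        from transport_le_scale[OF d_measurable this, of "ennreal (1 / r n)"]
        have "transport_le d (?Q u) (?Q v) (ennreal (1 / r n) * ennreal ((r n - \<kappa>) * d u v + r n * e))"
          using u v uS vS by (simp add: uniformized_def padded_def sets_L)
        also have "ennreal (1 / r n) * ennreal ((r n - \<kappa>) * d u v + r n * e) = ennreal (1 / r n * ((r n - \<kappa>) * d u v + r n * e))"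
          using r[of n] e d_nonneg uS vS by (intro ennreal_mult[symmetric]) auto
        also have "1 / r n * ((r n - \<kappa>) * d u v + r n * e) = \<rho> * d u v + e"
          using r(2)[of n] by (simp add: \<rho>_def field_simps)
        finally show "transport_le d (?Q u) (?Q v) (ennreal (\<rho> * d u v + e))" .
      qed (auto simp: uniformized_def)
      then obtain \<gamma> where \<gamma>: "\<gamma> \<in> couplings (poisson_mixture S ?Q (r n * t) x) (poisson_mixture S ?Q (r n * t) y)"
        and cost: "(\<integral>\<^sup>+(u, v). ennreal (d u v) * indicator (?G \<times> ?G) (u, v) \<partial>\<gamma>) \<le>
          ennreal (exp (- (r n * t) * (1 - \<rho>)) * d x y + 1 / real (Suc n))" by blast
      have u: "emeasure (poisson_mixture S ?Q (r n * t) z) (A \<inter> ?G) = truncated_semigroup (real n) (r n) A t z"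
        if "A \<in> sets S" "z \<in> space S" for A z
        using that by (simp add: emeasure_poisson_mixture[OF Q that(2) _ m] truncated_semigroup_def)
      have exp: "- (r n * t) * (1 - \<rho>) = - \<kappa> * t"
        using r(2)[of n] by (simp add: \<rho>_def field_simps)
      have top: "emeasure (poisson_mixture S ?Q (r n * t) z) ?G = truncated_semigroup (real n) (r n) (space S) t z"
        if "z \<in> space S" for z
        using u[OF sets.top that] sets.sets_into_space[OF bounded_rate] by (simp add: Int_absorb1)
      have "wasserstein d (distr Mx S (Xx t)) (distr My S (Xy t)) \<le>
        (\<integral>\<^sup>+(u, v). ennreal (d u v) * indicator (?G \<times> ?G) (u, v) \<partial>\<gamma>) +
        ennreal D * ((1 - emeasure (poisson_mixture S ?Q (r n * t) x) ?G) + (1 - emeasure (poisson_mixture S ?Q (r n * t) y) ?G))"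
      proof (rule wasserstein_le_restricted_coupling[OF \<gamma>])
        show "prob_space (distr Mx S (Xx t))" "prob_space (distr My S (Xy t))"
          using t by (auto intro!: px.prob_space_distr py.prob_space_distr px.measurable_X py.measurable_X)
        fix A assume A: "A \<in> sets S"
        note [measurable] = A px.measurable_X[OF less_imp_le[OF t]] py.measurable_X[OF less_imp_le[OF t]]
        show "emeasure (poisson_mixture S ?Q (r n * t) x) (A \<inter> ?G) \<le> emeasure (distr Mx S (Xx t)) A"
          unfolding u[OF A x] px.truncated_semigroup_eq[OF r(1,2) A less_imp_le[OF t]]
          by (subst emeasure_distr) (auto intro!: emeasure_mono)
        show "emeasure (poisson_mixture S ?Q (r n * t) y) (A \<inter> ?G) \<le> emeasure (distr My S (Xy t)) A"
          unfolding u[OF A y] py.truncated_semigroup_eq[OF r(1,2) A less_imp_le[OF t]]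
          by (subst emeasure_distr) (auto intro!: emeasure_mono)
      qed (auto simp: poisson_mixture_space[OF Q x] poisson_mixture_space[OF Q y])
      also have "\<dots> \<le> ennreal (exp (- \<kappa> * t) * d x y + 1 / real (Suc n)) + ennreal D * ((1 - ?ux n) + (1 - ?uy n))"
        unfolding top[OF x] top[OF y] using cost[unfolded exp] by (rule add_right_mono)
      finally show ?thesis .
    qed
    \<comment> \<open>As the truncation is removed, both the selection error and the missing masses
      tend to 0.\<close>
    have "(\<lambda>n. ennreal (exp (- \<kappa> * t) * d x y + 1 / real (Suc n)) + ennreal D * ((1 - ?ux n) + (1 - ?uy n)))
      \<longlonglongrightarrow> ennreal (exp (- \<kappa> * t) * d x y + 0) + ennreal D * ((1 - 1) + (1 - 1))"
    proof (intro tendsto_add tendsto_ennrealI tendsto_const ennreal_tendsto_cmult tendsto_diff_ennreal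
        px.truncated_semigroup_tendsto_1 py.truncated_semigroup_tendsto_1 r)
      show "(\<lambda>n. 1 / real (Suc n)) \<longlonglongrightarrow> 0" by (rule LIMSEQ_Suc[OF lim_1_over_n])
    qed (use t in auto)
    from LIMSEQ_le_const[OF this] bound show ?thesis by auto
  qed
qed

section \<open>The particle system\<close>

lemma dist_measurable_pair: "(\<lambda>(u :: 'a::polish_space, v). dist u v) \<in> borel_measurable (borel \<Otimes>\<^sub>M borel)"
  by measurable

abbreviation balanced :: "'a::polish_space measure \<Rightarrow> 'a measure \<Rightarrow> 'a \<Rightarrow> 'a measure" where
  "balanced m\<^sub>1 m\<^sub>2 x \<equiv> m\<^sub>1 \<oplus>\<^sub>\<mu> scale_measure (emeasure m\<^sub>2 UNIV) (return borel x)"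

definition mean_law :: "('a::polish_space \<Rightarrow> 'a measure) \<Rightarrow> ('n::finite \<Rightarrow> 'a) \<Rightarrow> 'a measure" where
  "mean_law P xs = scale_measure (ennreal (1 / real CARD('n))) (sum_measure borel (\<lambda>j. P (xs j)) UNIV)"

text \<open>\<open>n_type\<close> carries the type of the labels, which occurs in none of the other
  parameters.\<close>

locale particle_system =
  fixes q P :: "'a::polish_space \<Rightarrow> 'a measure" and \<beta> :: "'a \<Rightarrow> real" and d_inf :: real
    and n_type :: "'n::finite itself"
  assumes d_bounded: "\<And>x y :: 'a. dist x y \<le> d_inf"
    and q_sets: "\<And>x. sets (q x) = sets borel"
    and q_finite: "\<And>x. finite_measure (q x)"
    and q_kernel: "\<And>A. A \<in> sets borel \<Longrightarrow> (\<lambda>x. emeasure (q x) A) \<in> borel_measurable borel"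
    and \<beta>_measurable [measurable]: "\<beta> \<in> borel_measurable borel"
    and \<beta>_nonneg: "\<And>x. 0 \<le> \<beta> x"
    and P_kernel: "P \<in> measurable borel (prob_algebra borel)"
begin

abbreviation configs :: "('n \<Rightarrow> 'a) measure" where
  "configs \<equiv> config_space"

abbreviation F :: "'a \<Rightarrow> ('n \<Rightarrow> 'a) \<Rightarrow> 'a measure" where
  "F \<equiv> interaction_kernel q \<beta> P"

abbreviation mass :: "'a \<Rightarrow> real" where
  "mass x \<equiv> measure (q x) UNIV + \<beta> x"

lemma P_prob: "prob_space (P x)" and P_sets: "sets (P x) = sets borel"
  using measurable_space[OF P_kernel, of x] by (auto simp: space_prob_algebra)

lemma P_space: "space (P x) = UNIV"
  using sets_eq_imp_space_eq[OF P_sets, of x] by auto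

lemma emeasure_q_UNIV: "emeasure (q x) UNIV = ennreal (measure (q x) UNIV)"
  using q_finite[of x] by (rule finite_measure.emeasure_eq_measure)

lemma sets_mean_law: "sets (mean_law P xs) = sets borel"
  by (simp add: mean_law_def)

lemma emeasure_mean_law:
  "A \<in> sets borel \<Longrightarrow> emeasure (mean_law P (xs :: 'n \<Rightarrow> 'a)) A = ennreal (1 / real CARD('n)) * (\<Sum>j\<in>UNIV. emeasure (P (xs j)) A)"
  by (simp add: mean_law_def emeasure_sum_measure P_sets)

lemma emeasure_mean_law_UNIV: "emeasure (mean_law P (xs :: 'n \<Rightarrow> 'a)) UNIV = 1"
proof -
  have "emeasure (mean_law P xs) UNIV = ennreal (1 / real CARD('n)) * of_nat CARD('n)"
    using prob_space.emeasure_space_1[OF P_prob] by (simp add: emeasure_mean_law P_space)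
  also have "\<dots> = 1"
    by (simp add: ennreal_of_nat_eq_real_of_nat ennreal_mult[symmetric])
  finally show ?thesis .
qed

lemma prob_space_mean_law: "prob_space (mean_law P (xs :: 'n \<Rightarrow> 'a))"
  using emeasure_mean_law_UNIV[of xs] sets_eq_imp_space_eq[OF sets_mean_law, of xs] by (intro prob_spaceI) simp

lemma sets_F: "sets (F x xs) = sets borel"
  by (simp add: interaction_kernel_def q_sets)

lemma space_F: "space (F x xs) = UNIV"
  using sets_eq_imp_space_eq[OF sets_F] by simp

lemma emeasure_F:
  assumes A: "A \<in> sets borel"
  shows "emeasure (F x (xs :: 'n \<Rightarrow> 'a)) A = emeasure (q x) A + ennreal (\<beta> x) * emeasure (mean_law P xs) A"
proof -
  have "ennreal (\<beta> x / real CARD('n)) = ennreal (\<beta> x) * ennreal (1 / real CARD('n))"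
    using \<beta>_nonneg[of x] by (simp add: ennreal_mult[symmetric])
  then show ?thesis
    using A by (simp add: interaction_kernel_def emeasure_plus_measure q_sets emeasure_mean_law emeasure_sum_measure P_sets mult.assoc)
qed

text \<open>The mean-field part is \<beta> times a probability law, so the total rate of a particle
  depends on its own position only.\<close>

lemma emeasure_F_UNIV: "emeasure (F x (xs :: 'n \<Rightarrow> 'a)) UNIV = ennreal (mass x)"
  using \<beta>_nonneg[of x] by (simp add: emeasure_F emeasure_mean_law_UNIV emeasure_q_UNIV ennreal_plus)

lemma mass_nonneg: "0 \<le> mass x"
  using \<beta>_nonneg[of x] by simp

lemma fun_upd_F: "(\<lambda>z. xs(i := z)) \<in> F x xs' \<rightarrow>\<^sub>M configs"
  using measurable_fun_upd_config by (simp add: measurable_cong_sets[OF sets_F refl])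

lemma sets_particle_kernel: "sets (particle_kernel F xs) = sets configs"
  by (simp add: particle_kernel_def)

lemma nn_integral_particle_kernel:
  assumes f: "f \<in> borel_measurable configs"
  shows "(\<integral>\<^sup>+z. f z \<partial>particle_kernel F xs) = (\<Sum>i\<in>UNIV. \<integral>\<^sup>+z. f (xs(i := z)) \<partial>F (xs i) xs)"
  unfolding particle_kernel_def using f fun_upd_F
  by (subst nn_integral_sum_measure) (auto simp: nn_integral_distr)

lemma emeasure_particle_kernel_space:
  "emeasure (particle_kernel F xs) (space configs) = ennreal (\<Sum>i\<in>UNIV. mass (xs i))"
proof -
  have "emeasure (particle_kernel F xs) (space configs) = (\<integral>\<^sup>+z. 1 \<partial>particle_kernel F xs)"
    using sets_eq_imp_space_eq[OF sets_particle_kernel, of xs] by simp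
  also have "\<dots> = (\<Sum>i\<in>UNIV. ennreal (mass (xs i)))"
    by (subst nn_integral_particle_kernel) (simp_all add: space_F emeasure_F_UNIV)
  also have "\<dots> = ennreal (\<Sum>i\<in>UNIV. mass (xs i))"
    using mass_nonneg by (intro sum_ennreal) auto
  finally show ?thesis .
qed

sublocale q: jump_kernel borel q
  by (rule jump_kernel.intro[OF q_sets q_finite q_kernel])

lemma measurable_upd: "(\<lambda>(xs, z). xs(i := z)) \<in> configs \<Otimes>\<^sub>M borel \<rightarrow>\<^sub>M config_space"
proof (rule measurable_PiM_single')
  fix k :: 'n assume "k \<in> UNIV"
  show "(\<lambda>p. (case p of (xs, z) \<Rightarrow> xs(i := z)) k) \<in> borel_measurable (configs \<Otimes>\<^sub>M borel)"
    by (cases "k = i") (simp_all add: case_prod_unfold)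
qed (auto simp: space_PiM)

lemma nn_integral_F:
  assumes f: "f \<in> borel_measurable borel"
  shows "(\<integral>\<^sup>+z. f z \<partial>F x (xs :: 'n \<Rightarrow> 'a)) = (\<integral>\<^sup>+z. f z \<partial>q x) + ennreal (\<beta> x / real CARD('n)) * (\<Sum>j\<in>UNIV. \<integral>\<^sup>+z. f z \<partial>P (xs j))"
  unfolding interaction_kernel_def using f
  by (subst nn_integral_plus_measure)
    (simp_all add: q_sets P_sets nn_integral_scale_measure nn_integral_sum_measure measurable_cong_sets[OF q_sets refl])

lemma finite_particle_kernel: "finite_measure (particle_kernel F (xs :: 'n \<Rightarrow> 'a))"
  using emeasure_particle_kernel_space[of xs] sets_eq_imp_space_eq[OF sets_particle_kernel, of xs]
  by (intro finite_measureI) simp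

text \<open>The configuration enters through the moving particle and through the law of its target.
  Written out with \<open>q\<close> and \<open>P\<close>, each summand integrates a kernel that
  depends on a single coordinate.\<close>

lemma measurable_particle_kernel:
  assumes A [measurable]: "A \<in> sets configs"
  shows "(\<lambda>xs. emeasure (particle_kernel F xs) A) \<in> borel_measurable configs"
proof -
  note measurable_upd [measurable]
  have ind [measurable]: "(\<lambda>(xs, z). indicator A (xs(i := z)) :: ennreal) \<in> borel_measurable (configs \<Otimes>\<^sub>M borel)" for i
    using measurable_compose[OF measurable_upd[of i] borel_measurable_indicator[OF A]] by (simp add: case_prod_unfold)
  have ind1: "(\<lambda>z. indicator A (xs(i := z)) :: ennreal) \<in> borel_measurable borel" for xs :: "'n \<Rightarrow> 'a" and i
    using measurable_compose[OF measurable_fun_upd_config borel_measurable_indicator[OF A]] .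
  have "emeasure (particle_kernel F xs) A = (\<Sum>i\<in>UNIV. (\<integral>\<^sup>+z. indicator A (xs(i := z)) \<partial>q (xs i)) +
      ennreal (\<beta> (xs i) / real CARD('n)) * (\<Sum>j\<in>UNIV. \<integral>\<^sup>+z. indicator A (xs(i := z)) \<partial>P (xs j)))" for xs :: "'n \<Rightarrow> 'a"
  proof -
    have "emeasure (particle_kernel F xs) A = (\<integral>\<^sup>+z. indicator A z \<partial>particle_kernel F xs)"
      by (simp add: sets_particle_kernel)
    then show ?thesis by (simp add: nn_integral_particle_kernel nn_integral_F ind1)
  qed
  moreover have "(\<lambda>xs. \<integral>\<^sup>+z. indicator A (xs(i := z)) \<partial>q (xs i)) \<in> borel_measurable configs" for i
    by (rule q.measurable_nn_integral_L[OF ind]) measurable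
  moreover have "(\<lambda>xs. \<integral>\<^sup>+z. indicator A (xs(i := z)) \<partial>P (xs j)) \<in> borel_measurable configs" for i j
    by (rule nn_integral_measurable_subprob_algebra2[OF ind measurable_compose[OF _ measurable_prob_algebraD[OF P_kernel]]]) measurable
  ultimately show ?thesis by simp
qed

sublocale L: jump_kernel configs "particle_kernel F"
  by (rule jump_kernel.intro[OF sets_particle_kernel finite_particle_kernel measurable_particle_kernel])

lemma rate_eq: "L.rate xs = (\<Sum>i\<in>UNIV. mass (xs i))"
  unfolding L.rate_def
  by (rule measure_eq_emeasure_eq_ennreal[OF sum_nonneg emeasure_particle_kernel_space]) (rule mass_nonneg)

lemma config_dist_upd:
  "config_dist (xs(i := u)) (ys(i := v)) =
    (config_dist (xs :: 'n \<Rightarrow> 'a) ys - dist (xs i) (ys i) / real CARD('n)) + dist u v / real CARD('n)"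
proof -
  have "(\<Sum>j\<in>UNIV. dist ((xs(i := u)) j) ((ys(i := v)) j)) = dist u v + (\<Sum>j\<in>UNIV - {i}. dist (xs j) (ys j))"
    by (subst sum.remove[of _ i]) (auto intro!: sum.cong)
  moreover have "(\<Sum>j\<in>UNIV. dist (xs j) (ys j)) = dist (xs i) (ys i) + (\<Sum>j\<in>UNIV - {i}. dist (xs j) (ys j))"
    by (subst sum.remove[of _ i]) auto
  ultimately show ?thesis by (simp add: config_dist_def field_simps)
qed

lemma config_dist_ge: "dist (xs i) (ys i) / real CARD('n) \<le> config_dist (xs :: 'n \<Rightarrow> 'a) ys"
  using member_le_sum[of i UNIV "\<lambda>j. dist (xs j) (ys j)"] by (simp add: config_dist_def divide_right_mono)

lemma config_dist_measurable [measurable]: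
  "(\<lambda>(u, v). config_dist u v) \<in> borel_measurable (configs \<Otimes>\<^sub>M config_space)"
  unfolding config_dist_def by measurable

text \<open>For the partition, each particle is sent to the first point of a dense sequence within
  distance \<open>e / 2\<close>; finitely many labels leave countably many cells.\<close>

lemma separable_config_dist: "separable_cost configs config_dist d_inf"
proof (rule separable_cost.intro)
  show "(\<lambda>(u, v). config_dist u v) \<in> borel_measurable (configs \<Otimes>\<^sub>M config_space)"
    by (rule config_dist_measurable)
  fix u v w :: "'n \<Rightarrow> 'a"
  show "0 \<le> config_dist u v" by (simp add: config_dist_def sum_nonneg)
  have "(\<Sum>i\<in>UNIV. dist (u i) (v i)) \<le> real CARD('n) * d_inf"
    using sum_bounded_above[of UNIV "\<lambda>i. dist (u i) (v i)" d_inf] d_bounded by simp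
  then show "config_dist u v \<le> d_inf"
    by (simp add: config_dist_def divide_le_eq mult.commute)
  have "(\<Sum>i\<in>UNIV. dist (u i) (w i)) \<le> (\<Sum>i\<in>UNIV. dist (u i) (v i) + dist (v i) (w i))"
    by (intro sum_mono dist_triangle)
  then show "config_dist u w \<le> config_dist u v + config_dist v w"
    by (simp add: config_dist_def sum.distrib add_divide_distrib[symmetric] divide_right_mono)
next
  fix e :: real assume e: "0 < e"
  obtain D :: "'a set" where D: "countable D" "\<And>X. open X \<Longrightarrow> X \<noteq> {} \<Longrightarrow> \<exists>x\<in>D. x \<in> X"
    by (rule countable_dense_setE) blast
  define s where "s = from_nat_into D"
  define \<psi> where "\<psi> x = (LEAST k. dist x (s k) < e / 2)" for x :: 'a
  have \<psi>: "dist x (s (\<psi> x)) < e / 2" for x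
  proof -
    obtain y where y: "y \<in> D" "y \<in> ball x (e / 2)"
      using D(2)[of "ball x (e / 2)"] e by auto
    obtain k where "s k = y"
      using from_nat_into_surj[OF D(1) y(1)] unfolding s_def by blast
    then have "dist x (s k) < e / 2" using y by simp
    then show ?thesis unfolding \<psi>_def by (rule LeastI)
  qed
  have [measurable]: "\<psi> \<in> borel \<rightarrow>\<^sub>M count_space UNIV"
    unfolding \<psi>_def by measurable
  let ?\<phi> = "\<lambda>u :: 'n \<Rightarrow> 'a. to_nat (\<lambda>i. \<psi> (u i))"
  show "\<exists>\<phi>\<in>configs \<rightarrow>\<^sub>M count_space (UNIV :: nat set).
      \<forall>u\<in>space config_space. \<forall>v\<in>space config_space. \<phi> u = \<phi> v \<longrightarrow> config_dist u v \<le> e"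
  proof (intro bexI ballI impI)
    fix u v :: "'n \<Rightarrow> 'a" assume "?\<phi> u = ?\<phi> v"
    then have eq: "\<psi> (u i) = \<psi> (v i)" for i by (metis to_nat_split)
    have "dist (u i) (v i) \<le> e" for i
      using \<psi>[of "u i"] \<psi>[of "v i"] dist_triangle2[of "u i" "v i" "s (\<psi> (u i))"] by (simp add: eq)
    then have "(\<Sum>i\<in>UNIV. dist (u i) (v i)) \<le> real CARD('n) * e"
      using sum_bounded_above[of UNIV "\<lambda>i. dist (u i) (v i)" e] by simp
    then show "config_dist u v \<le> e" by (simp add: config_dist_def divide_le_eq mult.commute)
  next
    have "(\<lambda>u i. \<psi> (u i)) \<in> configs \<rightarrow>\<^sub>M count_space UNIV"
    proof -
      have "(\<lambda>u i. \<psi> (u i)) -` {a} \<inter> space config_space \<in> sets configs" for a :: "'n \<Rightarrow> nat"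
      proof -
        have "(\<lambda>u i. \<psi> (u i)) -` {a} \<inter> space config_space = (\<Inter>i\<in>UNIV. {u \<in> space configs. \<psi> (u i) = a i})"
          unfolding fun_eq_iff vimage_def by blast
        also have "\<dots> \<in> sets config_space"
          by (intro sets.finite_INT) measurable
        finally show ?thesis .
      qed
      then show ?thesis
        by (subst measurable_count_space_eq2_countable) auto
    qed
    then show "?\<phi> \<in> configs \<rightarrow>\<^sub>M count_space UNIV"
      by (rule measurable_compose) simp
  qed
qed

end

section \<open>Static couplings of two configurations\<close>

context particle_system
begin

text \<open>The point mass at \<open>a\<close> stands for the jumps of the partner at
  \<open>b\<close>, during which this particle stays. Hence \<open>loaded xs a b\<close> and
  \<open>loaded ys b a\<close> have the same total mass and can be coupled although the rates
  differ.\<close>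

abbreviation loaded :: "('n \<Rightarrow> 'a) \<Rightarrow> 'a \<Rightarrow> 'a \<Rightarrow> 'a measure" where
  "loaded xs a b \<equiv> F a xs \<oplus>\<^sub>\<mu> scale_measure (ennreal (mass b)) (return borel a)"

lemma d_inf_nonneg: "0 \<le> d_inf"
  using d_bounded[of undefined undefined] by simp

text \<open>Equal labels are matched, so the costs \<open>c * dist (xs j) (ys j)\<close> average to
  \<open>c * config_dist xs ys\<close>.\<close>

lemma transport_le_mean_law:
  assumes tr: "\<And>u v. transport_le dist (P u) (P v) (ennreal (c * dist u v + e))" and c: "0 \<le> c" "0 \<le> e"
  shows "transport_le dist (mean_law P xs) (mean_law P ys) (ennreal (c * config_dist (xs :: 'n \<Rightarrow> 'a) ys + e))"
proof -
  have "transport_le dist (sum_measure borel (\<lambda>j. P (xs j)) UNIV) (sum_measure borel (\<lambda>j. P (ys j)) UNIV)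
      (\<Sum>j\<in>UNIV. ennreal (c * dist (xs j) (ys j) + e))"
    by (rule transport_le_sum[OF dist_measurable_pair]) (auto simp: P_sets tr)
  from transport_le_scale[OF dist_measurable_pair this, of "ennreal (1 / real CARD('n))"]
  have "transport_le dist (mean_law P xs) (mean_law P ys)
      (ennreal (1 / real CARD('n)) * (\<Sum>j\<in>UNIV. ennreal (c * dist (xs j) (ys j) + e)))"
    by (simp add: mean_law_def)
  also have "(\<Sum>j\<in>UNIV. ennreal (c * dist (xs j) (ys j) + e)) = ennreal (\<Sum>j\<in>UNIV. c * dist (xs j) (ys j) + e)"
    using c by (intro sum_ennreal) simp
  also have "ennreal (1 / real CARD('n)) * \<dots> = ennreal (1 / real CARD('n) * (\<Sum>j\<in>UNIV. c * dist (xs j) (ys j) + e))"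
    using c by (intro ennreal_mult[symmetric] sum_nonneg) auto
  also have "1 / real CARD('n) * (\<Sum>j\<in>UNIV. c * dist (xs j) (ys j) + e) = c * config_dist xs ys + e"
    by (simp add: config_dist_def sum.distrib sum_distrib_left[symmetric] field_simps)
  finally show ?thesis .
qed

text \<open>Besides the q-parts four pieces are matched: mean-field jumps at the common rate, the
  excess rate of either side against the partner at rest, and the mass left over, which rests on
  both sides.\<close>

lemma transport_le_F:
  assumes q: "transport_le dist (balanced (q a) (q b) a)
      (balanced (q b) (q a) b) (ennreal cq)"
    and P: "transport_le dist (mean_law P (xs :: 'n \<Rightarrow> 'a)) (mean_law P ys) (ennreal cp)"
    and nonneg: "0 \<le> cq" "0 \<le> cp"
  shows "transport_le dist (loaded xs a b) (loaded ys b a)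
      (ennreal (cq + min (\<beta> a) (\<beta> b) * cp + \<bar>\<beta> a - \<beta> b\<bar> * d_inf + min (\<beta> a) (\<beta> b) * dist a b))"
proof -
  define m where "m = min (\<beta> a) (\<beta> b)"
  have m: "0 \<le> m" "m \<le> \<beta> a" "m \<le> \<beta> b" using \<beta>_nonneg by (auto simp: m_def)
  note D = dist_measurable_pair
  have ret: "prob_space (return borel x)" for x :: 'a by (rule prob_space_return) simp
  have t2: "transport_le dist (scale_measure (ennreal m) (mean_law P xs)) (scale_measure (ennreal m) (mean_law P ys)) (ennreal m * ennreal cp)"
    by (rule transport_le_scale[OF D P]) (simp_all add: sets_mean_law)
  have t3: "transport_le dist (scale_measure (ennreal (\<beta> a - m)) (mean_law P xs)) (scale_measure (ennreal (\<beta> a - m)) (return borel b))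
      (ennreal (\<beta> a - m) * ennreal d_inf)"
    by (rule transport_le_scale[OF D transport_le_bounded[OF D]])
      (simp_all add: sets_mean_law prob_space_mean_law ret d_bounded)
  have t4: "transport_le dist (scale_measure (ennreal (\<beta> b - m)) (return borel a)) (scale_measure (ennreal (\<beta> b - m)) (mean_law P ys))
      (ennreal (\<beta> b - m) * ennreal d_inf)"
    by (rule transport_le_scale[OF D transport_le_bounded[OF D]])
      (simp_all add: sets_mean_law prob_space_mean_law ret d_bounded)
  have t5: "transport_le dist (scale_measure (ennreal m) (return borel a)) (scale_measure (ennreal m) (return borel b))
      (ennreal m * ennreal (dist a b))"
    by (rule transport_le_scale[OF D transport_le_return[OF D]]) simp_all
  \<comment> \<open>one of \<open>\<beta> a - m\<close> and \<open>\<beta> b - m\<close> vanishes; keeping both terms avoids a case distinction\<close>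
  note t = transport_le_plus[OF D transport_le_plus[OF D transport_le_plus[OF D transport_le_plus[OF D q t2] t3] t4] t5]
  have eqA: "loaded zs x y =
      balanced (q x) (q y) x \<oplus>\<^sub>\<mu>
      scale_measure (ennreal m) (mean_law P zs) \<oplus>\<^sub>\<mu> scale_measure (ennreal (\<beta> x - m)) (mean_law P zs) \<oplus>\<^sub>\<mu>
      scale_measure (ennreal (\<beta> y - m)) (return borel x) \<oplus>\<^sub>\<mu> scale_measure (ennreal m) (return borel x)"
    (is "?l = ?r") if "m \<le> \<beta> x" "m \<le> \<beta> y" for x y and zs :: "'n \<Rightarrow> 'a"
  proof (rule measure_eqI)
    show "sets ?l = sets ?r" by (simp add: sets_F q_sets)
    fix A assume "A \<in> sets ?l"
    then have A: "A \<in> sets borel" by (simp add: sets_F)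
    have 1: "ennreal (\<beta> x) = ennreal m + ennreal (\<beta> x - m)"
      using that m by (simp add: ennreal_plus[symmetric] del: ennreal_plus)
    have 2: "ennreal (mass y) = emeasure (q y) UNIV + ennreal (\<beta> y - m) + ennreal m"
      using that m by (simp add: emeasure_q_UNIV ennreal_plus[symmetric] del: ennreal_plus)
    have "emeasure ?l A = emeasure (q x) A + ennreal (\<beta> x) * emeasure (mean_law P zs) A + ennreal (mass y) * indicator A x"
      using A by (simp add: emeasure_plus_measure sets_F emeasure_F)
    also have "\<dots> = emeasure ?r A"
      unfolding 1 2 using A
      by (simp add: emeasure_plus_measure q_sets sets_mean_law distrib_right distrib_left ac_simps)
    finally show "emeasure ?l A = emeasure ?r A" .
  qed
  \<comment> \<open>The same decomposition with the third and fourth summands exchanged, because the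
    excess of one side is matched with a point mass on the other.\<close>
  have eqB: "loaded zs x y =
      balanced (q x) (q y) x \<oplus>\<^sub>\<mu>
      scale_measure (ennreal m) (mean_law P zs) \<oplus>\<^sub>\<mu> scale_measure (ennreal (\<beta> y - m)) (return borel x) \<oplus>\<^sub>\<mu>
      scale_measure (ennreal (\<beta> x - m)) (mean_law P zs) \<oplus>\<^sub>\<mu> scale_measure (ennreal m) (return borel x)"
    (is "?l = ?r") if "m \<le> \<beta> x" "m \<le> \<beta> y" for x y and zs :: "'n \<Rightarrow> 'a"
    unfolding eqA[OF that]
    by (rule measure_eqI)
      (simp_all add: emeasure_plus_measure sets_F q_sets sets_mean_law ac_simps)
  have cost: "ennreal cq + ennreal m * ennreal cp + ennreal (\<beta> a - m) * ennreal d_inf + ennreal (\<beta> b - m) * ennreal d_inf +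
      ennreal m * ennreal (dist a b) = ennreal (cq + m * cp + \<bar>\<beta> a - \<beta> b\<bar> * d_inf + m * dist a b)"
  proof -
    have *: "\<bar>\<beta> a - \<beta> b\<bar> * d_inf = (\<beta> a - m) * d_inf + (\<beta> b - m) * d_inf"
      by (simp add: m_def min_def algebra_simps)
    show ?thesis
      unfolding * using m nonneg d_inf_nonneg
      by (simp add: ennreal_mult[symmetric] ennreal_plus[symmetric] add.assoc del: ennreal_plus)
  qed
  show ?thesis
    unfolding eqA[OF m(2,3)] eqB[OF m(3,2)] m_def[symmetric] cost[symmetric]
    by (rule t) (simp_all add: q_sets sets_mean_law)
qed

text \<open>Particles with equal labels move together, so a move at label i carries the unchanged
  distance of all other labels besides its own cost \<open>C i\<close>. Weighting this by the total
  rates gives \<open>config_dist\<close> times the sum of the two rates, and the mass left at rest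
  completes it to \<open>r\<close>.\<close>

lemma transport_le_particle_kernel:
  fixes xs ys :: "'n \<Rightarrow> 'a"
  assumes tr: "\<And>i. transport_le dist (loaded xs (xs i) (ys i)) (loaded ys (ys i) (xs i)) (ennreal (C i))"
    and C: "\<And>i. 0 \<le> C i" and r: "L.rate xs + L.rate ys \<le> r"
  shows "transport_le config_dist
      (L.padded r xs) (L.padded r ys)
      (ennreal (r * config_dist xs ys + (\<Sum>i\<in>UNIV. C i - (mass (xs i) + mass (ys i)) * dist (xs i) (ys i)) / real CARD('n)))"
proof -
  let ?S = configs
  let ?\<mu> = "\<lambda>xs ys i. loaded xs (xs i) (ys i)"
  let ?m = "\<lambda>i. mass (xs i) + mass (ys i)"
  \<comment> \<open>The part of \<open>config_dist\<close> that is due to the labels other than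
    \<open>i\<close>.\<close>
  define A where "A i = config_dist xs ys - dist (xs i) (ys i) / real CARD('n)" for i
  have A: "0 \<le> A i" for i using config_dist_ge[of xs i ys] by (simp add: A_def)
  have spS: "space ?S = UNIV" by (simp add: space_PiM)
  have upd: "(\<lambda>z. zs(i := z)) \<in> ?\<mu> xs ys i \<rightarrow>\<^sub>M ?S" for zs xs ys :: "'n \<Rightarrow> 'a" and i
    using fun_upd_F[of zs i] by (simp add: measurable_cong_sets[OF sets_plus_measure refl])
  have em_\<mu>: "emeasure (?\<mu> xs ys i) B = emeasure (F (xs i) xs) B + ennreal (mass (ys i)) * indicator B (xs i)"
    if "B \<in> sets borel" for B i and xs ys :: "'n \<Rightarrow> 'a"
    using that by (simp add: emeasure_plus_measure sets_F)
  have particle: "transport_le config_dist (distr (?\<mu> xs ys i) ?S (\<lambda>z. xs(i := z))) (distr (?\<mu> ys xs i) ?S (\<lambda>z. ys(i := z)))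
      (ennreal (?m i * A i + C i / real CARD('n)))" for i
  proof -
    obtain \<pi> where \<pi>: "\<pi> \<in> couplings (?\<mu> xs ys i) (?\<mu> ys xs i)" and cost: "transport_cost dist \<pi> \<le> ennreal (C i)"
      using tr[of i] by (rule transport_leE)
    have sets: "sets (?\<mu> xs ys i) = sets borel" "sets (?\<mu> ys xs i) = sets borel" by (simp_all add: sets_F)
    note \<pi>_meas = coupling_cost_measurable[OF dist_measurable_pair \<pi> sets]
    have \<pi>_space: "emeasure \<pi> (space \<pi>) = ennreal (?m i)"
    proof -
      have "emeasure \<pi> (space \<pi>) = emeasure (?\<mu> xs ys i) UNIV"
        using couplings_emeasure(1)[OF \<pi>, of UNIV] couplings_space[OF \<pi>] by (simp add: sets_F space_F)
      also have "\<dots> = ennreal (mass (xs i)) + ennreal (mass (ys i))"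
        by (subst em_\<mu>) (simp_all add: emeasure_F_UNIV)
      also have "\<dots> = ennreal (?m i)"
        by (rule ennreal_plus[OF mass_nonneg mass_nonneg, symmetric])
      finally show ?thesis .
    qed
    let ?f = "\<lambda>(u, v). (xs(i := u), ys(i := v))"
    have f: "?f \<in> \<pi> \<rightarrow>\<^sub>M ?S \<Otimes>\<^sub>M ?S"
    proof -
      have [measurable]: "(\<lambda>z. xs(i := z)) \<in> borel \<rightarrow>\<^sub>M ?S" "(\<lambda>z. ys(i := z)) \<in> borel \<rightarrow>\<^sub>M ?S"
        by (rule measurable_fun_upd_config)+
      show ?thesis unfolding measurable_cong_sets[OF \<pi>_meas(1) refl] by measurable
    qed
    have "transport_cost config_dist (distr \<pi> (?S \<Otimes>\<^sub>M ?S) ?f) =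
        (\<integral>\<^sup>+z. (case ?f z of (u, v) \<Rightarrow> ennreal (config_dist u v)) \<partial>\<pi>)"
      by (rule nn_integral_distr[OF f]) (use config_dist_measurable in measurable)
    also have "\<dots> = (\<integral>\<^sup>+z. ennreal (A i) + ennreal (1 / real CARD('n)) * (case z of (u, v) \<Rightarrow> ennreal (dist u v)) \<partial>\<pi>)"
      using A[of i] by (intro nn_integral_cong)
        (auto simp: config_dist_upd A_def[symmetric] ennreal_mult[symmetric] ennreal_plus[symmetric] simp del: ennreal_plus)
    also have "\<dots> = ennreal (A i) * ennreal (?m i) + ennreal (1 / real CARD('n)) * transport_cost dist \<pi>"
      using \<pi>_meas(2) by (simp add: nn_integral_add nn_integral_cmult \<pi>_space)
    also have "\<dots> \<le> ennreal (A i) * ennreal (?m i) + ennreal (1 / real CARD('n)) * ennreal (C i)"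
      using cost by (intro add_left_mono mult_left_mono) auto
    also have "\<dots> = ennreal (?m i * A i + C i / real CARD('n))"
    proof -
      have "0 \<le> ?m i" by (rule add_nonneg_nonneg[OF mass_nonneg mass_nonneg])
      then show ?thesis
        using A[of i] C[of i] by (simp add: ennreal_mult[symmetric] ennreal_plus[symmetric] mult.commute del: ennreal_plus)
    qed
    finally show ?thesis
      using couplings_distr[OF \<pi> upd[where zs=xs and i=i and xs=xs and ys=ys] upd[where zs=ys and i=i and xs=ys and ys=xs]] unfolding transport_le_def by blast
  qed
  have "transport_le config_dist
     (sum_measure ?S (\<lambda>i. distr (?\<mu> xs ys i) ?S (\<lambda>z. xs(i := z))) UNIV \<oplus>\<^sub>\<mu> scale_measure (ennreal (r - (L.rate xs + L.rate ys))) (return ?S xs))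
     (sum_measure ?S (\<lambda>i. distr (?\<mu> ys xs i) ?S (\<lambda>z. ys(i := z))) UNIV \<oplus>\<^sub>\<mu> scale_measure (ennreal (r - (L.rate xs + L.rate ys))) (return ?S ys))
     ((\<Sum>i\<in>UNIV. ennreal (?m i * A i + C i / real CARD('n))) + ennreal (r - (L.rate xs + L.rate ys)) * ennreal (config_dist xs ys))"
    by (intro transport_le_plus[OF config_dist_measurable] transport_le_sum[OF config_dist_measurable]
        transport_le_scale[OF config_dist_measurable] transport_le_return[OF config_dist_measurable] particle)
      (simp_all add: spS)
  \<comment> \<open>The point masses in \<open>loaded\<close> sum to the rate of the partner
    configuration; with the remaining mass at rest they make up the padding
    \<open>r - L.rate xs\<close>. The identity is applied in both orders.\<close>
  moreover have "sum_measure ?S (\<lambda>i. distr (?\<mu> xs ys i) ?S (\<lambda>z. xs(i := z))) UNIV \<oplus>\<^sub>\<mu> scale_measure (ennreal (r - (L.rate xs + L.rate ys))) (return ?S xs) =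
      L.padded r xs" (is "?l = ?r")
    if r: "L.rate xs + L.rate ys \<le> r" for xs ys :: "'n \<Rightarrow> 'a"
  proof (rule measure_eqI)
    show "sets ?l = sets ?r" by (simp add: L.padded_def sets_particle_kernel)
    fix B assume "B \<in> sets ?l"
    then have B: "B \<in> sets ?S" by simp
    have pre: "(\<lambda>z. xs(i := z)) -` B \<in> sets borel" for i
      using measurable_sets[OF measurable_fun_upd_config B, of xs i] by simp
    have 1: "emeasure (distr (?\<mu> xs ys i) ?S (\<lambda>z. xs(i := z))) B =
        emeasure (F (xs i) xs) ((\<lambda>z. xs(i := z)) -` B) + ennreal (mass (ys i)) * indicator B xs" for i
      by (subst emeasure_distr[OF upd B]) (simp add: space_F em_\<mu>[OF pre], simp add: indicator_def)
    have 2: "emeasure (particle_kernel F xs) B = (\<Sum>i\<in>UNIV. emeasure (F (xs i) xs) ((\<lambda>z. xs(i := z)) -` B))"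
      unfolding particle_kernel_def using B by (simp add: emeasure_sum_measure emeasure_distr[OF fun_upd_F] space_F)
    have "(\<Sum>i\<in>UNIV. ennreal (mass (ys i))) = ennreal (L.rate ys)"
      unfolding rate_eq using mass_nonneg by (intro sum_ennreal)
    then have "(\<Sum>i\<in>UNIV. ennreal (mass (ys i))) + ennreal (r - (L.rate xs + L.rate ys)) = ennreal (r - L.rate xs)"
      using r L.rate_nonneg[of ys] by (simp add: ennreal_plus[symmetric] del: ennreal_plus)
    then show "emeasure ?l B = emeasure ?r B"
      using B by (simp add: L.padded_def emeasure_plus_measure sets_particle_kernel emeasure_sum_measure 1 2 sum.distrib
          sum_distrib_right[symmetric] add.assoc distrib_right[symmetric])
  qed
  note this[OF r] this[of ys xs]
  moreover have "(\<Sum>i\<in>UNIV. ennreal (?m i * A i + C i / real CARD('n))) + ennreal (r - (L.rate xs + L.rate ys)) * ennreal (config_dist xs ys) =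
    ennreal (r * config_dist xs ys + (\<Sum>i\<in>UNIV. C i - ?m i * dist (xs i) (ys i)) / real CARD('n))"
  proof -
    have cd: "0 \<le> config_dist xs ys" by (simp add: config_dist_def sum_nonneg)
    have nn: "0 \<le> ?m i * A i + C i / real CARD('n)" for i
      using A[of i] C[of i] add_nonneg_nonneg[OF mass_nonneg mass_nonneg] by simp
    have "(\<Sum>i\<in>UNIV. ennreal (?m i * A i + C i / real CARD('n))) + ennreal (r - (L.rate xs + L.rate ys)) * ennreal (config_dist xs ys) =
      ennreal ((\<Sum>i\<in>UNIV. ?m i * A i + C i / real CARD('n)) + (r - (L.rate xs + L.rate ys)) * config_dist xs ys)"
      using r cd nn by (simp add: sum_ennreal ennreal_mult[symmetric] ennreal_plus[symmetric] sum_nonneg del: ennreal_plus)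
    also have "(\<Sum>i\<in>UNIV. ?m i * A i + C i / real CARD('n)) =
        (\<Sum>i\<in>UNIV. ?m i * config_dist xs ys + (C i - ?m i * dist (xs i) (ys i)) / real CARD('n))"
      by (intro sum.cong refl) (simp add: A_def field_simps)
    also have "\<dots> = (L.rate xs + L.rate ys) * config_dist xs ys + (\<Sum>i\<in>UNIV. C i - ?m i * dist (xs i) (ys i)) / real CARD('n)"
      unfolding rate_eq by (simp add: sum.distrib sum_distrib_right[symmetric] sum_divide_distrib)
    finally show ?thesis by (simp add: algebra_simps)
  qed
  ultimately show ?thesis using r by (simp add: add.commute[of "L.rate ys"])
qed

text \<open>\<open>K\<close> is the bound on the cost of the q-parts that results when the
  expression under the supremum is at most \<open>s\<close>, multiplied by \<open>dist u v\<close>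
  and solved for that cost. The hypothesis bounds \<open>c * \<beta> x\<close> and not \<beta>
  itself, so that \<open>c = 0\<close> with unbounded \<beta> is covered.\<close>

lemma transport_le_uniformized_kernel:
  fixes xs ys :: "'n \<Rightarrow> 'a" and s b c r e :: real
  defines "K u v \<equiv> (s + measure (q u) UNIV + measure (q v) UNIV + max (\<beta> u) (\<beta> v)) * dist u v - \<bar>\<beta> u - \<beta> v\<bar> * d_inf"
  assumes q: "\<And>u v e. 0 < e \<Longrightarrow> transport_le dist (balanced (q u) (q v) u)
      (balanced (q v) (q u) v) (ennreal (K u v + e))"
    and K: "\<And>u v. 0 \<le> K u v"
    and P: "\<And>u v e. 0 < e \<Longrightarrow> transport_le dist (P u) (P v) (ennreal (c * dist u v + e))"
    and c: "0 \<le> c" and b: "\<And>x. c * \<beta> x \<le> b"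
    and r: "L.rate xs + L.rate ys \<le> r" and e: "0 < e"
  shows "transport_le config_dist
      (L.padded r xs) (L.padded r ys)
      (ennreal ((r + b + s) * config_dist xs ys + e))"
proof -
  let ?N = "real CARD('n)"
  let ?cd = "config_dist xs ys"
  define m where "m i = min (\<beta> (xs i)) (\<beta> (ys i))" for i
  have m: "0 \<le> m i" for i using \<beta>_nonneg by (simp add: m_def)
  have cd: "0 \<le> ?cd" by (simp add: config_dist_def sum_nonneg)
  define B where "B = (\<Sum>i\<in>UNIV. m i)"
  have B: "0 \<le> B" using m by (simp add: B_def sum_nonneg)
  \<comment> \<open>Over all labels the error of the mean laws is multiplied by \<open>B\<close>,
    which may be 0.\<close>
  define e' where "e' = e / (2 * (B + 1))"
  have e': "0 < e'" "B * e' \<le> e / 2" using B e by (simp_all add: e'_def field_simps)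
  define C where "C i = (K (xs i) (ys i) + e / 2) + m i * (c * ?cd + e') + \<bar>\<beta> (xs i) - \<beta> (ys i)\<bar> * d_inf + m i * dist (xs i) (ys i)" for i
  have C: "0 \<le> C i" for i
    using K[of "xs i" "ys i"] e e' c cd m[of i] d_inf_nonneg by (simp add: C_def)
  have tr: "transport_le dist (loaded xs (xs i) (ys i)) (loaded ys (ys i) (xs i)) (ennreal (C i))" for i
    unfolding C_def m_def using e e' K[of "xs i" "ys i"] c cd
    by (intro transport_le_F q transport_le_mean_law P) auto
  \<comment> \<open>The excess cost cancels the term with \<open>d_inf\<close> in \<open>K\<close>.
    The mass at rest and the maximum in \<open>K\<close> add up to the two values of \<beta>, since
    maximum plus minimum is the sum; so they cancel the \<beta>-part of the masses.\<close>
  have "C i - (mass (xs i) + mass (ys i)) * dist (xs i) (ys i) = s * dist (xs i) (ys i) + e / 2 + m i * (c * ?cd + e')" for i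
  proof -
    have "max (\<beta> (xs i)) (\<beta> (ys i)) + m i = \<beta> (xs i) + \<beta> (ys i)" by (simp add: m_def min_def max_def)
    then have "m i = \<beta> (xs i) + \<beta> (ys i) - max (\<beta> (xs i)) (\<beta> (ys i))" by simp
    then have "m i * dist (xs i) (ys i) = (\<beta> (xs i) + \<beta> (ys i) - max (\<beta> (xs i)) (\<beta> (ys i))) * dist (xs i) (ys i)" by simp
    then show ?thesis unfolding C_def K_def by (simp add: algebra_simps)
  qed
  then have "(\<Sum>i\<in>UNIV. C i - (mass (xs i) + mass (ys i)) * dist (xs i) (ys i)) / ?N =
      (s * (\<Sum>i\<in>UNIV. dist (xs i) (ys i)) + ?N * (e / 2) + B * (c * ?cd + e')) / ?N"
    by (simp add: sum.distrib sum_distrib_left[symmetric] sum_distrib_right[symmetric] B_def)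
  also have "\<dots> = s * ?cd + e / 2 + (B * c * ?cd + B * e') / ?N"
    by (simp add: config_dist_def field_simps)
  also have "\<dots> \<le> s * ?cd + e / 2 + (?N * b * ?cd + ?N * (e / 2)) / ?N"
  proof -
    \<comment> \<open>Here the supremum of \<beta> enters: the average of \<open>c * m i\<close>
      over the labels is at most \<open>b\<close>.\<close>
    have "c * B = (\<Sum>i\<in>UNIV. c * m i)" by (simp add: B_def sum_distrib_left)
    also have "\<dots> \<le> (\<Sum>i\<in>(UNIV :: 'n set). b)"
    proof (rule sum_mono)
      fix i
      have "c * m i \<le> c * \<beta> (xs i)" using c by (intro mult_left_mono) (auto simp: m_def)
      then show "c * m i \<le> b" using b[of "xs i"] by simp
    qed
    finally have "B * c * ?cd \<le> ?N * b * ?cd" using cd by (intro mult_right_mono) (auto simp: mult.commute)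
    moreover have "e / 2 \<le> ?N * (e / 2)"
      using e mult_right_mono[of 1 ?N "e / 2"] by simp
    ultimately show ?thesis using e'(2) by (intro add_left_mono divide_right_mono) auto
  qed
  also have "\<dots> = (b + s) * ?cd + e" by (simp add: field_simps)
  finally show ?thesis
    using transport_le_particle_kernel[OF tr C r] by (elim transport_le_mono) (auto intro!: ennreal_leI simp: algebra_simps)
qed

lemma contracts:
  fixes \<Omega> :: "('n \<Rightarrow> 'a) \<Rightarrow> 'w measure"
  fixes s b c :: real
  defines "K u v \<equiv> (s + measure (q u) UNIV + measure (q v) UNIV + max (\<beta> u) (\<beta> v)) * dist u v - \<bar>\<beta> u - \<beta> v\<bar> * d_inf"
  assumes q: "\<And>u v e. 0 < e \<Longrightarrow> transport_le dist (balanced (q u) (q v) u)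
      (balanced (q v) (q u) v) (ennreal (K u v + e))"
    and K: "\<And>u v. 0 \<le> K u v"
    and P: "\<And>u v e. 0 < e \<Longrightarrow> transport_le dist (P u) (P v) (ennreal (c * dist u v + e))"
    and c: "0 \<le> c" and b: "\<And>x. c * \<beta> x \<le> b"
    and process: "\<And>x. nonexplosive_jump_process (\<Omega> x) config_space (particle_kernel F) x (T x) (Y x) (X x)"
  shows "contracts_at_rate config_dist (\<lambda>t x. distr (\<Omega> x) config_space (X x t)) (ereal (- b - s))"
  unfolding contracts_at_rate_def
proof (intro allI impI)
  fix t :: real and x y :: "'n \<Rightarrow> 'a" assume t: "0 \<le> t"
  have "wasserstein config_dist (distr (\<Omega> x) config_space (X x t)) (distr (\<Omega> y) config_space (X y t)) \<le>
      ennreal (exp (- (- b - s) * t) * config_dist x y)"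
  proof (rule jump_process_contraction[OF separable_config_dist L.jump_kernel_axioms process process _ _ t])
    fix u v :: "'n \<Rightarrow> 'a" and r e :: real
    assume "L.rate u + L.rate v \<le> r" "0 < e"
    from transport_le_uniformized_kernel[OF q[unfolded K_def] K[unfolded K_def] P c b this]
    show "transport_le config_dist (L.padded r u) (L.padded r v) (ennreal ((r - (- b - s)) * config_dist u v + e))"
      by (simp add: algebra_simps)
  qed (simp_all add: space_PiM)
  also have "\<dots> = exp_decay (ereal (- b - s)) t * ennreal (config_dist x y)"
    unfolding exp_decay_simps by (rule ennreal_mult) (simp_all add: config_dist_def sum_nonneg)
  finally show "wasserstein config_dist (distr (\<Omega> x) config_space (X x t)) (distr (\<Omega> y) config_space (X y t)) \<le>
      exp_decay (ereal (- b - s)) t * ennreal (config_dist x y)" .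
qed

end

theorem corollary4p3:
  fixes q P :: "'a::polish_space \<Rightarrow> 'a measure" and \<beta> :: "'a \<Rightarrow> real" and d_inf :: real
    and \<Omega> :: "('n::finite \<Rightarrow> 'a) \<Rightarrow> 'w measure"
    and T :: "('n \<Rightarrow> 'a) \<Rightarrow> nat \<Rightarrow> 'w \<Rightarrow> ereal"
    and Y :: "('n \<Rightarrow> 'a) \<Rightarrow> nat \<Rightarrow> 'w \<Rightarrow> ('n \<Rightarrow> 'a)"
    and X :: "('n \<Rightarrow> 'a) \<Rightarrow> real \<Rightarrow> 'w \<Rightarrow> ('n \<Rightarrow> 'a)"
    and \<theta> :: ereal
  assumes d_bounded: "\<And>x y :: 'a. dist x y \<le> d_inf"
    and q_sets: "\<And>x. sets (q x) = sets borel"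
    and q_finite: "\<And>x. finite_measure (q x)"
    and q_kernel: "\<And>A. A \<in> sets borel \<Longrightarrow> (\<lambda>x. emeasure (q x) A) \<in> borel_measurable borel"
    and \<beta>_measurable: "\<beta> \<in> borel_measurable borel"
    and \<beta>_nonneg: "\<And>x. 0 \<le> \<beta> x"
    and P_kernel: "P \<in> measurable borel (prob_algebra borel)"
    and process: "\<And>x. nonexplosive_jump_process (\<Omega> x) config_space
        (particle_kernel (interaction_kernel q \<beta> P)) x (T x) (Y x) (X x)"
    and \<theta>_def: "\<theta> = (INF (x, y)\<in>{(x, y). x \<noteq> y}. discrete_curvature P x y)"
    and \<theta>_nonneg: "0 \<le> \<theta>"
  shows "coarse_ricci_curvature config_dist (\<lambda>t x. distr (\<Omega> x) config_space (X x t))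
    \<ge> - ((1 - \<theta>) * (SUP x. ereal (\<beta> x)))
      - (SUP (x, y)\<in>{(x, y). x \<noteq> y}.
           J_functional x y (q x) (q y) / ereal (dist x y)
           + ereal (\<bar>\<beta> x - \<beta> y\<bar> / dist x y * d_inf)
           - ereal (max (\<beta> x) (\<beta> y)))"
proof -
  interpret particle_system q P \<beta> d_inf "TYPE('n)"
    by (rule particle_system.intro[OF d_bounded q_sets q_finite q_kernel \<beta>_measurable \<beta>_nonneg P_kernel])
  define B where "B = (SUP x. ereal (\<beta> x))"
  define g where "g x y = J_functional x y (q x) (q y) / ereal (dist x y) + ereal (\<bar>\<beta> x - \<beta> y\<bar> / dist x y * d_inf)
    - ereal (max (\<beta> x) (\<beta> y))" for x y
  define G where "G = (SUP (x, y)\<in>{(x, y). x \<noteq> y}. g x y)"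
  let ?law = "\<lambda>t x. distr (\<Omega> x) config_space (X x t)"
  have "- ((1 - \<theta>) * B) - G \<le> coarse_ricci_curvature config_dist ?law"
  proof (cases "\<exists>x y :: 'a. x \<noteq> y")
    \<comment> \<open>On a single point both extrema run over the empty set. All configurations
      coincide, so the curvature is \<infinity> and any lower bound holds.\<close>
    case False
    have "contracts_at_rate config_dist ?law \<infinity>"
      unfolding contracts_at_rate_def
    proof (intro allI impI)
      fix t :: real and x y :: "'n \<Rightarrow> 'a" assume "0 \<le> t"
      have xy: "x = y" using False by (auto simp: fun_eq_iff)
      have "transport_le config_dist (?law t x) (?law t x) 0"
        by (rule transport_le_refl) (use config_dist_measurable in \<open>simp_all add: config_dist_def cong: sets_pair_measure_cong measurable_cong_sets\<close>)
      then have "wasserstein config_dist (?law t x) (?law t x) \<le> 0" by (rule wasserstein_le_transport)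
      then show "wasserstein config_dist (?law t x) (?law t y) \<le> exp_decay \<infinity> t * ennreal (config_dist x y)"
        by (simp add: xy)
    qed
    then have "\<infinity> \<le> coarse_ricci_curvature config_dist ?law"
      unfolding coarse_ricci_curvature_def by (intro Sup_upper) simp
    then show ?thesis by simp
  next
    case True
    then obtain x0 y0 :: 'a where xy0: "x0 \<noteq> y0" by blast
    have curv: "\<theta> \<le> discrete_curvature P u v" if "u \<noteq> v" for u v
      unfolding \<theta>_def using that by (intro INF_lower2[of "(u, v)"]) auto
    \<comment> \<open>An infinite cost would make the curvature \<open>- \<infinity>\<close>,
      against \<open>0 \<le> \<theta>\<close>.\<close>
    have W_real: "\<exists>w\<ge>0. wasserstein dist (P u) (P v) = ennreal w \<and> discrete_curvature P u v = ereal (1 - w / dist u v)"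
      if "u \<noteq> v" for u v
    proof (cases "wasserstein dist (P u) (P v)")
      case (real w)
      then show ?thesis using that by (intro exI[of _ w]) (simp add: discrete_curvature_def one_ereal_def)
    next
      case top
      then have "discrete_curvature P u v = - \<infinity>"
        using that by (simp add: discrete_curvature_def one_ereal_def)
      then show ?thesis using curv[OF that] \<theta>_nonneg by simp
    qed
    \<comment> \<open>Costs are nonnegative and a pair of distinct points exists, so \<theta> is at
      most 1 and hence finite.\<close>
    obtain \<theta>' where \<theta>': "\<theta> = ereal \<theta>'" "0 \<le> \<theta>'" "\<theta>' \<le> 1"
    proof -
      obtain w where "0 \<le> w" "discrete_curvature P x0 y0 = ereal (1 - w / dist x0 y0)"
        using W_real[OF xy0] by blast
      then have "\<theta> \<le> ereal (1 - w / dist x0 y0)" "1 - w / dist x0 y0 \<le> 1"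
        using curv[OF xy0] by auto
      then show ?thesis using \<theta>_nonneg that by (cases \<theta>) auto
    qed
    have P: "transport_le dist (P u) (P v) (ennreal ((1 - \<theta>') * dist u v + e))" if e: "0 < e" for u v e
    proof (cases "u = v")
      case True
      have "transport_le dist (P u) (P u) 0"
        by (rule transport_le_refl) (simp_all add: P_sets cong: sets_pair_measure_cong measurable_cong_sets)
      then show ?thesis using True by (auto elim: transport_le_mono)
    next
      case False
      obtain w where w: "0 \<le> w" "wasserstein dist (P u) (P v) = ennreal w" "discrete_curvature P u v = ereal (1 - w / dist u v)"
        using W_real[OF False] by blast
      have "w \<le> (1 - \<theta>') * dist u v"
        using curv[OF False] False by (simp add: w(3) \<theta>'(1) field_simps)
      then show ?thesis
        using w(1) e by (intro transport_le_wasserstein) (simp only: w(2), intro ennreal_lessI, auto)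
    qed
    \<comment> \<open>An infinite cost in J makes \<open>g\<close> equal to \<infinity>. In either
      case \<open>g\<close> is not \<open>- \<infinity>\<close>, so neither is the supremum.\<close>
    have g_real: "\<exists>w. 0 \<le> w \<and> wasserstein dist (balanced (q u) (q v) u)
        (balanced (q v) (q u) v) = ennreal w \<and>
        g u v = ereal ((w - (measure (q u) UNIV + measure (q v) UNIV) * dist u v) / dist u v +
          \<bar>\<beta> u - \<beta> v\<bar> / dist u v * d_inf - max (\<beta> u) (\<beta> v)) \<or> g u v = \<infinity>"
      if "u \<noteq> v" for u v
    proof (cases "wasserstein dist (balanced (q u) (q v) u)
        (balanced (q v) (q u) v)")
      case (real w)
      then show ?thesis using that by (intro exI[of _ w]) (simp add: g_def J_functional_def del: ereal_max)
    next
      case top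
      then show ?thesis using that by (intro exI disjI2) (simp add: g_def J_functional_def)
    qed
    have g_le: "g u v \<le> G" if "u \<noteq> v" for u v
      unfolding G_def using that by (intro SUP_upper2[of "(u, v)"]) auto
    have G: "G \<noteq> - \<infinity>"
      using g_real[OF xy0] g_le[OF xy0] by auto
    have B: "ereal (\<beta> x) \<le> B" for x unfolding B_def by (rule SUP_upper) simp
    have B0: "0 \<le> B" using B[of x0] \<beta>_nonneg[of x0] by (meson ereal_less_eq(5) order_trans)
    have cB: "0 \<le> (1 - \<theta>) * B" using B0 \<theta>' by (simp add: one_ereal_def)
    \<comment> \<open>If one term is infinite, the claimed bound is \<open>- \<infinity>\<close>. By
      \<open>0 * \<infinity> = 0\<close> the product stays finite for \<theta> = 1 even if \<beta>
      is unbounded.\<close>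
    show ?thesis
    proof (cases "(1 - \<theta>) * B = \<infinity> \<or> G = \<infinity>")
      case True
      then have "- ((1 - \<theta>) * B) - G = - \<infinity>"
        using G cB by (cases "(1 - \<theta>) * B"; cases G) auto
      then show ?thesis by simp
    next
      case False
      then obtain b s where b: "(1 - \<theta>) * B = ereal b" and s: "G = ereal s"
        using G cB by (cases "(1 - \<theta>) * B"; cases G) auto
      have \<beta>_le: "(1 - \<theta>') * \<beta> x \<le> b" for x
      proof -
        have "(1 - \<theta>) * ereal (\<beta> x) \<le> (1 - \<theta>) * B"
          using \<theta>' by (intro ereal_mult_left_mono B) (simp add: one_ereal_def)
        then show ?thesis unfolding b by (simp add: \<theta>' one_ereal_def)
      qed
      \<comment> \<open>Solving \<open>g u v \<le> s\<close> for the Wasserstein distance in J gives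
        this bound.\<close>
      define K where "K u v = (s + measure (q u) UNIV + measure (q v) UNIV + max (\<beta> u) (\<beta> v)) * dist u v -
        \<bar>\<beta> u - \<beta> v\<bar> * d_inf" for u v
      have K: "\<exists>w. 0 \<le> w \<and> w \<le> K u v \<and> wasserstein dist (balanced (q u) (q v) u)
        (balanced (q v) (q u) v) = ennreal w" if "u \<noteq> v" for u v
      proof -
        from g_real[OF that] g_le[OF that] s obtain w where w: "0 \<le> w" "wasserstein dist (balanced (q u) (q v) u)
          (balanced (q v) (q u) v) = ennreal w"
          "g u v = ereal ((w - (measure (q u) UNIV + measure (q v) UNIV) * dist u v) / dist u v +
            \<bar>\<beta> u - \<beta> v\<bar> / dist u v * d_inf - max (\<beta> u) (\<beta> v))"
          by auto
        have "(w - (measure (q u) UNIV + measure (q v) UNIV) * dist u v) / dist u v +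
            \<bar>\<beta> u - \<beta> v\<bar> / dist u v * d_inf - max (\<beta> u) (\<beta> v) \<le> s"
          using g_le[OF that] by (simp add: w(3) s)
        then have "((w - (measure (q u) UNIV + measure (q v) UNIV) * dist u v) / dist u v +
            \<bar>\<beta> u - \<beta> v\<bar> / dist u v * d_inf - max (\<beta> u) (\<beta> v)) * dist u v \<le> s * dist u v"
          by (intro mult_right_mono) auto
        also have "((w - (measure (q u) UNIV + measure (q v) UNIV) * dist u v) / dist u v +
            \<bar>\<beta> u - \<beta> v\<bar> / dist u v * d_inf - max (\<beta> u) (\<beta> v)) * dist u v =
            w - (measure (q u) UNIV + measure (q v) UNIV) * dist u v + \<bar>\<beta> u - \<beta> v\<bar> * d_inf - max (\<beta> u) (\<beta> v) * dist u v"
          using that by (simp add: field_simps)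
        finally have "w \<le> K u v" by (simp add: K_def distrib_right)
        then show ?thesis using w by blast
      qed
      \<comment> \<open>Off the diagonal \<open>K\<close> dominates a nonnegative cost; on it both
        of its terms vanish.\<close>
      have K_nonneg: "0 \<le> K u v" for u v
        using K[of u v] by (cases "u = v") (auto simp: K_def intro: order_trans)
      have q: "transport_le dist (balanced (q u) (q v) u)
        (balanced (q v) (q u) v) (ennreal (K u v + e))" if e: "0 < e" for u v e
      proof (cases "u = v")
        case True
        let ?\<mu> = "balanced (q u) (q u) u"
        have "transport_le dist ?\<mu> ?\<mu> 0"
          by (rule transport_le_refl) (simp_all add: q_sets cong: sets_pair_measure_cong measurable_cong_sets)
        then show ?thesis using True by (auto elim: transport_le_mono)
      next
        case False
        from K[OF this] obtain w where w: "0 \<le> w" "w \<le> K u v" and W: "wasserstein dist (balanced (q u) (q v) u)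
          (balanced (q v) (q u) v) = ennreal w" by blast
        show ?thesis
          using w e by (intro transport_le_wasserstein) (simp only: W, intro ennreal_lessI, auto)
      qed
      have "contracts_at_rate config_dist ?law (ereal (- b - s))"
        by (rule contracts[OF q[unfolded K_def] K_nonneg[unfolded K_def] P _ \<beta>_le process]) (use \<theta>' in auto)
      then have "ereal (- b - s) \<le> coarse_ricci_curvature config_dist ?law"
        unfolding coarse_ricci_curvature_def by (intro Sup_upper) simp
      then show ?thesis by (simp add: b s)
    qed
  qed
  then show ?thesis by (simp add: B_def G_def g_def)
qed

end
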